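(* Let $A$ be the CQG algebra of a compact matrix quantum group. Then the outer automorphism group $\mathrm{Out}(A)=\mathrm{Aut}(A)/\mathrm{Aut}_\chi(A)$, with the quotient topology, is discrete.
   Context: A compact quantum group $G$ is given by a unital $C^*$-algebra with a coassociative comultiplication $\Delta$ satisfying Woronowicz's density conditions. Its CQG algebra $A$ is the dense Hopf $*$-algebra spanned by matrix coefficients of the irreducible finite-dimensional unitary representations of $G$; $\mathrm{Irr}(G)$ is the set of equivalence classes of irreducible representations, and $\overline{A}$ is the full (universal) enveloping $C^*$-algebra of $A$. $G$ is a compact matrix quantum group if it has a finite-dimensional unitary representation whose matrix coefficients generate the $C^*$-algebra. $\mathrm{Aut}(A)$ is the group of comultiplication-preserving $*$-automorphisms of $\overline{A}$, equivalently (by restriction to $A$) the group of Hopf $*$-algebra automorphisms of $A$. It is a topological group with basic identity neighborhoods $\{\alpha : \|\alpha(a_i)-a_i\|<\varepsilon,\ i=1,\dots,n\}$ for $a_1,\dots,a_n\in A$ and $\varepsilon>0$, where the norm is that of $\overline{A}$. The inner automorphism group $\mathrm{Aut}_\chi(A)$ is the normal subgroup of those $\alpha\in\mathrm{Aut}(A)$ with $\alpha(\chi_V)=\chi_V$ for the character $\chi_V\in A$ of every $V\in\mathrm{Irr}(G)$. *)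

theory Defs
  imports "HOL-Analysis.Analysis" "HOL-Algebra.Bij" "HOL-Algebra.Coset"
begin

section \<open>Unital C*-algebras\<close>

text \<open>The zero algebra is excluded, because \<^class>\<open>real_normed_algebra_1\<close> has norm 1 = 1.\<close>

class cstar_algebra = real_normed_algebra_1 + complete_space +
  fixes scaleC :: "complex \<Rightarrow> 'a \<Rightarrow> 'a" (infixr "*\<^sub>C" 75)
    and star :: "'a \<Rightarrow> 'a"
  assumes scaleC_of_real: "complex_of_real r *\<^sub>C x = r *\<^sub>R x"
    and scaleC_add_right: "c *\<^sub>C (x + y) = c *\<^sub>C x + c *\<^sub>C y"
    and scaleC_add_left: "(c + d) *\<^sub>C x = c *\<^sub>C x + d *\<^sub>C x"
    and scaleC_scaleC: "c *\<^sub>C d *\<^sub>C x = (c * d) *\<^sub>C x"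
    and mult_scaleC_left: "(c *\<^sub>C x) * y = c *\<^sub>C (x * y)"
    and mult_scaleC_right: "x * (c *\<^sub>C y) = c *\<^sub>C (x * y)"
    and norm_scaleC: "norm (c *\<^sub>C x) = cmod c * norm x"
    and star_star: "star (star x) = x"
    and star_add: "star (x + y) = star x + star y"
    and star_scaleC: "star (c *\<^sub>C x) = cnj c *\<^sub>C star x"
    and star_mult: "star (x * y) = star y * star x"
    and cstar_identity: "norm (star x * x) = (norm x)\<^sup>2"

lemma scaleC_one: "1 *\<^sub>C (x :: 'a :: cstar_algebra) = x"
  using scaleC_of_real[of 1 x] by simp

global_interpretation complex_vector: vector_space "scaleC :: complex \<Rightarrow> 'a \<Rightarrow> 'a :: cstar_algebra"
  defines cspan = "complex_vector.span"
    and csubspace = "complex_vector.subspace"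
    and cdependent = "complex_vector.dependent"
  by unfold_locales (simp_all add: scaleC_add_right scaleC_add_left scaleC_scaleC scaleC_one)

definition star_hom :: "('a :: cstar_algebra \<Rightarrow> 'b :: cstar_algebra) \<Rightarrow> bool" where
  "star_hom f \<longleftrightarrow>
     (\<forall>x y. f (x + y) = f x + f y) \<and> (\<forall>c x. f (c *\<^sub>C x) = c *\<^sub>C f x) \<and>
     (\<forall>x y. f (x * y) = f x * f y) \<and> (\<forall>x. f (star x) = star (f x)) \<and> f 1 = 1"

definition star_subalgebra :: "'a :: cstar_algebra set \<Rightarrow> bool" where
  "star_subalgebra A \<longleftrightarrow>
     csubspace A \<and> 1 \<in> A \<and> (\<forall>x\<in>A. \<forall>y\<in>A. x * y \<in> A) \<and> (\<forall>x\<in>A. star x \<in> A)"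

definition state :: "('a :: cstar_algebra \<Rightarrow> complex) \<Rightarrow> bool" where
  "state \<phi> \<longleftrightarrow>
     (\<forall>x y. \<phi> (x + y) = \<phi> x + \<phi> y) \<and> (\<forall>c x. \<phi> (c *\<^sub>C x) = c * \<phi> x) \<and>
     (\<forall>x. \<phi> (star x * x) \<in> \<real>\<^sub>\<ge>\<^sub>0) \<and> \<phi> 1 = 1"


section \<open>Minimal tensor products\<close>

definition elementary_tensors ::
    "('a :: cstar_algebra \<Rightarrow> 'b :: cstar_algebra \<Rightarrow> 'c :: cstar_algebra) \<Rightarrow> 'a set \<Rightarrow> 'b set \<Rightarrow> 'c set" where
  "elementary_tensors T A B = {T a b | a b. a \<in> A \<and> b \<in> B}"

text \<open>The functional \<open>\<phi> \<otimes> \<psi>\<close> on the algebraic tensor product. If \<open>T\<close> exhibits its span as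
  the algebraic tensor product, the value does not depend on the chosen presentation of \<open>z\<close>.\<close>

definition tensor_functional ::
    "('a :: cstar_algebra \<Rightarrow> 'b :: cstar_algebra \<Rightarrow> 'c :: cstar_algebra) \<Rightarrow>
     ('a \<Rightarrow> complex) \<Rightarrow> ('b \<Rightarrow> complex) \<Rightarrow> 'c \<Rightarrow> complex" where
  "tensor_functional T \<phi> \<psi> z =
     (\<Sum>(a, b)\<leftarrow>(SOME xs. z = (\<Sum>(a, b)\<leftarrow>xs. T a b)). \<phi> a * \<psi> b)"

text \<open>The values \<open>\<parallel>(\<pi>\<^sub>\<phi> \<otimes> \<pi>\<^sub>\<psi>)(x) \<eta>\<parallel>\<^sup>2 / \<parallel>\<eta>\<parallel>\<^sup>2\<close>, where \<open>\<pi>\<^sub>\<phi>\<close> and \<open>\<pi>\<^sub>\<psi>\<close> are the GNS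
  representations of states \<open>\<phi>\<close> and \<open>\<psi>\<close>, and \<open>\<eta>\<close> is the vector given by an element \<open>y\<close> of the
  algebraic tensor product; \<open>T a b\<close> stands for \<open>a \<otimes> b\<close>. Their supremum is the square of the
  minimal (spatial) C*-norm of \<open>x\<close>.\<close>

definition spatial_quotients ::
    "('a :: cstar_algebra \<Rightarrow> 'b :: cstar_algebra \<Rightarrow> 'c :: cstar_algebra) \<Rightarrow> 'c \<Rightarrow> real set" where
  "spatial_quotients T x =
     {Re (tensor_functional T \<phi> \<psi> (star y * star x * x * y)) /
      Re (tensor_functional T \<phi> \<psi> (star y * y)) | \<phi> \<psi> y.
      state \<phi> \<and> state \<psi> \<and> y \<in> cspan (elementary_tensors T UNIV UNIV) \<and>
      tensor_functional T \<phi> \<psi> (star y * y) \<noteq> 0}"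

text \<open>\<open>T\<close> exhibits \<open>'c\<close> as the minimal C*-tensor product of \<open>'a\<close> and \<open>'b\<close>: it is bilinear and
  compatible with the *-algebra structures, the induced map from the algebraic tensor product is
  injective, its image is dense, and the norm on the image is the minimal one.\<close>

definition minimal_tensor_product ::
    "('a :: cstar_algebra \<Rightarrow> 'b :: cstar_algebra \<Rightarrow> 'c :: cstar_algebra) \<Rightarrow> bool" where
  "minimal_tensor_product T \<longleftrightarrow>
     (\<forall>a a' b. T (a + a') b = T a b + T a' b) \<and>
     (\<forall>a b b'. T a (b + b') = T a b + T a b') \<and>
     (\<forall>c a b. T (c *\<^sub>C a) b = c *\<^sub>C T a b \<and> T a (c *\<^sub>C b) = c *\<^sub>C T a b) \<and>
     (\<forall>a a' b b'. T a b * T a' b' = T (a * a') (b * b')) \<and>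
     (\<forall>a b. star (T a b) = T (star a) (star b)) \<and>
     T 1 1 = 1 \<and>
     (\<forall>B f. finite B \<and> \<not> cdependent B \<and> (\<Sum>b\<in>B. T (f b) b) = 0 \<longrightarrow> (\<forall>b\<in>B. f b = 0)) \<and>
     closure (cspan (elementary_tensors T UNIV UNIV)) = UNIV \<and>
     (\<forall>x\<in>cspan (elementary_tensors T UNIV UNIV).
        bdd_above (spatial_quotients T x) \<and> (norm x)\<^sup>2 = Sup (spatial_quotients T x))"


section \<open>Compact quantum groups and their representations\<close>

text \<open>The types \<open>'b\<close> and \<open>'c\<close> are the minimal tensor square and cube of \<open>'a\<close>, with \<open>T a b\<close>
  for \<open>a \<otimes> b\<close>, \<open>L z a\<close> for \<open>z \<otimes> a\<close> and \<open>R a z\<close> for \<open>a \<otimes> z\<close> (\<open>z\<close> in the tensor square).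
  The maps \<open>F\<close> and \<open>G\<close> are the continuous extensions of \<open>\<Delta> \<otimes> id\<close> and \<open>id \<otimes> \<Delta>\<close>, so the
  existential clause is coassociativity; the last two clauses are the density conditions.\<close>

definition compact_quantum_group ::
    "('a :: cstar_algebra \<Rightarrow> 'a \<Rightarrow> 'b :: cstar_algebra) \<Rightarrow>
     ('b \<Rightarrow> 'a \<Rightarrow> 'c :: cstar_algebra) \<Rightarrow> ('a \<Rightarrow> 'b \<Rightarrow> 'c) \<Rightarrow> ('a \<Rightarrow> 'b) \<Rightarrow> bool" where
  "compact_quantum_group T L R \<Delta> \<longleftrightarrow>
     minimal_tensor_product T \<and> minimal_tensor_product L \<and> minimal_tensor_product R \<and>
     (\<forall>a b c. L (T a b) c = R a (T b c)) \<and>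
     star_hom \<Delta> \<and>
     (\<exists>F G. bounded_linear F \<and> (\<forall>a b. F (T a b) = L (\<Delta> a) b) \<and>
            bounded_linear G \<and> (\<forall>a b. G (T a b) = R a (\<Delta> b)) \<and>
            (\<forall>a. F (\<Delta> a) = G (\<Delta> a))) \<and>
     closure (cspan {\<Delta> a * T 1 b | a b. True}) = UNIV \<and>
     closure (cspan {\<Delta> a * T b 1 | a b. True}) = UNIV"

text \<open>An \<open>n\<close>-dimensional representation is an \<open>n \<times> n\<close> matrix \<open>u\<close> over \<open>'a\<close>; only the entries
  \<open>u i j\<close> with \<open>i, j < n\<close> matter.\<close>

definition unitary_rep ::
    "('a :: cstar_algebra \<Rightarrow> 'a \<Rightarrow> 'b :: cstar_algebra) \<Rightarrow> ('a \<Rightarrow> 'b) \<Rightarrow>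
     nat \<Rightarrow> (nat \<Rightarrow> nat \<Rightarrow> 'a) \<Rightarrow> bool" where
  "unitary_rep T \<Delta> n u \<longleftrightarrow>
     (\<forall>i<n. \<forall>j<n. \<Delta> (u i j) = (\<Sum>k<n. T (u i k) (u k j))) \<and>
     (\<forall>i<n. \<forall>j<n. (\<Sum>k<n. star (u k i) * u k j) = (if i = j then 1 else 0)) \<and>
     (\<forall>i<n. \<forall>j<n. (\<Sum>k<n. u i k * star (u j k)) = (if i = j then 1 else 0))"

text \<open>Vectors of \<open>\<complex>\<^sup>n\<close> are functions on \<^typ>\<open>nat\<close> vanishing outside \<open>{..<n}\<close>. The last clause
  says that the coaction \<open>e\<^sub>j \<mapsto> \<Sum>\<^sub>i e\<^sub>i \<otimes> u\<^sub>i\<^sub>j\<close> maps \<open>W\<close> into the algebraic tensor product of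
  \<open>W\<close> and \<open>'a\<close>.\<close>

definition invariant_subspace ::
    "nat \<Rightarrow> (nat \<Rightarrow> nat \<Rightarrow> 'a :: cstar_algebra) \<Rightarrow> (nat \<Rightarrow> complex) set \<Rightarrow> bool" where
  "invariant_subspace n u W \<longleftrightarrow>
     W \<subseteq> {w. \<forall>i\<ge>n. w i = 0} \<and> (\<lambda>_. 0) \<in> W \<and>
     (\<forall>v\<in>W. \<forall>w\<in>W. (\<lambda>i. v i + w i) \<in> W) \<and> (\<forall>c. \<forall>w\<in>W. (\<lambda>i. c * w i) \<in> W) \<and>
     (\<forall>w\<in>W. \<exists>(m :: nat) v a. (\<forall>r<m. v r \<in> W) \<and>
        (\<forall>i<n. (\<Sum>j<n. w j *\<^sub>C u i j) = (\<Sum>r<m. v r i *\<^sub>C a r)))"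

definition irreducible_unitary_rep ::
    "('a :: cstar_algebra \<Rightarrow> 'a \<Rightarrow> 'b :: cstar_algebra) \<Rightarrow> ('a \<Rightarrow> 'b) \<Rightarrow>
     nat \<Rightarrow> (nat \<Rightarrow> nat \<Rightarrow> 'a) \<Rightarrow> bool" where
  "irreducible_unitary_rep T \<Delta> n u \<longleftrightarrow>
     unitary_rep T \<Delta> n u \<and> n > 0 \<and>
     (\<forall>W. invariant_subspace n u W \<longrightarrow> W = {\<lambda>_. 0} \<or> W = {w. \<forall>i\<ge>n. w i = 0})"

definition compact_matrix_quantum_group ::
    "('a :: cstar_algebra \<Rightarrow> 'a \<Rightarrow> 'b :: cstar_algebra) \<Rightarrow>
     ('b \<Rightarrow> 'a \<Rightarrow> 'c :: cstar_algebra) \<Rightarrow> ('a \<Rightarrow> 'b \<Rightarrow> 'c) \<Rightarrow> ('a \<Rightarrow> 'b) \<Rightarrow> bool" where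
  "compact_matrix_quantum_group T L R \<Delta> \<longleftrightarrow>
     compact_quantum_group T L R \<Delta> \<and>
     (\<exists>n u. unitary_rep T \<Delta> n u \<and>
        (\<lambda>S. star_subalgebra S \<and> closed S) hull {u i j | i j. i < n \<and> j < n} = UNIV)"


section \<open>The CQG algebra\<close>

text \<open>Sweedler-style equations are stated for presentations \<open>\<Delta> a = \<Sum> x \<otimes> y\<close> by finite lists of
  pairs. Coassociativity and multiplicativity of \<open>\<Delta>\<close> on \<open>A\<close> are inherited from the ambient
  compact quantum group.\<close>

definition hopf_star_subalgebra ::
    "('a :: cstar_algebra \<Rightarrow> 'a \<Rightarrow> 'b :: cstar_algebra) \<Rightarrow> ('a \<Rightarrow> 'b) \<Rightarrow> 'a set \<Rightarrow> bool" where
  "hopf_star_subalgebra T \<Delta> A \<longleftrightarrow>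
     star_subalgebra A \<and> \<Delta> ` A \<subseteq> cspan (elementary_tensors T A A) \<and>
     (\<exists>(\<epsilon> :: 'a \<Rightarrow> complex) (\<kappa> :: 'a \<Rightarrow> 'a).
        (\<forall>a\<in>A. \<forall>b\<in>A. \<epsilon> (a + b) = \<epsilon> a + \<epsilon> b) \<and> (\<forall>c. \<forall>a\<in>A. \<epsilon> (c *\<^sub>C a) = c * \<epsilon> a) \<and>
        (\<forall>a\<in>A. \<forall>b\<in>A. \<epsilon> (a * b) = \<epsilon> a * \<epsilon> b) \<and> \<epsilon> 1 = 1 \<and>
        \<kappa> ` A \<subseteq> A \<and>
        (\<forall>a\<in>A. \<forall>b\<in>A. \<kappa> (a + b) = \<kappa> a + \<kappa> b) \<and> (\<forall>c. \<forall>a\<in>A. \<kappa> (c *\<^sub>C a) = c *\<^sub>C \<kappa> a) \<and>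
        (\<forall>a\<in>A. \<forall>xs. set xs \<subseteq> A \<times> A \<and> \<Delta> a = (\<Sum>(x, y)\<leftarrow>xs. T x y) \<longrightarrow>
           (\<Sum>(x, y)\<leftarrow>xs. \<epsilon> x *\<^sub>C y) = a \<and> (\<Sum>(x, y)\<leftarrow>xs. \<epsilon> y *\<^sub>C x) = a \<and>
           (\<Sum>(x, y)\<leftarrow>xs. \<kappa> x * y) = \<epsilon> a *\<^sub>C 1 \<and> (\<Sum>(x, y)\<leftarrow>xs. x * \<kappa> y) = \<epsilon> a *\<^sub>C 1))"

definition is_cqg_algebra ::
    "('a :: cstar_algebra \<Rightarrow> 'a \<Rightarrow> 'b :: cstar_algebra) \<Rightarrow> ('a \<Rightarrow> 'b) \<Rightarrow> 'a set \<Rightarrow> bool" where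
  "is_cqg_algebra T \<Delta> A \<longleftrightarrow>
     A = cspan {u i j | n u i j. irreducible_unitary_rep T \<Delta> n u \<and> i < n \<and> j < n} \<and>
     closure A = UNIV \<and> hopf_star_subalgebra T \<Delta> A"

text \<open>The characters \<open>\<chi>\<^sub>V\<close>, \<open>V\<close> irreducible. Equivalent representations have the same character, so
  ranging over representatives is ranging over \<open>Irr(G)\<close>.\<close>

definition irreducible_characters ::
    "('a :: cstar_algebra \<Rightarrow> 'a \<Rightarrow> 'b :: cstar_algebra) \<Rightarrow> ('a \<Rightarrow> 'b) \<Rightarrow> 'a set" where
  "irreducible_characters T \<Delta> = {\<Sum>i<n. u i i | n u. irreducible_unitary_rep T \<Delta> n u}"

definition cstar_seminorm_on :: "'a :: cstar_algebra set \<Rightarrow> ('a \<Rightarrow> real) \<Rightarrow> bool" where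
  "cstar_seminorm_on A p \<longleftrightarrow>
     (\<forall>a\<in>A. 0 \<le> p a) \<and>
     (\<forall>a\<in>A. \<forall>b\<in>A. p (a + b) \<le> p a + p b) \<and> (\<forall>c. \<forall>a\<in>A. p (c *\<^sub>C a) = cmod c * p a) \<and>
     (\<forall>a\<in>A. \<forall>b\<in>A. p (a * b) \<le> p a * p b) \<and> (\<forall>a\<in>A. p (star a * a) = (p a)\<^sup>2)"

text \<open>The norm of the full enveloping C*-algebra of \<open>A\<close>, restricted to \<open>A\<close>: the largest
  C*-seminorm. It is finite on a CQG algebra, which is spanned by entries of unitary matrices.\<close>

definition universal_norm :: "'a :: cstar_algebra set \<Rightarrow> 'a \<Rightarrow> ereal" where
  "universal_norm A a = (SUP p\<in>{p. cstar_seminorm_on A p}. ereal (p a))"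


section \<open>Automorphism groups\<close>

text \<open>The last clause of the carrier is \<open>\<Delta> \<circ> \<alpha> = (\<alpha> \<otimes> \<alpha>) \<circ> \<Delta>\<close> on \<open>A\<close>.\<close>

definition aut_group ::
    "('a :: cstar_algebra \<Rightarrow> 'a \<Rightarrow> 'b :: cstar_algebra) \<Rightarrow> ('a \<Rightarrow> 'b) \<Rightarrow> 'a set \<Rightarrow> ('a \<Rightarrow> 'a) monoid"
  where
  "aut_group T \<Delta> A = BijGroup A
     \<lparr>carrier := {\<alpha> \<in> Bij A.
        (\<forall>a\<in>A. \<forall>b\<in>A. \<alpha> (a + b) = \<alpha> a + \<alpha> b) \<and> (\<forall>c. \<forall>a\<in>A. \<alpha> (c *\<^sub>C a) = c *\<^sub>C \<alpha> a) \<and>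
        (\<forall>a\<in>A. \<forall>b\<in>A. \<alpha> (a * b) = \<alpha> a * \<alpha> b) \<and> (\<forall>a\<in>A. \<alpha> (star a) = star (\<alpha> a)) \<and>
        (\<forall>a\<in>A. \<forall>xs. set xs \<subseteq> A \<times> A \<and> \<Delta> a = (\<Sum>(x, y)\<leftarrow>xs. T x y) \<longrightarrow>
           \<Delta> (\<alpha> a) = (\<Sum>(x, y)\<leftarrow>xs. T (\<alpha> x) (\<alpha> y)))}\<rparr>"

definition inner_aut ::
    "('a :: cstar_algebra \<Rightarrow> 'a \<Rightarrow> 'b :: cstar_algebra) \<Rightarrow> ('a \<Rightarrow> 'b) \<Rightarrow> 'a set \<Rightarrow> ('a \<Rightarrow> 'a) set" where
  "inner_aut T \<Delta> A =
     {\<alpha> \<in> carrier (aut_group T \<Delta> A). \<forall>x\<in>irreducible_characters T \<Delta>. \<alpha> x = x}"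

definition out_group ::
    "('a :: cstar_algebra \<Rightarrow> 'a \<Rightarrow> 'b :: cstar_algebra) \<Rightarrow> ('a \<Rightarrow> 'b) \<Rightarrow> 'a set \<Rightarrow>
     ('a \<Rightarrow> 'a) set monoid" where
  "out_group T \<Delta> A = aut_group T \<Delta> A Mod inner_aut T \<Delta> A"

definition identity_neighbourhood ::
    "('a :: cstar_algebra \<Rightarrow> 'a \<Rightarrow> 'b :: cstar_algebra) \<Rightarrow> ('a \<Rightarrow> 'b) \<Rightarrow> 'a set \<Rightarrow>
     'a set \<Rightarrow> real \<Rightarrow> ('a \<Rightarrow> 'a) set" where
  "identity_neighbourhood T \<Delta> A S e =
     {\<alpha> \<in> carrier (aut_group T \<Delta> A). \<forall>a\<in>S. universal_norm A (\<alpha> a - a) < ereal e}"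

text \<open>The group topology: basic neighbourhoods of \<open>\<alpha>\<close> are the translates of those of the
  identity.\<close>

definition aut_topology ::
    "('a :: cstar_algebra \<Rightarrow> 'a \<Rightarrow> 'b :: cstar_algebra) \<Rightarrow> ('a \<Rightarrow> 'b) \<Rightarrow> 'a set \<Rightarrow>
     ('a \<Rightarrow> 'a) topology" where
  "aut_topology T \<Delta> A = topology (\<lambda>U. U \<subseteq> carrier (aut_group T \<Delta> A) \<and>
     (\<forall>\<alpha>\<in>U. \<exists>S e. finite S \<and> S \<subseteq> A \<and> e > 0 \<and>
        \<alpha> <#\<^bsub>aut_group T \<Delta> A\<^esub> identity_neighbourhood T \<Delta> A S e \<subseteq> U))"

definition quotient_topology :: "'a topology \<Rightarrow> ('a \<Rightarrow> 'b) \<Rightarrow> 'b topology" where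
  "quotient_topology X f =
     topology (\<lambda>U. U \<subseteq> f ` topspace X \<and> openin X {x \<in> topspace X. f x \<in> U})"

definition out_topology ::
    "('a :: cstar_algebra \<Rightarrow> 'a \<Rightarrow> 'b :: cstar_algebra) \<Rightarrow> ('a \<Rightarrow> 'b) \<Rightarrow> 'a set \<Rightarrow>
     ('a \<Rightarrow> 'a) set topology" where
  "out_topology T \<Delta> A = quotient_topology (aut_topology T \<Delta> A)
     (\<lambda>\<alpha>. inner_aut T \<Delta> A #>\<^bsub>aut_group T \<Delta> A\<^esub> \<alpha>)"

lemma openin_quotient_topology:
  "openin (quotient_topology X f) U \<longleftrightarrow>
     U \<subseteq> f ` topspace X \<and> openin X {x \<in> topspace X. f x \<in> U}"
proof -
  have "istopology (\<lambda>U. U \<subseteq> f ` topspace X \<and> openin X {x \<in> topspace X. f x \<in> U})"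
    unfolding istopology_def
  proof (intro conjI allI impI; (elim conjE)?)
    fix S T assume "openin X {x \<in> topspace X. f x \<in> S}" "openin X {x \<in> topspace X. f x \<in> T}"
    then have "openin X ({x \<in> topspace X. f x \<in> S} \<inter> {x \<in> topspace X. f x \<in> T})"
      by (rule openin_Int)
    also have "{x \<in> topspace X. f x \<in> S} \<inter> {x \<in> topspace X. f x \<in> T} = {x \<in> topspace X. f x \<in> S \<inter> T}"
      by auto
    finally show "openin X {x \<in> topspace X. f x \<in> S \<inter> T}" .
  next
    fix K assume K: "\<forall>U\<in>K. U \<subseteq> f ` topspace X \<and> openin X {x \<in> topspace X. f x \<in> U}"
    have "openin X (\<Union>U\<in>K. {x \<in> topspace X. f x \<in> U})"
      using K by (intro openin_Union) auto
    also have "(\<Union>U\<in>K. {x \<in> topspace X. f x \<in> U}) = {x \<in> topspace X. f x \<in> \<Union>K}"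
      by auto
    finally show "openin X {x \<in> topspace X. f x \<in> \<Union>K}" .
  qed auto
  then show ?thesis
    by (simp add: quotient_topology_def)
qed

lemma openin_aut_topology:
  "openin (aut_topology T \<Delta> A) U \<longleftrightarrow> U \<subseteq> carrier (aut_group T \<Delta> A) \<and>
     (\<forall>\<alpha>\<in>U. \<exists>S e. finite S \<and> S \<subseteq> A \<and> e > 0 \<and>
        \<alpha> <#\<^bsub>aut_group T \<Delta> A\<^esub> identity_neighbourhood T \<Delta> A S e \<subseteq> U)"
proof -
  let ?G = "aut_group T \<Delta> A" and ?N = "identity_neighbourhood T \<Delta> A"
  define Q where "Q \<alpha> U \<longleftrightarrow>
    (\<exists>S e. finite S \<and> S \<subseteq> A \<and> e > 0 \<and> \<alpha> <#\<^bsub>?G\<^esub> ?N S e \<subseteq> U)" for \<alpha> U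
  have mono: "Q \<alpha> V" if "Q \<alpha> U" "U \<subseteq> V" for \<alpha> U V
    using that unfolding Q_def by (meson order_trans)
  have int: "Q \<alpha> (U \<inter> V)" if QU: "Q \<alpha> U" and QV: "Q \<alpha> V" for \<alpha> U V
  proof -
    obtain S e where S: "finite S" "S \<subseteq> A" "e > 0" "\<alpha> <#\<^bsub>?G\<^esub> ?N S e \<subseteq> U"
      using QU unfolding Q_def by (elim exE conjE)
    obtain S' e' where S': "finite S'" "S' \<subseteq> A" "e' > 0" "\<alpha> <#\<^bsub>?G\<^esub> ?N S' e' \<subseteq> V"
      using QV unfolding Q_def by (elim exE conjE)
    have le: "?N (S \<union> S') (min e e') \<subseteq> ?N S e" "?N (S \<union> S') (min e e') \<subseteq> ?N S' e'"
      unfolding identity_neighbourhood_def by auto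
    have coset_mono: "\<alpha> <#\<^bsub>?G\<^esub> M \<subseteq> \<alpha> <#\<^bsub>?G\<^esub> M'" if "M \<subseteq> M'" for M M'
      using that unfolding l_coset_def by (intro UN_mono) simp_all
    have "\<alpha> <#\<^bsub>?G\<^esub> ?N (S \<union> S') (min e e') \<subseteq> U \<inter> V"
      by (intro Int_greatest order_trans[OF coset_mono[OF le(1)]] 
          order_trans[OF coset_mono[OF le(2)]] S(4) S'(4))
    moreover have "finite (S \<union> S')" "S \<union> S' \<subseteq> A" "min e e' > 0"
      using S(1-3) S'(1-3) by simp_all
    ultimately show ?thesis
      unfolding Q_def by (intro exI conjI)
  qed
  have "istopology (\<lambda>U. U \<subseteq> carrier ?G \<and> (\<forall>\<alpha>\<in>U. Q \<alpha> U))"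
    unfolding istopology_def
  proof (rule conjI; intro allI impI)
    fix U V assume "U \<subseteq> carrier ?G \<and> (\<forall>\<alpha>\<in>U. Q \<alpha> U)" "V \<subseteq> carrier ?G \<and> (\<forall>\<alpha>\<in>V. Q \<alpha> V)"
    then show "U \<inter> V \<subseteq> carrier ?G \<and> (\<forall>\<alpha>\<in>U \<inter> V. Q \<alpha> (U \<inter> V))"
      using int by blast
  next
    fix K assume "\<forall>U\<in>K. U \<subseteq> carrier ?G \<and> (\<forall>\<alpha>\<in>U. Q \<alpha> U)"
    then show "\<Union>K \<subseteq> carrier ?G \<and> (\<forall>\<alpha>\<in>\<Union>K. Q \<alpha> (\<Union>K))"
      by (metis Sup_least UnionE Union_upper mono)
  qed
  then show ?thesis
    by (simp add: aut_topology_def Q_def)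
qed

end

(*
  Let u be the generating representation.  If an automorphism is close to the identity on the entries
  of a unitary representation v, averaging over the Haar state gives an intertwiner of v and its
  image that is close to the identity matrix, hence invertible; so the span of the entries of v is
  preserved and the character of v is fixed.  The entries of u and their adjoints generate A, so an
  automorphism preserving the span of the entries of u acts on A polynomially in its matrix on that
  span, and "all irreducible characters are fixed" is a system of polynomial equations in this matrix.
  By the Hilbert basis theorem finitely many of these equations suffice.  Being close to the identity
  on the entries of u and of finitely many irreducible representations therefore makes an
  automorphism inner, so the inner automorphism group is open.

  The Haar state is obtained from compactness of the state space: minimizing the length of a
  vector (phi(v_ij))_i over all states phi yields a fixed vector of v.
*)
theory Submission
  imports Defs "HOL-Library.Function_Algebras" "Jordan_Normal_Form.Determinant"
begin

section \<open>States on unital C*-algebras\<close>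

text \<open>A character is fixed near the identity only within a radius that depends on its
  representation, and only if the entries of that representation are controlled. A basic
  neighbourhood controls finitely many elements, so infinitely many irreducible characters cannot be
  treated one at a time; this is the obstacle that calls for a noetherian argument. Automorphisms
  are given on \<open>A\<close> only and are never extended to the completion. Estimates use the
  norm of \<open>'a\<close>, which the universal norm dominates, and where a total linear map is
  wanted, a linear projection onto \<open>A\<close> is applied first; its continuity plays no part
  in these arguments. States are the only functionals used. They separate points because the minimal
  tensor norm is itself a supremum over pairs of states, so identities in the algebra can be
  verified state by state.\<close>

lemma star_zero [simp]: "star 0 = (0 :: 'a :: cstar_algebra)"
  using star_scaleC[of 0 "0 :: 'a"] by simp

lemma star_one [simp]: "star 1 = (1 :: 'a :: cstar_algebra)"
  by (metis mult.right_neutral star_mult star_star)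

lemma star_minus: "star (- x) = - star (x :: 'a :: cstar_algebra)"
  by (metis add.right_inverse add_eq_0_iff star_add star_zero)

lemma star_diff: "star (x - y) = star x - star (y :: 'a :: cstar_algebra)"
  by (metis add_uminus_conv_diff star_add star_minus)

lemma star_sum: "star (\<Sum>i\<in>I. f i) = (\<Sum>i\<in>I. star (f i :: 'a :: cstar_algebra))"
  by (induction I rule: infinite_finite_induct) (simp_all add: star_add)

lemma star_scaleR: "star (r *\<^sub>R x) = r *\<^sub>R star (x :: 'a :: cstar_algebra)"
  by (metis complex_cnj_complex_of_real scaleC_of_real star_scaleC)

lemma norm_star [simp]: "norm (star x) = norm (x :: 'a :: cstar_algebra)"
proof -
  have le: "norm y \<le> norm (star y)" for y :: 'a
  proof (cases "y = 0")
    case False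
    have "(norm y)\<^sup>2 \<le> norm (star y) * norm y"
      unfolding cstar_identity[symmetric] by (rule norm_mult_ineq)
    then show ?thesis
      using False by (simp add: power2_eq_square)
  qed simp
  from le[of x] le[of "star x"] show ?thesis
    by (simp add: star_star)
qed

lemma bounded_linear_star: "bounded_linear (star :: 'a :: cstar_algebra \<Rightarrow> 'a)"
  by (rule bounded_linear_intro[where K = 1]) (simp_all add: star_add star_scaleR)

lemma scaleC_scaleR_commute: "c *\<^sub>C r *\<^sub>R x = r *\<^sub>R c *\<^sub>C (x :: 'a :: cstar_algebra)"
  by (metis mult.commute scaleC_of_real scaleC_scaleC)

lemma bounded_linear_scaleC: "bounded_linear (\<lambda>x :: 'a :: cstar_algebra. c *\<^sub>C x)"
  by (rule bounded_linear_intro[where K = "cmod c"])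
    (simp_all add: scaleC_add_right norm_scaleC scaleC_scaleR_commute)

lemmas continuous_on_star [continuous_intros] =
  bounded_linear.continuous_on[OF bounded_linear_star]
lemmas continuous_on_scaleC [continuous_intros] =
  bounded_linear.continuous_on[OF bounded_linear_scaleC]

text \<open>\<open>1 - y\<close> squares to \<open>1 - b\<close> exactly when \<open>y\<close> is a
  fixed point of \<open>f\<close>. On the self-adjoint elements of norm at most
  \<open>r = norm b\<close> the map \<open>f\<close> is a contraction with constant
  \<open>r\<close>, so Banach's fixed point theorem replaces functional calculus.\<close>

lemma sqrt_one_minus:
  fixes b :: "'a :: cstar_algebra"
  assumes b: "norm b < 1" "star b = b"
  shows "\<exists>z. star z = z \<and> z * z = 1 - b"
proof -
  define r where "r = norm b"
  define Y where "Y = {y. star y = y \<and> norm (y :: 'a) \<le> r}"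
  define f where "f y = (1/2) *\<^sub>R (b + y * y)" for y :: 'a
  have "closed Y"
    unfolding Y_def
    by (intro closed_Collect_conj closed_Collect_eq closed_Collect_le continuous_intros)
  then have "complete Y"
    by (simp add: complete_eq_closed)
  moreover have "Y \<noteq> {}"
    using b by (auto simp: Y_def r_def)
  moreover have "f ` Y \<subseteq> Y"
  proof
    fix z assume "z \<in> f ` Y"
    then obtain y where y: "star y = y" "norm y \<le> r" "z = f y"
      by (auto simp: Y_def)
    have "norm (b + y * y) \<le> r + r * r"
      using norm_triangle_ineq[of b "y * y"] norm_mult_ineq[of y y] y(2)
        mult_mono[of "norm y" r "norm y" r] by (simp add: r_def)
    also have "\<dots> \<le> 2 * r"
      using b mult_left_le[of r r] by (simp add: r_def)
    finally have "norm z \<le> r"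
      by (simp add: y f_def)
    moreover have "star z = z"
      by (simp add: y f_def star_scaleR star_add star_mult b)
    ultimately show "z \<in> Y"
      by (simp add: Y_def)
  qed
  moreover have "dist (f x) (f y) \<le> r * dist x y" if "x \<in> Y" "y \<in> Y" for x y
  proof -
    have "f x - f y = (1/2) *\<^sub>R (x * (x - y) + (x - y) * y)"
      by (simp add: f_def algebra_simps)
    then have "norm (f x - f y) = norm (x * (x - y) + (x - y) * y) / 2"
      by simp
    also have "norm (x * (x - y) + (x - y) * y) \<le> norm x * norm (x - y) + norm (x - y) * norm y"
      by (metis norm_mult_ineq norm_triangle_mono)
    also have "\<dots> \<le> r * norm (x - y) + norm (x - y) * r"
      using that by (intro add_mono mult_mono) (auto simp: Y_def r_def)
    finally show ?thesis
      by (simp add: dist_norm algebra_simps)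
  qed
  ultimately have "\<exists>!y. y \<in> Y \<and> f y = y"
    using b Banach_fix[of Y r f] by (auto simp: r_def)
  then obtain y where y: "star y = y" "f y = y"
    by (auto simp: Y_def)
  then have "b + y * y = y + y"
    unfolding f_def by (metis scaleR_half_double scaleR_right_distrib scaleR_left_distrib field_sum_of_halves scaleR_one)
  then have "(1 - y) * (1 - y) = 1 - b"
    by (simp add: algebra_simps)
  then show ?thesis
    using y by (intro exI[of _ "1 - y"]) (simp add: star_diff)
qed

section \<open>Cauchy-Schwarz and boundedness of states\<close>

context
  fixes \<phi> :: "'a :: cstar_algebra \<Rightarrow> complex"
  assumes state: "state \<phi>"
begin

lemma state_add: "\<phi> (x + y) = \<phi> x + \<phi> y"
  and state_scaleC: "\<phi> (c *\<^sub>C x) = c * \<phi> x"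
  and state_nonneg: "\<phi> (star x * x) \<in> \<real>\<^sub>\<ge>\<^sub>0"
  and state_one: "\<phi> 1 = 1"
  using state by (auto simp: state_def)

lemma state_zero: "\<phi> 0 = 0"
  using state_scaleC[of 0 0] by simp

lemma state_minus: "\<phi> (- x) = - \<phi> x"
  using state_scaleC[of "-1" x] by simp

lemma state_diff: "\<phi> (x - y) = \<phi> x - \<phi> y"
  by (metis add_uminus_conv_diff state_add state_minus)

lemma state_sum: "\<phi> (\<Sum>i\<in>I. f i) = (\<Sum>i\<in>I. \<phi> (f i))"
  by (induction I rule: infinite_finite_induct) (simp_all add: state_add state_zero)

lemma state_scaleR: "\<phi> (r *\<^sub>R x) = r *\<^sub>R \<phi> x"
  by (metis scaleC_of_real scaleR_conv_of_real state_scaleC)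

text \<open>Positivity makes the value at
  \<open>star (x + c *\<^sub>C 1) * (x + c *\<^sub>C 1)\<close> real. Taking c = 1 compares the
  imaginary parts of the two sides, and c = \<i> the real parts.\<close>

lemma state_star: "\<phi> (star x) = cnj (\<phi> x)"
proof -
  have expand: "\<phi> (star (x + c *\<^sub>C 1) * (x + c *\<^sub>C 1)) =
      \<phi> (star x * x) + c * \<phi> (star x) + cnj c * \<phi> x + cnj c * c" for c
    by (simp add: star_add star_scaleC distrib_left distrib_right state_add mult_scaleC_left
        mult_scaleC_right state_scaleC state_one scaleC_scaleC)
  have im: "Im (\<phi> (star y * y)) = 0" for y
    using state_nonneg[of y] by (simp add: complex_nonneg_Reals_iff)
  from im[of "x + 1 *\<^sub>C 1"] im[of "x + \<i> *\<^sub>C 1"] im[of x] show ?thesis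
    unfolding expand by (simp add: complex_eq_iff)
qed

lemma state_Cauchy_Schwarz:
  "(cmod (\<phi> (star x * y)))\<^sup>2 \<le> Re (\<phi> (star x * x)) * Re (\<phi> (star y * y))"
proof -
  define a where "a = Re (\<phi> (star x * x))"
  define b where "b = \<phi> (star x * y)"
  define c where "c = Re (\<phi> (star y * y))"
  have a: "\<phi> (star x * x) = of_real a" "0 \<le> a" and c: "\<phi> (star y * y) = of_real c" "0 \<le> c"
    using state_nonneg[of x] state_nonneg[of y]
    by (auto simp: a_def c_def complex_nonneg_Reals_iff complex_eq_iff)
  have b': "\<phi> (star y * x) = cnj b"
    using state_star[of "star x * y"] by (simp add: b_def star_mult star_star)
  have bb: "cnj b * b = of_real ((cmod b)\<^sup>2)"
    by (metis complex_norm_square mult.commute)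
  \<comment> \<open>The factor \<open>cnj b\<close> in \<open>t\<close> makes both cross terms equal
    to \<open>- s * (cmod b)\<^sup>2\<close>, which leaves a real quadratic in
    \<open>s\<close>.\<close>
  have ineq: "0 \<le> a - 2 * s * (cmod b)\<^sup>2 + s\<^sup>2 * (cmod b)\<^sup>2 * c" for s :: real
  proof -
    define t where "t = - of_real s * cnj b"
    have "\<phi> (star (x + t *\<^sub>C y) * (x + t *\<^sub>C y)) = of_real a + t * b + cnj t * cnj b + cnj t * t * of_real c"
      by (simp add: star_add star_scaleC distrib_left distrib_right state_add mult_scaleC_left
        mult_scaleC_right state_scaleC scaleC_scaleC a c b' b_def[symmetric])
    also have "\<dots> = of_real (a - 2 * s * (cmod b)\<^sup>2 + s\<^sup>2 * (cmod b)\<^sup>2 * c)"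
      using arg_cong[OF bb, of "\<lambda>z. z * (of_real c * (of_real s * of_real s) - 2 * of_real s)"]
      by (simp add: t_def power2_eq_square algebra_simps)
    finally show ?thesis
      using state_nonneg[of "x + t *\<^sub>C y"] by (simp add: complex_nonneg_Reals_iff)
  qed
  have "(cmod b)\<^sup>2 \<le> a * c"
  proof (cases "c = 0")
    case False
    then show ?thesis
      using ineq[of "1 / c"] c by (simp add: field_simps power2_eq_square)
  next
    case True
    show ?thesis
    proof (cases "b = 0")
      case False
      \<comment> \<open>For c = 0 the quadratic is linear in \<open>s\<close>, and this
        \<open>s\<close> would give it the negative value \<open>- a - 2\<close>.\<close>
      then have "2 * ((a + 1) / (cmod b)\<^sup>2) * (cmod b)\<^sup>2 = 2 * (a + 1)"
        by simp
      then show ?thesis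
        using ineq[of "(a + 1) / (cmod b)\<^sup>2"] True a by simp
    qed (use a c in simp)
  qed
  then show ?thesis
    by (simp add: a_def b_def c_def)
qed

text \<open>Once \<open>s\<close> exceeds \<open>(norm x)\<^sup>2\<close>, the element
  \<open>1 - (1 / s) *\<^sub>R (star x * x)\<close> is the square of a self-adjoint one, so
  \<open>\<phi>\<close> is nonnegative on it. The epsilon provides the strict inequality.\<close>

lemma state_star_self_le: "Re (\<phi> (star x * x)) \<le> (norm x)\<^sup>2"
proof (rule field_le_epsilon)
  fix e :: real assume e: "e > 0"
  define s where "s = (norm x)\<^sup>2 + e"
  have s: "s > 0" "norm (star x * x) < s"
    using e by (auto simp: s_def cstar_identity add_nonneg_pos)
  define b where "b = (1 / s) *\<^sub>R (star x * x)"
  have "norm b < 1" "star b = b"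
    using s by (simp_all add: b_def star_scaleR star_mult star_star)
  then obtain z where "star z = z" "z * z = 1 - b"
    using sqrt_one_minus by blast
  then have "Re (\<phi> (1 - b)) \<ge> 0"
    using state_nonneg[of z] by (simp add: complex_nonneg_Reals_iff)
  then have "Re (\<phi> (star x * x)) / s \<le> 1"
    by (simp add: state_diff state_one b_def state_scaleR)
  then show "Re (\<phi> (star x * x)) \<le> (norm x)\<^sup>2 + e"
    using s by (simp add: s_def)
qed

lemma state_Cauchy_Schwarz_one: "(cmod (\<phi> x))\<^sup>2 \<le> Re (\<phi> (star x * x))"
  using state_Cauchy_Schwarz[of 1 x] by (simp add: state_one)

lemma state_norm_le: "cmod (\<phi> x) \<le> norm x"
proof -
  have "(cmod (\<phi> x))\<^sup>2 \<le> (norm x)\<^sup>2"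
    using state_Cauchy_Schwarz_one state_star_self_le by (rule order_trans)
  then show ?thesis
    by (rule power2_le_imp_le) simp
qed

lemma bounded_linear_state: "bounded_linear \<phi>"
  by (rule bounded_linear_intro[where K = 1]) (simp_all add: state_add state_scaleR state_norm_le)

lemma state_null_left: "\<phi> (star x * y) = 0" if "\<phi> (star x * x) = 0"
  using state_Cauchy_Schwarz[of x y] that by simp

end

text \<open>Rescaling by \<open>1 / \<phi> (star x * x)\<close> turns \<open>\<phi> (star x * _ * x)\<close> into a state.\<close>

lemma state_compression_eq_0:
  assumes "\<forall>\<phi> :: 'a :: cstar_algebra \<Rightarrow> complex. state \<phi> \<longrightarrow> \<phi> a = 0" and "state \<phi>"
  shows "\<phi> (star x * a * x) = 0"
proof (cases "\<phi> (star x * x) = 0")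
  case True
  then show ?thesis
    using state_null_left[OF assms(2) True, of "a * x"] by (simp add: mult.assoc)
next
  case False
  define c where "c = \<phi> (star x * x)"
  define \<psi> where "\<psi> y = inverse c * \<phi> (star x * y * x)" for y
  have c: "c \<in> \<real>\<^sub>\<ge>\<^sub>0" "c \<noteq> 0"
    using state_nonneg[OF assms(2)] False by (auto simp: c_def)
  have "\<psi> (star y * y) \<in> \<real>\<^sub>\<ge>\<^sub>0" for y
    unfolding \<psi>_def using c state_nonneg[OF assms(2), of "y * x"]
    by (intro nonneg_Reals_mult_I nonneg_Reals_inverse_I) (simp_all add: star_mult mult.assoc)
  then have "state \<psi>"
    using c
    by (auto simp: state_def \<psi>_def distrib_left distrib_right state_add[OF assms(2)]
        state_scaleC[OF assms(2)] mult_scaleC_left mult_scaleC_right algebra_simps c_def)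
  from assms(1) this have "\<psi> a = 0"
    by blast
  then show ?thesis
    using c by (simp add: \<psi>_def)
qed

text \<open>Polarization: the diagonal terms vanish by \<open>state_compression_eq_0\<close>, and c
  = 1 together with c = \<i> then separates the two cross terms.\<close>

lemma state_polarized_eq_0:
  assumes "\<forall>\<phi> :: 'a :: cstar_algebra \<Rightarrow> complex. state \<phi> \<longrightarrow> \<phi> a = 0" and "state \<phi>"
  shows "\<phi> (star x * a * y) = 0"
proof -
  have expand: "\<phi> (star (x + c *\<^sub>C y) * a * (x + c *\<^sub>C y)) =
      \<phi> (star x * a * x) + c * \<phi> (star x * a * y) + cnj c * \<phi> (star y * a * x)
        + cnj c * c * \<phi> (star y * a * y)" for c
    by (simp add: star_add star_scaleC distrib_left distrib_right state_add[OF assms(2)] mult_scaleC_left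
        mult_scaleC_right state_scaleC[OF assms(2)] scaleC_scaleC mult.assoc)
  have 0: "\<phi> (star z * a * z) = 0" for z
    using assms by (rule state_compression_eq_0)
  have "c * \<phi> (star x * a * y) + cnj c * \<phi> (star y * a * x) = 0" for c
    using expand[of c] by (simp add: 0)
  from this[of 1] this[of \<i>] show ?thesis
    by (simp add: complex_eq_iff)
qed

text \<open>The bound makes \<open>f\<close> 1-Lipschitz on \<open>D\<close>, so it extends
  continuously, and each state axiom passes to limits of sequences in \<open>D\<close>. This carries
  product functionals from the algebraic tensor product to its completion.\<close>

lemma state_extension:
  fixes f :: "'a :: cstar_algebra \<Rightarrow> complex"
  assumes D: "star_subalgebra D" "closure D = UNIV"
    and add: "\<And>x y. x \<in> D \<Longrightarrow> y \<in> D \<Longrightarrow> f (x + y) = f x + f y"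
    and scale: "\<And>c x. x \<in> D \<Longrightarrow> f (c *\<^sub>C x) = c * f x"
    and nonneg: "\<And>x. x \<in> D \<Longrightarrow> f (star x * x) \<in> \<real>\<^sub>\<ge>\<^sub>0"
    and one: "f 1 = 1"
    and bound: "\<And>x. x \<in> D \<Longrightarrow> cmod (f x) \<le> norm x"
  shows "\<exists>\<omega>. state \<omega> \<and> (\<forall>x\<in>D. \<omega> x = f x)"
proof -
  have sub: "csubspace D" and D1: "1 \<in> D" and Dm: "\<And>x. x \<in> D \<Longrightarrow> star x * x \<in> D"
    using D by (auto simp: star_subalgebra_def)
  have Ds: "c *\<^sub>C x \<in> D" and Da: "x + y \<in> D" if "x \<in> D" "y \<in> D" for c x y
    using that sub by (auto intro: complex_vector.subspace_scale complex_vector.subspace_add)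
  note Ds' = complex_vector.subspace_scale[OF sub]
  have "dist (f x) (f y) \<le> dist x y" if "x \<in> D" "y \<in> D" for x y
  proof -
    have "f (x + (-1) *\<^sub>C y) = f x - f y"
      using add[OF that(1) Ds[OF that(2,2)], of "-1"] scale[OF that(2), of "-1"] by simp
    then show ?thesis
      using bound[OF Da[OF that(1) Ds[OF that(2,2)]], of "-1"] by (simp add: dist_norm)
  qed
  then have "uniformly_continuous_on D f"
    unfolding uniformly_continuous_on_def by (metis dist_commute le_less_trans)
  then obtain \<omega> where "uniformly_continuous_on (closure D) \<omega>" and ext: "\<And>x. x \<in> D \<Longrightarrow> f x = \<omega> x"
    by (rule uniformly_continuous_on_extension_on_closure) auto
  then have cont: "continuous_on UNIV \<omega>"
    using D uniformly_continuous_imp_continuous by metis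
  have seq: "\<exists>s. (\<forall>n. s n \<in> D) \<and> s \<longlonglongrightarrow> x" for x
    using D(2) closure_sequential[of x D] by auto
  have tend: "(\<lambda>n. \<omega> (s n)) \<longlonglongrightarrow> \<omega> x" if "s \<longlonglongrightarrow> x" for s x
    using continuous_on_tendsto_compose[OF cont that] by simp
  have "\<omega> (x + y) = \<omega> x + \<omega> y" for x y
  proof -
    obtain s where s: "\<And>n. s n \<in> D" "s \<longlonglongrightarrow> x"
      using seq[of x] by blast
    obtain t where t: "\<And>n. t n \<in> D" "t \<longlonglongrightarrow> y"
      using seq[of y] by blast
    have "(\<lambda>n. \<omega> (s n + t n)) \<longlonglongrightarrow> \<omega> (x + y)"
      using s t by (intro tend tendsto_intros)
    moreover have "(\<lambda>n. \<omega> (s n + t n)) = (\<lambda>n. \<omega> (s n) + \<omega> (t n))"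
      by (simp add: s t add Da flip: ext)
    moreover have "(\<lambda>n. \<omega> (s n) + \<omega> (t n)) \<longlonglongrightarrow> \<omega> x + \<omega> y"
      using s t by (intro tend tendsto_intros)
    ultimately show ?thesis
      using LIMSEQ_unique by metis
  qed
  moreover have "\<omega> (c *\<^sub>C x) = c * \<omega> x" for c x
  proof -
    obtain s where s: "\<And>n. s n \<in> D" "s \<longlonglongrightarrow> x"
      using seq[of x] by blast
    have "(\<lambda>n. \<omega> (c *\<^sub>C s n)) \<longlonglongrightarrow> \<omega> (c *\<^sub>C x)"
      using s by (intro tend bounded_linear.tendsto[OF bounded_linear_scaleC])
    moreover have "(\<lambda>n. \<omega> (c *\<^sub>C s n)) = (\<lambda>n. c * \<omega> (s n))"
      by (simp add: s scale Ds' flip: ext)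
    moreover have "(\<lambda>n. c * \<omega> (s n)) \<longlonglongrightarrow> c * \<omega> x"
      using s by (intro tend tendsto_intros)
    ultimately show ?thesis
      using LIMSEQ_unique by metis
  qed
  moreover have "\<omega> (star x * x) \<in> \<real>\<^sub>\<ge>\<^sub>0" for x
  proof -
    obtain s where s: "\<And>n. s n \<in> D" "s \<longlonglongrightarrow> x"
      using seq[of x] by blast
    have "(\<lambda>n. \<omega> (star (s n) * s n)) \<longlonglongrightarrow> \<omega> (star x * x)"
      using s by (intro tend tendsto_intros bounded_linear.tendsto[OF bounded_linear_star])
    moreover have pos: "\<omega> (star (s n) * s n) \<in> \<real>\<^sub>\<ge>\<^sub>0" for n
      using nonneg[OF s(1)] ext[OF Dm[OF s(1)]] by simp
    ultimately show ?thesis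
      using closed_sequentially[OF closed_nonneg_Reals_complex pos] by simp
  qed
  ultimately show ?thesis
    using ext D1 one by (intro exI[of _ \<omega>]) (auto simp: state_def)
qed

lemma state_dense_eq:
  fixes A :: "'a :: cstar_algebra set"
  assumes "state \<phi>" "state \<psi>" "closure A = UNIV" "\<And>x. x \<in> A \<Longrightarrow> \<phi> x = \<psi> x"
  shows "\<phi> = \<psi>"
proof
  fix x
  have "closed {x. \<phi> x = \<psi> x}"
    using bounded_linear_state[OF assms(1)] bounded_linear_state[OF assms(2)]
    by (intro closed_Collect_eq linear_continuous_on)
  then have "closure A \<subseteq> {x. \<phi> x = \<psi> x}"
    using assms(4) by (intro closure_minimal) auto
  then show "\<phi> x = \<psi> x"
    using assms(3) by auto
qed

section \<open>States on minimal tensor products\<close>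

text \<open>The Schur product theorem for two Gram matrices, proved by eliminating the last vector
  \<open>b m\<close>. If it has length zero for \<open>\<psi>\<close>, its row and column vanish;
  otherwise the other vectors are made orthogonal to it.\<close>

lemma tensor_psd:
  fixes \<phi> :: "'a :: cstar_algebra \<Rightarrow> complex" and \<psi> :: "'b :: cstar_algebra \<Rightarrow> complex"
  assumes \<phi>: "state \<phi>" and \<psi>: "state \<psi>"
  shows "(\<Sum>i<m :: nat. \<Sum>j<m. \<phi> (star (a i) * a j) * \<psi> (star (b i) * b j)) \<in> \<real>\<^sub>\<ge>\<^sub>0"
proof (induction m arbitrary: a b)
  case (Suc m)
  note linear = state_add[OF \<phi>] state_add[OF \<psi>] state_diff[OF \<psi>] state_scaleC[OF \<phi>] state_scaleC[OF \<psi>]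
    state_sum[OF \<phi>]
  define c where "c = \<psi> (star (b m) * b m)"
  have split: "(\<Sum>i<Suc m. \<Sum>j<Suc m. \<phi> (star (a i) * a j) * \<psi> (star (b i) * b j)) =
      (\<Sum>i<m. \<Sum>j<m. \<phi> (star (a i) * a j) * \<psi> (star (b i) * b j)) +
      (\<Sum>i<m. \<phi> (star (a i) * a m) * \<psi> (star (b i) * b m)) +
      (\<Sum>j<m. \<phi> (star (a m) * a j) * \<psi> (star (b m) * b j)) + \<phi> (star (a m) * a m) * c"
    by (simp add: sum.distrib c_def algebra_simps)
  have sym: "\<psi> (star (b i) * b m) = cnj (\<psi> (star (b m) * b i))" for i
    using state_star[OF \<psi>, of "star (b m) * b i"] by (simp add: star_mult star_star)
  show ?case
  proof (cases "c = 0")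
    case True
    then have "\<psi> (star (b m) * x) = 0" for x
      using state_null_left[OF \<psi>] by (simp add: c_def)
    then show ?thesis
      using Suc.IH[of a b] by (simp add: split sym True del: sum.lessThan_Suc)
  next
    case False
    have c: "c \<in> \<real>\<^sub>\<ge>\<^sub>0"
      unfolding c_def by (rule state_nonneg[OF \<psi>])
    then have cnj_c: "cnj c = c"
      by (metis Reals_cnj_iff nonneg_Reals_subset_Reals subsetD)
    \<comment> \<open>In tensor notation, the sum of \<open>a i \<otimes> b i\<close> over i \<le> m
      becomes the sum of \<open>a i \<otimes> b' i\<close> over i < m plus
      \<open>a' \<otimes> b m\<close>, with every \<open>b' i\<close> orthogonal to
      \<open>b m\<close>; the two parts therefore contribute separately.\<close>
    define t where "t i = \<psi> (star (b m) * b i) / c" for i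
    define b' where "b' i = b i - t i *\<^sub>C b m" for i
    define a' where "a' = a m + (\<Sum>i<m. t i *\<^sub>C a i)"
    have t: "\<psi> (star (b m) * b i) = t i * c" for i
      using False by (simp add: t_def)
    have b': "\<psi> (star (b i) * b j) = \<psi> (star (b' i) * b' j) + cnj (t i) * t j * c" for i j
    proof -
      have "\<psi> (star (b' i) * b' j) = \<psi> (star (b i) * b j) - t j * \<psi> (star (b i) * b m)
          - cnj (t i) * \<psi> (star (b m) * b j) + cnj (t i) * t j * c"
        by (simp add: b'_def star_diff star_scaleC left_diff_distrib right_diff_distrib
            mult_scaleC_left mult_scaleC_right linear scaleC_scaleC c_def)
      then show ?thesis
        by (simp add: t sym cnj_c algebra_simps)
    qed
    have "\<phi> (star a' * a') = \<phi> (star (a m) * a m) + (\<Sum>j<m. t j * \<phi> (star (a m) * a j)) +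
        (\<Sum>i<m. cnj (t i) * \<phi> (star (a i) * a m)) +
        (\<Sum>i<m. \<Sum>j<m. cnj (t i) * t j * \<phi> (star (a i) * a j))"
      by (simp add: a'_def star_add star_sum star_scaleC distrib_left distrib_right sum_distrib_left
          sum_distrib_right mult_scaleC_left mult_scaleC_right linear sum.distrib scaleC_scaleC
          mult_ac sum_product) (rule sum.swap)
    moreover have "(\<Sum>i<m. \<Sum>j<m. \<phi> (star (a i) * a j) * \<psi> (star (b i) * b j)) =
        (\<Sum>i<m. \<Sum>j<m. \<phi> (star (a i) * a j) * \<psi> (star (b' i) * b' j)) +
        (\<Sum>i<m. \<Sum>j<m. cnj (t i) * t j * \<phi> (star (a i) * a j)) * c"
      by (simp add: b' distrib_left sum.distrib sum_distrib_left mult_ac)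
    ultimately have "(\<Sum>i<Suc m. \<Sum>j<Suc m. \<phi> (star (a i) * a j) * \<psi> (star (b i) * b j)) =
        (\<Sum>i<m. \<Sum>j<m. \<phi> (star (a i) * a j) * \<psi> (star (b' i) * b' j)) + \<phi> (star a' * a') * c"
      unfolding split
      by (simp add: sym t cnj_c distrib_left distrib_right sum_distrib_left sum_distrib_right mult_ac)
    then show ?thesis
      using Suc.IH[of a b'] c state_nonneg[OF \<phi>, of a']
      by (simp add: nonneg_Reals_add_I nonneg_Reals_mult_I)
  qed
qed simp

locale minimal_tensor =
  fixes T :: "'a :: cstar_algebra \<Rightarrow> 'b :: cstar_algebra \<Rightarrow> 'c :: cstar_algebra"
  assumes minimal_tensor: "minimal_tensor_product T"
begin

lemma T_add_left: "T (a + a') b = T a b + T a' b"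
  and T_add_right: "T a (b + b') = T a b + T a b'"
  and T_scaleC_left: "T (c *\<^sub>C a) b = c *\<^sub>C T a b"
  and T_scaleC_right: "T a (c *\<^sub>C b) = c *\<^sub>C T a b"
  and T_mult: "T a b * T a' b' = T (a * a') (b * b')"
  and star_T: "star (T a b) = T (star a) (star b)"
  and T_one: "T 1 1 = 1"
  and T_injective: "\<lbrakk>finite B; \<not> cdependent B; (\<Sum>b\<in>B. T (f b) b) = 0; b \<in> B\<rbrakk> \<Longrightarrow> f b = 0"
  and dense_tensors: "closure (cspan (elementary_tensors T UNIV UNIV)) = UNIV"
  and bdd_spatial_quotients: "x \<in> cspan (elementary_tensors T UNIV UNIV) \<Longrightarrow> bdd_above (spatial_quotients T x)"
  and norm_eq_spatial: "x \<in> cspan (elementary_tensors T UNIV UNIV) \<Longrightarrow> (norm x)\<^sup>2 = Sup (spatial_quotients T x)"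
  using minimal_tensor unfolding minimal_tensor_product_def
  apply -
  subgoal by simp
  subgoal by simp
  subgoal by simp
  subgoal by simp
  subgoal by simp
  subgoal by simp
  subgoal by simp
  subgoal by blast
  subgoal by simp
  subgoal by simp
  subgoal by simp
  done

lemma T_zero_left: "T 0 b = 0"
  using T_scaleC_left[of 0 0 b] by simp

lemma T_zero_right: "T a 0 = 0"
  using T_scaleC_right[of a 0 0] by simp

lemma T_sum_left: "T (\<Sum>i\<in>I. f i) b = (\<Sum>i\<in>I. T (f i) b)"
  by (induction I rule: infinite_finite_induct) (simp_all add: T_add_left T_zero_left)

lemma T_sum_right: "T a (\<Sum>i\<in>I. f i) = (\<Sum>i\<in>I. T a (f i))"
  by (induction I rule: infinite_finite_induct) (simp_all add: T_add_right T_zero_right)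

text \<open>By injectivity of \<open>T\<close> on the algebraic tensor product, every balanced map out of it is
  well defined.\<close>

lemma tensor_sum_eq_0:
  fixes \<beta> :: "'a \<Rightarrow> 'b \<Rightarrow> 'v :: ab_group_add"
  assumes zero: "(\<Sum>i\<in>I. T (a i) (b i)) = 0" and fin: "finite I"
    and add_left: "\<And>x x' y. \<beta> (x + x') y = \<beta> x y + \<beta> x' y"
    and add_right: "\<And>x y y'. \<beta> x (y + y') = \<beta> x y + \<beta> x y'"
    and balanced: "\<And>c x y. \<beta> (c *\<^sub>C x) y = \<beta> x (c *\<^sub>C y)"
  shows "(\<Sum>i\<in>I. \<beta> (a i) (b i)) = 0"
proof -
  have \<beta>0: "\<beta> 0 y = 0" "\<beta> x 0 = 0" for x y
    using add_left[of 0 0 y] add_right[of x 0 0] by simp_all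
  have sum_left: "\<beta> (\<Sum>i\<in>J. f i) y = (\<Sum>i\<in>J. \<beta> (f i) y)" for J :: "'z set" and f y
    by (induction J rule: infinite_finite_induct) (simp_all add: add_left \<beta>0)
  have sum_right: "\<beta> x (\<Sum>i\<in>J. f i) = (\<Sum>i\<in>J. \<beta> x (f i))" for J :: "'z set" and f x
    by (induction J rule: infinite_finite_induct) (simp_all add: add_right \<beta>0)
  obtain B where B: "B \<subseteq> b ` I" "\<not> cdependent B" "b ` I \<subseteq> cspan B"
    using complex_vector.maximal_independent_subset by blast
  have "finite B"
    using B(1) fin finite_subset by blast
  have "\<exists>c. b i = (\<Sum>v\<in>B. c v *\<^sub>C v)" if "i \<in> I" for i
    using B(3) that complex_vector.span_finite[OF \<open>finite B\<close>] by blast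
  then obtain c where c: "\<And>i. i \<in> I \<Longrightarrow> b i = (\<Sum>v\<in>B. c i v *\<^sub>C v)"
    by metis
  define f where "f v = (\<Sum>i\<in>I. c i v *\<^sub>C a i)" for v
  have "(\<Sum>v\<in>B. T (f v) v) = (\<Sum>v\<in>B. \<Sum>i\<in>I. c i v *\<^sub>C T (a i) v)"
    by (simp add: f_def T_sum_left T_scaleC_left)
  also have "\<dots> = (\<Sum>i\<in>I. \<Sum>v\<in>B. c i v *\<^sub>C T (a i) v)"
    by (rule sum.swap)
  also have "\<dots> = (\<Sum>i\<in>I. T (a i) (b i))"
    by (intro sum.cong refl) (simp add: c T_sum_right T_scaleC_right)
  finally have f0: "f v = 0" if "v \<in> B" for v
    using T_injective[OF \<open>finite B\<close> B(2) _ that, of f] zero by simp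
  have "(\<Sum>i\<in>I. \<beta> (a i) (b i)) = (\<Sum>i\<in>I. \<Sum>v\<in>B. \<beta> (c i v *\<^sub>C a i) v)"
    by (intro sum.cong refl) (simp add: c sum_right balanced)
  also have "\<dots> = (\<Sum>v\<in>B. \<Sum>i\<in>I. \<beta> (c i v *\<^sub>C a i) v)"
    by (rule sum.swap)
  also have "\<dots> = (\<Sum>v\<in>B. \<beta> (f v) v)"
    by (simp add: f_def sum_left)
  also have "\<dots> = 0"
    by (simp add: f0 \<beta>0)
  finally show ?thesis .
qed

lemma tensor_list_eq_0:
  fixes \<beta> :: "'a \<Rightarrow> 'b \<Rightarrow> 'v :: ab_group_add"
  assumes zero: "(\<Sum>(a, b)\<leftarrow>xs. T a b) = 0"
    and "\<And>x x' y. \<beta> (x + x') y = \<beta> x y + \<beta> x' y"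
    and "\<And>x y y'. \<beta> x (y + y') = \<beta> x y + \<beta> x y'"
    and "\<And>c x y. \<beta> (c *\<^sub>C x) y = \<beta> x (c *\<^sub>C y)"
  shows "(\<Sum>(a, b)\<leftarrow>xs. \<beta> a b) = 0"
proof -
  have index: "(\<Sum>(a, b)\<leftarrow>xs. g a b) = (\<Sum>i\<in>{0..<length xs}. g (fst (xs ! i)) (snd (xs ! i)))"
    for g :: "'a \<Rightarrow> 'b \<Rightarrow> 'z :: ab_group_add"
    by (simp add: sum_list_sum_nth case_prod_beta)
  show ?thesis
    unfolding index by (rule tensor_sum_eq_0[OF zero[unfolded index] _ assms(2-4)]) simp
qed

lemma tensor_list_eq:
  fixes \<beta> :: "'a \<Rightarrow> 'b \<Rightarrow> 'v :: ab_group_add"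
  assumes eq: "(\<Sum>(a, b)\<leftarrow>xs. T a b) = (\<Sum>(a, b)\<leftarrow>ys. T a b)"
    and add_left: "\<And>x x' y. \<beta> (x + x') y = \<beta> x y + \<beta> x' y"
    and "\<And>x y y'. \<beta> x (y + y') = \<beta> x y + \<beta> x y'"
    and "\<And>c x y. \<beta> (c *\<^sub>C x) y = \<beta> x (c *\<^sub>C y)"
  shows "(\<Sum>(a, b)\<leftarrow>xs. \<beta> a b) = (\<Sum>(a, b)\<leftarrow>ys. \<beta> a b)"
proof -
  define zs where "zs = xs @ map (\<lambda>(a, b). (- a, b)) ys"
  have neg: "(\<Sum>(a, b)\<leftarrow>map (\<lambda>(a, b). (- a, b)) ys. g a b) = - (\<Sum>(a, b)\<leftarrow>ys. g a b)"
    if "\<And>a b. g (- a) b = - g a b" for g :: "'a \<Rightarrow> 'b \<Rightarrow> 'z :: ab_group_add"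
    using that by (induction ys) auto
  have negs: "T (- a) b = - T a b" "\<beta> (- a) b = - \<beta> a b" for a b
    using T_add_left[of a "- a" b] add_left[of a "- a" b] add_left[of 0 0 b]
    by (simp_all add: T_zero_left minus_unique)
  have eqs: "(\<Sum>(a, b)\<leftarrow>zs. T a b) = (\<Sum>(a, b)\<leftarrow>xs. T a b) - (\<Sum>(a, b)\<leftarrow>ys. T a b)"
    "(\<Sum>(a, b)\<leftarrow>zs. \<beta> a b) = (\<Sum>(a, b)\<leftarrow>xs. \<beta> a b) - (\<Sum>(a, b)\<leftarrow>ys. \<beta> a b)"
    unfolding zs_def map_append sum_list_append neg[of T, OF negs(1)] neg[of \<beta>, OF negs(2)] by simp_all
  have "(\<Sum>(a, b)\<leftarrow>zs. \<beta> a b) = 0"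
    by (rule tensor_list_eq_0[OF _ assms(2-4)]) (simp add: eq eqs(1))
  then show ?thesis
    by (simp add: eqs)
qed

lemma span_tensors_list:
  assumes "csubspace A" "z \<in> cspan (elementary_tensors T A B)"
  obtains xs where "set xs \<subseteq> A \<times> B" "z = (\<Sum>(a, b)\<leftarrow>xs. T a b)"
proof -
  have "\<exists>xs. set xs \<subseteq> A \<times> B \<and> z = (\<Sum>(a, b)\<leftarrow>xs. T a b)"
    using assms(2)
  proof (induction rule: complex_vector.span_induct_alt)
    case base
    show ?case
      by (intro exI[of _ "[]"]) simp
  next
    case (step c x y)
    then obtain xs a b where "set xs \<subseteq> A \<times> B" "y = (\<Sum>(a, b)\<leftarrow>xs. T a b)" "a \<in> A" "b \<in> B" "x = T a b"
      by (auto simp: elementary_tensors_def)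
    then show ?case
      using complex_vector.subspace_scale[OF assms(1)]
      by (intro exI[of _ "(c *\<^sub>C a, b) # xs"]) (simp add: T_scaleC_left)
  qed
  then show ?thesis
    using that by blast
qed

lemma star_subalgebra_span_tensors:
  assumes A: "star_subalgebra A" and B: "star_subalgebra B"
  shows "star_subalgebra (cspan (elementary_tensors T A B))" (is "star_subalgebra ?D")
proof -
  have "x * y \<in> ?D" if "x \<in> ?D" "y \<in> ?D" for x y
    using that(1)
  proof (induction rule: complex_vector.span_induct_alt)
    case (step c x x')
    from that(2) have "x * y \<in> ?D"
    proof (induction rule: complex_vector.span_induct_alt)
      case (step d z z')
      obtain a b a' b' where "a \<in> A" "b \<in> B" "x = T a b" "a' \<in> A" "b' \<in> B" "z = T a' b'"
        using \<open>x \<in> elementary_tensors T A B\<close> \<open>z \<in> elementary_tensors T A B\<close>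
        by (auto simp: elementary_tensors_def)
      then have "x * z \<in> elementary_tensors T A B"
        unfolding elementary_tensors_def using A B
        by (intro CollectI exI[of _ "a * a'"] exI[of _ "b * b'"]) (simp add: T_mult star_subalgebra_def)
      with step show ?case
        by (simp add: distrib_left mult_scaleC_right complex_vector.span_add
            complex_vector.span_scale complex_vector.span_base)
    qed (simp add: complex_vector.span_zero)
    with step show ?case
      by (simp add: distrib_right mult_scaleC_left complex_vector.span_add complex_vector.span_scale)
  qed (simp add: complex_vector.span_zero)
  moreover have "star x \<in> ?D" if "x \<in> ?D" for x
    using that
  proof (induction rule: complex_vector.span_induct_alt)
    case (step c x y)
    obtain a b where "a \<in> A" "b \<in> B" "x = T a b"
      using \<open>x \<in> elementary_tensors T A B\<close> by (auto simp: elementary_tensors_def)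
    then have "star x \<in> elementary_tensors T A B"
      unfolding elementary_tensors_def using A B
      by (intro CollectI exI[of _ "star a"] exI[of _ "star b"]) (simp add: star_T star_subalgebra_def)
    with step show ?case
      by (simp add: star_add star_scaleC complex_vector.span_add
            complex_vector.span_scale complex_vector.span_base)
  qed (simp add: complex_vector.span_zero)
  moreover have "1 \<in> ?D"
    using A B by (intro complex_vector.span_base) (force simp: elementary_tensors_def star_subalgebra_def T_one)
  ultimately show ?thesis
    by (simp add: star_subalgebra_def complex_vector.subspace_span)
qed

lemma star_subalgebra_UNIV: "star_subalgebra UNIV"
  by (simp add: star_subalgebra_def complex_vector.subspace_UNIV)

abbreviation "alg_tensors \<equiv> cspan (elementary_tensors T UNIV UNIV)"

lemma T_in_alg_tensors: "T a b \<in> alg_tensors"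
  by (intro complex_vector.span_base) (auto simp: elementary_tensors_def)

text \<open>By \<open>tensor_list_eq\<close> all presentations give the same value, so the one
  picked by \<open>SOME\<close> may be exchanged for any other.\<close>

lemma tensor_functional_list:
  assumes \<phi>: "state \<phi>" and \<psi>: "state \<psi>"
  shows "tensor_functional T \<phi> \<psi> (\<Sum>(a, b)\<leftarrow>xs. T a b) = (\<Sum>(a, b)\<leftarrow>xs. \<phi> a * \<psi> b)"
proof -
  define z where "z = (\<Sum>(a, b)\<leftarrow>xs. T a b)"
  define ys where "ys = (SOME ys. z = (\<Sum>(a, b)\<leftarrow>ys. T a b))"
  have "z = (\<Sum>(a, b)\<leftarrow>ys. T a b)"
    unfolding ys_def by (rule someI) (rule z_def)
  then have "(\<Sum>(a, b)\<leftarrow>ys. T a b) = (\<Sum>(a, b)\<leftarrow>xs. T a b)"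
    by (simp add: z_def)
  then have "(\<Sum>(a, b)\<leftarrow>ys. \<phi> a * \<psi> b) = (\<Sum>(a, b)\<leftarrow>xs. \<phi> a * \<psi> b)"
    by (rule tensor_list_eq[where \<beta> = "\<lambda>a b. \<phi> a * \<psi> b"])
      (simp_all add: state_add[OF \<phi>] state_add[OF \<psi>] state_scaleC[OF \<phi>] state_scaleC[OF \<psi>]
        distrib_left distrib_right)
  then show ?thesis
    by (simp add: tensor_functional_def z_def ys_def)
qed

lemma tensor_functional_sum:
  assumes "state \<phi>" "state \<psi>" "finite I"
  shows "tensor_functional T \<phi> \<psi> (\<Sum>i\<in>I. T (a i) (b i)) = (\<Sum>i\<in>I. \<phi> (a i) * \<psi> (b i))"
proof -
  obtain ks where "set ks = I" "distinct ks"
    using finite_distinct_list[OF assms(3)] by blast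
  then show ?thesis
    using tensor_functional_list[OF assms(1,2), of "map (\<lambda>i. (a i, b i)) ks"]
    by (simp add: o_def sum_list_distinct_conv_sum_set)
qed

lemma algebraic_sum:
  assumes "z \<in> alg_tensors"
  obtains m :: nat and a b where "z = (\<Sum>i<m. T (a i) (b i))"
proof -
  obtain xs where "z = (\<Sum>(a, b)\<leftarrow>xs. T a b)"
    using span_tensors_list[OF complex_vector.subspace_UNIV assms] by blast
  then have "z = (\<Sum>i<length xs. T (fst (xs ! i)) (snd (xs ! i)))"
    by (simp add: sum_list_sum_nth case_prod_beta atLeast0LessThan)
  then show ?thesis
    by (rule that)
qed

context
  fixes \<phi> :: "'a \<Rightarrow> complex" and \<psi> :: "'b \<Rightarrow> complex"
  assumes \<phi>: "state \<phi>" and \<psi>: "state \<psi>"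
begin

lemma tensor_functional_add:
  assumes "x \<in> alg_tensors" "y \<in> alg_tensors"
  shows "tensor_functional T \<phi> \<psi> (x + y) = tensor_functional T \<phi> \<psi> x + tensor_functional T \<phi> \<psi> y"
proof -
  obtain xs ys where "x = (\<Sum>(a, b)\<leftarrow>xs. T a b)" "y = (\<Sum>(a, b)\<leftarrow>ys. T a b)"
    using span_tensors_list[OF complex_vector.subspace_UNIV] assms by metis
  then show ?thesis
    using tensor_functional_list[OF \<phi> \<psi>, of "xs @ ys"] by (simp add: tensor_functional_list[OF \<phi> \<psi>])
qed

lemma tensor_functional_scaleC:
  assumes "x \<in> alg_tensors"
  shows "tensor_functional T \<phi> \<psi> (c *\<^sub>C x) = c * tensor_functional T \<phi> \<psi> x"
proof -
  obtain m :: nat and a b where "x = (\<Sum>i<m. T (a i) (b i))"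
    by (rule algebraic_sum[OF assms])
  then show ?thesis
    using tensor_functional_sum[OF \<phi> \<psi>, of "{..<m}" "\<lambda>i. c *\<^sub>C a i" b]
    by (simp add: tensor_functional_sum[OF \<phi> \<psi>] T_scaleC_left state_scaleC[OF \<phi>]
        complex_vector.scale_sum_right sum_distrib_left mult.assoc)
qed

lemma tensor_functional_one: "tensor_functional T \<phi> \<psi> 1 = 1"
  using tensor_functional_list[OF \<phi> \<psi>, of "[(1, 1)]"]
  by (simp add: T_one state_one[OF \<phi>] state_one[OF \<psi>])

lemma tensor_functional_star:
  assumes "x \<in> alg_tensors"
  shows "tensor_functional T \<phi> \<psi> (star x) = cnj (tensor_functional T \<phi> \<psi> x)"
proof -
  obtain m :: nat and a b where "x = (\<Sum>i<m. T (a i) (b i))"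
    by (rule algebraic_sum[OF assms])
  then show ?thesis
    by (simp add: tensor_functional_sum[OF \<phi> \<psi>] star_sum star_T state_star[OF \<phi>] state_star[OF \<psi>])
qed

lemma tensor_functional_nonneg:
  assumes "x \<in> alg_tensors"
  shows "tensor_functional T \<phi> \<psi> (star x * x) \<in> \<real>\<^sub>\<ge>\<^sub>0"
proof -
  obtain m :: nat and a b where x: "x = (\<Sum>i<m. T (a i) (b i))"
    by (rule algebraic_sum[OF assms])
  have "star x * x = (\<Sum>i<m. \<Sum>j<m. T (star (a i) * a j) (star (b i) * b j))"
    by (simp add: x star_sum star_T sum_product T_mult)
  also have "\<dots> = (\<Sum>p\<in>{..<m} \<times> {..<m}. T (star (a (fst p)) * a (snd p)) (star (b (fst p)) * b (snd p)))"
    by (simp add: sum.cartesian_product case_prod_beta)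
  finally have "tensor_functional T \<phi> \<psi> (star x * x) =
      (\<Sum>i<m. \<Sum>j<m. \<phi> (star (a i) * a j) * \<psi> (star (b i) * b j))"
    by (simp add: tensor_functional_sum[OF \<phi> \<psi>] sum.cartesian_product case_prod_beta)
  then show ?thesis
    using tensor_psd[OF \<phi> \<psi>] by simp
qed

lemma tensor_functional_bound:
  assumes x: "x \<in> alg_tensors"
  shows "cmod (tensor_functional T \<phi> \<psi> x) \<le> norm x"
proof -
  let ?f = "tensor_functional T \<phi> \<psi>"
  have alg: "star_subalgebra alg_tensors"
    by (intro star_subalgebra_span_tensors star_subalgebra_UNIV)
  then have closed: "1 \<in> alg_tensors" "star x \<in> alg_tensors" "star x * x \<in> alg_tensors"
    using x by (auto simp: star_subalgebra_def)
  note [simp] = complex_vector.span_add complex_vector.span_scale tensor_functional_add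
    tensor_functional_scaleC closed x
  \<comment> \<open>With this \<open>t\<close> the square of \<open>x + t *\<^sub>C 1\<close> has
    the variance of \<open>x\<close> as its value; nonnegativity of the variance is the
    Cauchy-Schwarz inequality against 1.\<close>
  define t where "t = - ?f x"
  have "?f (star (x + t *\<^sub>C 1) * (x + t *\<^sub>C 1)) =
      ?f (star x * x) + t * ?f (star x) + cnj t * ?f x + cnj t * t"
    by (simp add: star_add star_scaleC distrib_left distrib_right mult_scaleC_left
        mult_scaleC_right tensor_functional_one scaleC_scaleC)
  also have "\<dots> = ?f (star x * x) - of_real ((cmod (?f x))\<^sup>2)"
    unfolding complex_norm_square by (simp add: t_def tensor_functional_star)
  finally have "(cmod (?f x))\<^sup>2 \<le> Re (?f (star x * x))"
    using tensor_functional_nonneg[of "x + t *\<^sub>C 1"] by (simp add: complex_nonneg_Reals_iff)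
  \<comment> \<open>The vector y = 1 gives a spatial quotient with denominator 1. This is how the
    minimal norm enters the bound.\<close>
  also have "Re (?f (star x * x)) \<in> spatial_quotients T x"
    unfolding spatial_quotients_def using \<phi> \<psi>
    by (intro CollectI exI[of _ \<phi>] exI[of _ \<psi>] exI[of _ 1]) (simp add: tensor_functional_one)
  then have "Re (?f (star x * x)) \<le> (norm x)\<^sup>2"
    using norm_eq_spatial[OF x] bdd_spatial_quotients[OF x] cSup_upper by metis
  finally show ?thesis
    by (rule power2_le_imp_le) simp
qed

lemma tensor_state: "\<exists>\<omega>. state \<omega> \<and> (\<forall>a b. \<omega> (T a b) = \<phi> a * \<psi> b)"
proof -
  have alg: "star_subalgebra alg_tensors"
    by (intro star_subalgebra_span_tensors star_subalgebra_UNIV)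
  have "\<exists>\<omega>. state \<omega> \<and> (\<forall>x\<in>alg_tensors. \<omega> x = tensor_functional T \<phi> \<psi> x)"
    by (rule state_extension[OF alg dense_tensors tensor_functional_add tensor_functional_scaleC
          tensor_functional_nonneg tensor_functional_one tensor_functional_bound])
  then obtain \<omega> where \<omega>: "state \<omega>" "\<And>x. x \<in> alg_tensors \<Longrightarrow> \<omega> x = tensor_functional T \<phi> \<psi> x"
    by blast
  have "\<omega> (T a b) = \<phi> a * \<psi> b" for a b
    using \<omega>(2)[OF T_in_alg_tensors] tensor_functional_list[OF \<phi> \<psi>, of "[(a, b)]"] by simp
  then show ?thesis
    using \<omega>(1) by blast
qed

end

text \<open>The minimal norm of \<open>T a 1\<close> is computed by states, so enough states exist.\<close>

lemma states_separate_zero: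
  assumes "\<And>\<phi> :: 'a \<Rightarrow> complex. state \<phi> \<Longrightarrow> \<phi> a = 0"
  shows "a = 0"
proof (rule ccontr)
  assume "a \<noteq> 0"
  have states_0: "\<forall>\<phi> :: 'a \<Rightarrow> complex. state \<phi> \<longrightarrow> \<phi> a = 0"
    using assms by blast
  define z where "z = T a 1"
  have "\<not> cdependent {1 :: 'b}"
    by simp
  then have "z \<noteq> 0"
    using T_injective[of "{1}" "\<lambda>_. a" 1] \<open>a \<noteq> 0\<close> by (auto simp: z_def)
  have z: "z \<in> alg_tensors" and one: "1 \<in> alg_tensors"
    using T_in_alg_tensors[of a 1] T_in_alg_tensors[of 1 1] by (simp_all add: z_def T_one)
  have "tensor_functional T \<phi> \<psi> (star y * star z * z * y) = 0"
    if st: "state \<phi>" "state \<psi>" and y: "y \<in> alg_tensors" for \<phi> \<psi> y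
  proof -
    obtain m :: nat and p q where y: "y = (\<Sum>i<m. T (p i) (q i))"
      by (rule algebraic_sum[OF y])
    have "star y * star z * z * y =
        (\<Sum>i<m. \<Sum>j<m. T (star (p i) * star a * a * p j) (star (q i) * q j))"
      by (simp add: y z_def star_sum star_T sum_product T_mult sum_distrib_left sum_distrib_right mult.assoc)
        (rule sum.swap)
    also have "\<dots> = (\<Sum>r\<in>{..<m} \<times> {..<m}.
        T (star (p (fst r)) * star a * a * p (snd r)) (star (q (fst r)) * q (snd r)))"
      by (simp add: sum.cartesian_product case_prod_beta)
    also have "tensor_functional T \<phi> \<psi> \<dots> = (\<Sum>r\<in>{..<m} \<times> {..<m}.
        \<phi> (star (p (fst r)) * star a * a * p (snd r)) * \<psi> (star (q (fst r)) * q (snd r)))"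
      by (simp add: tensor_functional_sum[OF st])
    also have "\<dots> = 0"
      using state_polarized_eq_0[OF states_0 st(1), where x = "a * p i" and y = "p j" for i j]
      by (intro sum.neutral) (simp add: star_mult mult.assoc)
    finally show ?thesis .
  qed
  then have "spatial_quotients T z \<subseteq> {0}"
    by (auto simp: spatial_quotients_def)
  \<comment> \<open>Whether the set of quotients is empty does not depend on its second argument. If
    it were empty, 1 and 0 would have the same squared norm, namely the unspecified value
    \<open>Sup {}\<close>.\<close>
  moreover have "spatial_quotients T z \<noteq> {}"
  proof
    assume "spatial_quotients T z = {}"
    then have "spatial_quotients T x = {}" for x
      by (auto simp: spatial_quotients_def)
    then show False
      using norm_eq_spatial[OF one] norm_eq_spatial[OF complex_vector.span_zero] by simp
  qed
  ultimately have "spatial_quotients T z = {0}"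
    by blast
  then show False
    using norm_eq_spatial[OF z] \<open>z \<noteq> 0\<close> by simp
qed

lemma states_separate:
  assumes "\<And>\<phi> :: 'a \<Rightarrow> complex. state \<phi> \<Longrightarrow> \<phi> x = \<phi> y"
  shows "x = y"
  using states_separate_zero[of "x - y"] assms state_diff by fastforce

end

section \<open>The Haar state\<close>

lemma state_midpoint:
  fixes \<phi> \<psi> :: "'a :: cstar_algebra \<Rightarrow> complex"
  assumes "state \<phi>" "state \<psi>"
  shows "state (\<lambda>x. (\<phi> x + \<psi> x) / 2)"
  using assms by (auto simp: state_def complex_nonneg_Reals_iff field_simps)

text \<open>Banach-Alaoglu for pointwise convergence: \<open>state_norm_le\<close> puts the states
  into a product of closed discs, which is compact by Tychonoff, and each state axiom is a closed
  condition on finitely many coordinates.\<close>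

lemma compact_states: "compact {\<phi> :: 'a :: cstar_algebra \<Rightarrow> complex. state \<phi>}"
proof -
  define P :: "('a \<Rightarrow> complex) set" where "P = (\<Pi>\<^sub>E a\<in>UNIV. cball 0 (norm a))"
  have "compactin (product_topology (\<lambda>_ :: 'a. euclidean) UNIV) P"
    unfolding P_def by (subst compactin_PiE) (auto simp: compactin_euclidean_iff)
  then have "compact P"
    by (simp add: euclidean_product_topology compactin_euclidean_iff)
  moreover have "closed {\<phi> :: 'a \<Rightarrow> complex. \<phi> a \<in> \<real>\<^sub>\<ge>\<^sub>0}" for a
    using closed_vimage[OF closed_nonneg_Reals_complex continuous_on_product_coordinates[of a]]
    by (simp add: vimage_def)
  then have "closed {\<phi> :: 'a \<Rightarrow> complex. state \<phi>}"
    unfolding state_def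
    by (intro closed_Collect_conj closed_Collect_all closed_Collect_eq continuous_intros
        continuous_on_product_coordinates)
  ultimately have "compact (P \<inter> {\<phi>. state \<phi>})"
    by (rule compact_Int_closed)
  moreover have "{\<phi>. state \<phi>} \<subseteq> P"
    by (auto simp: P_def state_norm_le)
  ultimately show ?thesis
    by (simp add: Int_absorb1)
qed

text \<open>Without any state, \<open>states_separate_zero\<close> would apply vacuously to
  1.\<close>

lemma (in minimal_tensor) state_exists: "\<exists>\<phi> :: 'a \<Rightarrow> complex. state \<phi>"
  using states_separate_zero[of 1] by force

text \<open>Orthonormality of the columns makes \<open>u\<close> isometric on
  \<complex>\<open>\<^sup>n\<close>. Applying a state yields numerical identities: for arbitrary
  states they give contractivity, for the Haar state a way to recognise the zero vector.\<close>

lemma unitary_rep_isometric: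
  assumes u: "unitary_rep T \<Delta> n u"
  shows "(\<Sum>i<n. star (\<Sum>k<n. \<eta> k *\<^sub>C u i k) * (\<Sum>k<n. \<eta> k *\<^sub>C u i k)) =
    of_real (\<Sum>k<n. (cmod (\<eta> k))\<^sup>2) *\<^sub>C 1"
proof -
  have "(\<Sum>i<n. star (\<Sum>k<n. \<eta> k *\<^sub>C u i k) * (\<Sum>k<n. \<eta> k *\<^sub>C u i k)) =
      (\<Sum>i<n. \<Sum>k<n. \<Sum>l<n. (cnj (\<eta> k) * \<eta> l) *\<^sub>C (star (u i k) * u i l))"
    by (simp add: star_sum star_scaleC sum_product mult_scaleC_left mult_scaleC_right scaleC_scaleC mult_ac)
  also have "\<dots> = (\<Sum>k<n. \<Sum>l<n. \<Sum>i<n. (cnj (\<eta> k) * \<eta> l) *\<^sub>C (star (u i k) * u i l))"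
    by (subst sum.swap) (intro sum.cong refl sum.swap)
  also have "\<dots> = (\<Sum>k<n. \<Sum>l<n. (cnj (\<eta> k) * \<eta> l) *\<^sub>C (if k = l then 1 else 0))"
    using u by (intro sum.cong refl)
      (simp add: unitary_rep_def flip: complex_vector.scale_sum_right)
  also have "\<dots> = (\<Sum>k<n. of_real ((cmod (\<eta> k))\<^sup>2) *\<^sub>C 1)"
    by (intro sum.cong refl)
      (simp add: if_distrib[of "\<lambda>x. _ *\<^sub>C x"] complex_norm_square mult.commute cong: if_cong del: of_real_power)
  finally show ?thesis
    by (simp add: complex_vector.scale_sum_left)
qed

text \<open>In each coordinate \<open>state_Cauchy_Schwarz_one\<close> bounds the left side, and the
  bounds add up to the isometry identity.\<close>

lemma unitary_rep_contractive:
  assumes u: "unitary_rep T \<Delta> n u" and \<psi>: "state \<psi>"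
  shows "(\<Sum>i<n. (cmod (\<Sum>k<n. \<psi> (u i k) * \<eta> k))\<^sup>2) \<le> (\<Sum>k<n. (cmod (\<eta> k))\<^sup>2)"
proof -
  define y where "y i = (\<Sum>k<n. \<eta> k *\<^sub>C u i k)" for i
  have "(\<Sum>i<n. \<psi> (star (y i) * y i)) = of_real (\<Sum>k<n. (cmod (\<eta> k))\<^sup>2)"
    using arg_cong[OF unitary_rep_isometric[OF u, of \<eta>], of \<psi>]
    by (simp add: y_def state_sum[OF \<psi>] state_scaleC[OF \<psi>] state_one[OF \<psi>])
  then have eq: "(\<Sum>i<n. Re (\<psi> (star (y i) * y i))) = (\<Sum>k<n. (cmod (\<eta> k))\<^sup>2)"
    by (metis Re_complex_of_real Re_sum)
  have "(\<Sum>k<n. \<psi> (u i k) * \<eta> k) = \<psi> (y i)" for i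
    by (simp add: y_def state_sum[OF \<psi>] state_scaleC[OF \<psi>] mult.commute)
  then show ?thesis
    unfolding eq[symmetric] by (intro sum_mono) (simp add: state_Cauchy_Schwarz_one[OF \<psi>])
qed

text \<open>This says that \<open>u\<close> contains the trivial representation. For irreducible
  \<open>u\<close> the dichotomy decides the Haar state: Kronecker delta on the entries if it holds,
  zero otherwise.\<close>

definition has_fixed_vector :: "nat \<Rightarrow> (nat \<Rightarrow> nat \<Rightarrow> 'a :: cstar_algebra) \<Rightarrow> bool" where
  "has_fixed_vector n u \<longleftrightarrow>
     (\<exists>\<eta>. (\<exists>i<n. \<eta> i \<noteq> 0) \<and> (\<forall>i<n. (\<Sum>k<n. \<eta> k *\<^sub>C u i k) = \<eta> i *\<^sub>C 1))"

text \<open>The line through a fixed vector is invariant, hence the whole space. So every basis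
  vector is fixed, and the columns of \<open>u\<close> can be read off.\<close>

lemma irreducible_fixed_vector:
  assumes irr: "irreducible_unitary_rep T \<Delta> n u" and fixed: "has_fixed_vector n u" and ij: "i < n" "j < n"
  shows "u i j = (if i = j then 1 else 0)"
proof -
  obtain \<eta>' where \<eta>': "\<exists>i<n. \<eta>' i \<noteq> 0" "\<And>i. i < n \<Longrightarrow> (\<Sum>k<n. \<eta>' k *\<^sub>C u i k) = \<eta>' i *\<^sub>C 1"
    using fixed by (auto simp: has_fixed_vector_def)
  \<comment> \<open>Members of an invariant subspace vanish from index \<open>n\<close> on, so the
    fixed vector is cut off there.\<close>
  define \<eta> where "\<eta> i = (if i < n then \<eta>' i else 0)" for i
  have \<eta>: "(\<Sum>k<n. \<eta> k *\<^sub>C u i k) = \<eta> i *\<^sub>C 1" if "i < n" for i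
    using \<eta>'(2)[OF that] that by (simp add: \<eta>_def)
  define W where "W = range (\<lambda>c i. c * \<eta> i)"
  have orbit: "(\<Sum>k<n. (c * \<eta> k) *\<^sub>C u i k) = (c * \<eta> i) *\<^sub>C 1" if "i < n" for c i
    using arg_cong[OF \<eta>[OF that], of "\<lambda>x. c *\<^sub>C x"]
    by (simp add: complex_vector.scale_sum_right scaleC_scaleC)
  have "invariant_subspace n u W"
    unfolding invariant_subspace_def
  proof (intro conjI ballI allI)
    show "W \<subseteq> {w. \<forall>i\<ge>n. w i = 0}"
      by (auto simp: W_def \<eta>_def)
    show "(\<lambda>_. 0) \<in> W"
      unfolding W_def by (rule image_eqI[of _ _ 0]) auto
    show "(\<lambda>i. v i + w i) \<in> W" if vw: "v \<in> W" "w \<in> W" for v w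
    proof -
      obtain c d where "v = (\<lambda>i. c * \<eta> i)" "w = (\<lambda>i. d * \<eta> i)"
        using vw by (auto simp: W_def)
      then show ?thesis
        unfolding W_def by (intro image_eqI[of _ _ "c + d"]) (auto simp: algebra_simps)
    qed
    show "(\<lambda>i. c * w i) \<in> W" if w: "w \<in> W" for c w
    proof -
      obtain d where "w = (\<lambda>i. d * \<eta> i)"
        using w by (auto simp: W_def)
      then show ?thesis
        unfolding W_def by (intro image_eqI[of _ _ "c * d"]) (auto simp: algebra_simps)
    qed
    show "\<exists>(m :: nat) v a. (\<forall>r<m. v r \<in> W) \<and> (\<forall>i<n. (\<Sum>j<n. w j *\<^sub>C u i j) = (\<Sum>r<m. v r i *\<^sub>C a r))"
      if "w \<in> W" for w
      using that orbit by (intro exI[of _ 1] exI[of _ "\<lambda>_. w"] exI[of _ "\<lambda>_. 1"]) (auto simp: W_def)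
  qed
  moreover have "W \<noteq> {\<lambda>_. 0}"
  proof
    assume "W = {\<lambda>_. 0}"
    then have "(\<lambda>i. 1 * \<eta> i) = (\<lambda>_. 0)"
      unfolding W_def by blast
    then show False
      using \<eta>'(1) by (auto simp: \<eta>_def fun_eq_iff split: if_splits)
  qed
  ultimately have W: "W = {w. \<forall>i\<ge>n. w i = 0}"
    using irr by (auto simp: irreducible_unitary_rep_def)
  have "(\<lambda>k. if k = j then 1 else 0) \<in> W"
    unfolding W using ij by auto
  then obtain c where c': "(\<lambda>k. if k = j then 1 else 0) = (\<lambda>k. c * \<eta> k)"
    unfolding W_def by blast
  have c: "(if k = j then 1 else 0) = c * \<eta> k" for k
    by (rule fun_cong[OF c'])
  have "u i j = (\<Sum>k<n. (if k = j then 1 else 0) *\<^sub>C u i k)"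
    using ij by (simp add: if_distrib[of "\<lambda>c. c *\<^sub>C _"] scaleC_one cong: if_cong)
  also have "\<dots> = (if i = j then 1 else 0) *\<^sub>C 1"
    unfolding c using orbit ij by simp
  finally show ?thesis
    by (simp add: scaleC_one)
qed

locale cqg = minimal_tensor T
  for T :: "'a :: cstar_algebra \<Rightarrow> 'a \<Rightarrow> 'b :: cstar_algebra" +
  fixes \<Delta> :: "'a \<Rightarrow> 'b"
  assumes star_hom: "star_hom \<Delta>"
begin

lemma Delta_add: "\<Delta> (x + y) = \<Delta> x + \<Delta> y"
  and Delta_scaleC: "\<Delta> (c *\<^sub>C x) = c *\<^sub>C \<Delta> x"
  and Delta_mult: "\<Delta> (x * y) = \<Delta> x * \<Delta> y"
  and Delta_star: "\<Delta> (star x) = star (\<Delta> x)"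
  and Delta_one: "\<Delta> 1 = 1"
  using star_hom by (simp_all add: star_hom_def)

text \<open>\<open>\<tau> \<circ> \<Delta>\<close> is the convolution product of \<open>\<phi>\<close> and \<open>\<psi>\<close>.\<close>

lemma convolution_state:
  assumes "state \<phi>" "state \<psi>"
  obtains \<tau> where "state \<tau>" "state (\<lambda>x. \<tau> (\<Delta> x))" "\<And>a b. \<tau> (T a b) = \<phi> a * \<psi> b"
proof -
  obtain \<tau> where \<tau>: "state \<tau>" "\<And>a b. \<tau> (T a b) = \<phi> a * \<psi> b"
    using tensor_state[OF assms] by blast
  have "state (\<lambda>x. \<tau> (\<Delta> x))"
    using state_nonneg[OF \<tau>(1)]
    by (auto simp: state_def Delta_add Delta_scaleC Delta_mult Delta_star Delta_one
        state_add[OF \<tau>(1)] state_scaleC[OF \<tau>(1)] state_one[OF \<tau>(1)])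
  then show ?thesis
    using \<tau> that by blast
qed

text \<open>All states agree on the entries of an irreducible representation with a fixed vector.
  Hence vanishing on this set prescribes a state on the entries of all irreducible
  representations.\<close>

definition nontrivial_entries :: "'a set" where
  "nontrivial_entries =
     {u i j | n u i j. irreducible_unitary_rep T \<Delta> n u \<and> \<not> has_fixed_vector n u \<and> i < n \<and> j < n}"

text \<open>The state minimizing the squared length of the chosen matrix columns sends each column to a
  vector fixed by all states under convolution: otherwise its midpoint with a convolution
  would be shorter, by the parallelogram law.\<close>

lemma state_vanishing_on_finite:
  assumes F: "finite F" "F \<subseteq> nontrivial_entries"
  shows "\<exists>\<phi>. state \<phi> \<and> (\<forall>x\<in>F. \<phi> x = 0)"
proof -
  have "\<forall>x\<in>F. \<exists>n u i j. x = u i j \<and> irreducible_unitary_rep T \<Delta> n u \<and> \<not> has_fixed_vector n u \<and> i < n \<and> j < n"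
    using F(2) unfolding nontrivial_entries_def by blast
  then obtain n u i j where F': "\<And>x. x \<in> F \<Longrightarrow> x = u x (i x) (j x) \<and>
      irreducible_unitary_rep T \<Delta> (n x) (u x) \<and> \<not> has_fixed_vector (n x) (u x) \<and> i x < n x \<and> j x < n x"
    by metis
  \<comment> \<open>Whole columns are measured, although only one entry of each is wanted, because
    convolution mixes the entries of a column.\<close>
  define N where "N \<phi> = (\<Sum>x\<in>F. \<Sum>l<n x. (cmod (\<phi> (u x l (j x))))\<^sup>2)" for \<phi> :: "'a \<Rightarrow> complex"
  have "continuous_on {\<phi>. state \<phi>} N"
    unfolding N_def
    by (intro continuous_intros continuous_on_subset[OF continuous_on_product_coordinates] subset_UNIV)
  then obtain \<phi> where \<phi>: "state \<phi>" and min: "\<And>\<psi>. state \<psi> \<Longrightarrow> N \<phi> \<le> N \<psi>"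
    using continuous_attains_inf[OF compact_states] state_exists by (metis empty_iff mem_Collect_eq)
  have fixed: "\<psi> (\<Sum>k<n x. \<phi> (u x k (j x)) *\<^sub>C u x l k) = \<psi> (\<phi> (u x l (j x)) *\<^sub>C 1)"
    if \<psi>: "state \<psi>" and x: "x \<in> F" "l < n x" for \<psi> x l
  proof -
    obtain \<tau> where \<tau>: "state \<tau>" "state (\<lambda>x. \<tau> (\<Delta> x))" "\<And>a b. \<tau> (T a b) = \<psi> a * \<phi> b"
      using convolution_state[OF \<psi> \<phi>] by blast
    define \<omega> where "\<omega> x = \<tau> (\<Delta> x)" for x
    have \<omega>: "state \<omega>"
      unfolding \<omega>_def by (rule \<tau>(2))
    have conv: "\<omega> (u x l (j x)) = (\<Sum>k<n x. \<psi> (u x l k) * \<phi> (u x k (j x)))" if "x \<in> F" "l < n x" for x l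
      using F'[OF that(1)] that(2) unfolding \<omega>_def
      by (simp add: irreducible_unitary_rep_def unitary_rep_def state_sum[OF \<tau>(1)] \<tau>(3))
    have "(\<Sum>l<n x. (cmod (\<omega> (u x l (j x))))\<^sup>2) \<le> (\<Sum>l<n x. (cmod (\<phi> (u x l (j x))))\<^sup>2)" if "x \<in> F" for x
      using unitary_rep_contractive[OF _ \<psi>, of T \<Delta> "n x" "u x" "\<lambda>k. \<phi> (u x k (j x))"] F'[OF that]
      by (simp add: conv[OF that] irreducible_unitary_rep_def)
    then have le: "N \<omega> \<le> N \<phi>"
      unfolding N_def by (rule sum_mono)
    define D where "D = (\<Sum>x\<in>F. \<Sum>l<n x. (cmod (\<phi> (u x l (j x)) - \<omega> (u x l (j x))))\<^sup>2)"
    have par: "(cmod ((p + q) / 2))\<^sup>2 = ((cmod p)\<^sup>2 + (cmod q)\<^sup>2) / 2 - (cmod (p - q))\<^sup>2 / 4" for p q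
      by (simp add: norm_divide power_divide cmod_power2) (simp add: power2_eq_square field_simps)
    have "N (\<lambda>x. (\<phi> x + \<omega> x) / 2) = (N \<phi> + N \<omega>) / 2 - D / 4"
      unfolding N_def D_def par by (simp add: sum.distrib sum_subtractf sum_divide_distrib add_divide_distrib)
    then have "N \<phi> \<le> (N \<phi> + N \<omega>) / 2 - D / 4"
      using min[OF state_midpoint[OF \<phi> \<omega>]] by metis
    then have "D \<le> 0"
      using le by (simp add: field_simps)
    moreover have "D \<ge> 0"
      unfolding D_def by (intro sum_nonneg) simp
    ultimately have "D = 0"
      by (rule order_antisym)
    then have "\<phi> (u x l (j x)) = \<omega> (u x l (j x))"
      using F(1) x by (auto simp: D_def sum_nonneg_eq_0_iff sum_nonneg)
    then show ?thesis
      using conv[OF x] by (simp add: state_sum[OF \<psi>] state_scaleC[OF \<psi>] state_one[OF \<psi>] mult.commute)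
  qed
  have "\<phi> x = 0" if x: "x \<in> F" for x
  proof (rule ccontr)
    assume "\<phi> x \<noteq> 0"
    then have "\<phi> (u x (i x) (j x)) \<noteq> 0"
      using F'[OF x] by metis
    moreover have "(\<Sum>k<n x. \<phi> (u x k (j x)) *\<^sub>C u x l k) = \<phi> (u x l (j x)) *\<^sub>C 1" if "l < n x" for l
      using fixed[OF _ x that] by (rule states_separate)
    ultimately have "has_fixed_vector (n x) (u x)"
      unfolding has_fixed_vector_def
      using F'[OF x] by (intro exI[of _ "\<lambda>l. \<phi> (u x l (j x))"]) blast
    then show False
      using F'[OF x] by blast
  qed
  then show ?thesis
    using \<phi> by blast
qed

definition haar :: "'a \<Rightarrow> complex" where
  "haar = (SOME h. state h \<and> (\<forall>x\<in>nontrivial_entries. h x = 0))"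

text \<open>The conditions \<open>\<phi> x = 0\<close> are closed on the compact state space, and
  finitely many of them are satisfiable together by \<open>state_vanishing_on_finite\<close>; the
  finite intersection property does the rest.\<close>

lemma state_haar: "state haar"
  and haar_nontrivial: "x \<in> nontrivial_entries \<Longrightarrow> haar x = 0"
proof -
  have "{\<phi>. state \<phi>} \<inter> (\<Inter>x\<in>nontrivial_entries. {\<phi>. \<phi> x = 0}) \<noteq> {}"
  proof (rule compact_imp_fip_image[OF compact_states])
    show "closed {\<phi> :: 'a \<Rightarrow> complex. \<phi> x = 0}" for x
      by (intro closed_Collect_eq continuous_intros continuous_on_product_coordinates)
    show "{\<phi>. state \<phi>} \<inter> (\<Inter>x\<in>F. {\<phi>. \<phi> x = 0}) \<noteq> {}"
      if "finite F" "F \<subseteq> nontrivial_entries" for F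
      using state_vanishing_on_finite[OF that] by auto
  qed
  then have "\<exists>h. state h \<and> (\<forall>x\<in>nontrivial_entries. h x = 0)"
    by auto
  from someI_ex[OF this] show "state haar" "x \<in> nontrivial_entries \<Longrightarrow> haar x = 0"
    by (auto simp: haar_def)
qed

end

section \<open>Invariance of the Haar state and intertwiners by averaging\<close>

locale cqg_algebra = cqg T \<Delta>
  for T :: "'a :: cstar_algebra \<Rightarrow> 'a \<Rightarrow> 'b :: cstar_algebra" and \<Delta> :: "'a \<Rightarrow> 'b" +
  fixes A :: "'a set"
  assumes is_cqg_algebra: "is_cqg_algebra T \<Delta> A"
begin

lemma A_eq: "A = cspan {u i j | n u i j. irreducible_unitary_rep T \<Delta> n u \<and> i < n \<and> j < n}"
  and dense_A: "closure A = UNIV"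
  and star_subalgebra_A: "star_subalgebra A"
  and Delta_A: "a \<in> A \<Longrightarrow> \<Delta> a \<in> cspan (elementary_tensors T A A)"
  using is_cqg_algebra unfolding is_cqg_algebra_def hopf_star_subalgebra_def by auto

text \<open>Both sides are states, so it suffices to compare them on entries of irreducible
  representations. There either every factor \<open>haar (u i k)\<close> is zero, or
  \<open>u\<close> is the identity matrix; density of \<open>A\<close> concludes.\<close>

lemma haar_convolution:
  assumes \<psi>: "state \<psi>" and \<tau>: "state \<tau>" "state (\<lambda>x. \<tau> (\<Delta> x))" "\<And>a b. \<tau> (T a b) = haar a * \<psi> b"
  shows "\<tau> (\<Delta> a) = haar a"
proof -
  have gen: "\<tau> (\<Delta> (u i j)) = haar (u i j)"
    if irr: "irreducible_unitary_rep T \<Delta> n u" and ij: "i < n" "j < n" for n u i j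
  proof -
    have eq: "\<tau> (\<Delta> (u i j)) = (\<Sum>k<n. haar (u i k) * \<psi> (u k j))"
      using irr ij by (simp add: irreducible_unitary_rep_def unitary_rep_def state_sum[OF \<tau>(1)] \<tau>(3))
    show ?thesis
    proof (cases "has_fixed_vector n u")
      case True
      have "(\<Sum>k<n. haar (u i k) * \<psi> (u k j)) = (\<Sum>k<n. if k = j then haar (u i j) else 0)"
        using irreducible_fixed_vector[OF irr True] ij
        by (intro sum.cong refl) (auto simp: state_one[OF \<psi>] state_zero[OF \<psi>])
      then show ?thesis
        using ij by (simp add: eq)
    next
      case False
      then have "u i k \<in> nontrivial_entries" if "k < n" for k
        using irr ij that unfolding nontrivial_entries_def by blast
      then show ?thesis
        using ij by (simp add: eq haar_nontrivial)
    qed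
  qed
  have "\<tau> (\<Delta> x) = haar x" if "x \<in> A" for x
    using that unfolding A_eq
  proof (induction rule: complex_vector.span_induct_alt)
    case base
    show ?case
      by (simp add: state_zero[OF \<tau>(2)] state_zero[OF state_haar])
  next
    case (step c x y)
    then have "\<tau> (\<Delta> x) = haar x"
      using gen by blast
    with step show ?case
      by (simp add: state_add[OF \<tau>(2)] state_add[OF state_haar] state_scaleC[OF \<tau>(2)] state_scaleC[OF state_haar])
  qed
  then have "(\<lambda>x. \<tau> (\<Delta> x)) = haar"
    by (rule state_dense_eq[OF \<tau>(2) state_haar dense_A])
  then show ?thesis
    by (rule fun_cong)
qed

text \<open>Invariance is stated for a finite presentation of \<open>\<Delta> a\<close>, which
  avoids a slice map on the completed tensor product. Applying an arbitrary state \<psi> reduces it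
  to \<open>haar_convolution\<close>.\<close>

lemma haar_invariant:
  assumes "\<Delta> a = (\<Sum>r\<in>I. T (x r) (y r))"
  shows "(\<Sum>r\<in>I. haar (x r) *\<^sub>C y r) = haar a *\<^sub>C 1"
proof (rule states_separate)
  fix \<psi> :: "'a \<Rightarrow> complex"
  assume \<psi>: "state \<psi>"
  obtain \<tau> where \<tau>: "state \<tau>" "state (\<lambda>x. \<tau> (\<Delta> x))" "\<And>a b. \<tau> (T a b) = haar a * \<psi> b"
    using convolution_state[OF state_haar \<psi>] by blast
  show "\<psi> (\<Sum>r\<in>I. haar (x r) *\<^sub>C y r) = \<psi> (haar a *\<^sub>C 1)"
    using haar_convolution[OF \<psi> \<tau>, of a]
    by (simp add: assms state_sum[OF \<tau>(1)] \<tau>(3) state_sum[OF \<psi>] state_scaleC[OF \<psi>] state_one[OF \<psi>])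
qed

text \<open>The averaged matrices \<open>haar (star v * X * w)\<close> intertwine \<open>w\<close> and \<open>v\<close>; here one column of
  the statement, for an arbitrary \<open>b\<close> in place of an entry of \<open>w\<close>.\<close>

lemma haar_slice:
  assumes v: "unitary_rep T \<Delta> n v" and b: "\<Delta> b = (\<Sum>r\<in>I. T (x r) (y r))" and kc: "k < n" "c < n"
  shows "(\<Sum>r\<in>I. haar (star (v k c) * x r) *\<^sub>C y r) = (\<Sum>i<n. haar (star (v k i) * b) *\<^sub>C v c i)"
proof -
  have inv: "(\<Sum>a<n. \<Sum>r\<in>I. haar (star (v k a) * x r) *\<^sub>C (star (v a i) * y r)) = haar (star (v k i) * b) *\<^sub>C 1"
    if "i < n" for i
  proof -
    have "\<Delta> (star (v k i) * b) = (\<Sum>p\<in>{..<n} \<times> I.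
        T (star (v k (fst p)) * x (snd p)) (star (v (fst p) i) * y (snd p)))"
      using v kc that
      by (simp add: Delta_mult Delta_star b unitary_rep_def star_sum star_T sum_product T_mult
          sum.cartesian_product case_prod_beta)
    from haar_invariant[OF this] show ?thesis
      by (simp add: sum.cartesian_product case_prod_beta)
  qed
  \<comment> \<open>Multiplying \<open>inv\<close> from the left by \<open>v c i\<close> and summing
    over \<open>i\<close> brings in the orthonormality of the rows of \<open>v\<close>, which keeps
    only a = c.\<close>
  have "(\<Sum>i<n. haar (star (v k i) * b) *\<^sub>C v c i) = (\<Sum>i<n. v c i * (haar (star (v k i) * b) *\<^sub>C 1))"
    by (simp add: mult_scaleC_right)
  also have "\<dots> = (\<Sum>i<n. \<Sum>a<n. \<Sum>r\<in>I. haar (star (v k a) * x r) *\<^sub>C (v c i * star (v a i) * y r))"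
    by (intro sum.cong refl) (simp add: inv[symmetric] sum_distrib_left mult_scaleC_right mult.assoc)
  also have "\<dots> = (\<Sum>a<n. \<Sum>i<n. \<Sum>r\<in>I. haar (star (v k a) * x r) *\<^sub>C (v c i * star (v a i) * y r))"
    by (rule sum.swap)
  also have "\<dots> = (\<Sum>a<n. \<Sum>r\<in>I. \<Sum>i<n. haar (star (v k a) * x r) *\<^sub>C (v c i * star (v a i) * y r))"
    by (intro sum.cong refl sum.swap)
  also have "\<dots> = (\<Sum>a<n. \<Sum>r\<in>I. haar (star (v k a) * x r) *\<^sub>C ((if c = a then 1 else 0) * y r))"
    using v kc by (intro sum.cong refl)
      (simp add: unitary_rep_def flip: complex_vector.scale_sum_right sum_distrib_right)
  also have "\<dots> = (\<Sum>a<n. if c = a then (\<Sum>r\<in>I. haar (star (v k a) * x r) *\<^sub>C y r) else 0)"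
    by (intro sum.cong refl) auto
  also have "\<dots> = (\<Sum>r\<in>I. haar (star (v k c) * x r) *\<^sub>C y r)"
    using kc by simp
  finally show ?thesis ..
qed

end

section \<open>Generation by a unitary representation\<close>

text \<open>Used in two ways: \<open>p x = x\<close> expresses membership in the subspace by an
  equation that states can test, and composition with \<open>p\<close> turns a map that is linear on
  the subspace into one that is linear everywhere.\<close>

lemma linear_projection_exists:
  fixes S :: "'a :: cstar_algebra set"
  assumes S: "csubspace S"
  obtains p where "\<And>x. p x \<in> S" "\<And>x. x \<in> S \<Longrightarrow> p x = x"
    "\<And>x y. p (x + y) = p x + p y" "\<And>c x. p (c *\<^sub>C x) = c *\<^sub>C p x"
proof -
  interpret pair: vector_space_pair "scaleC :: complex \<Rightarrow> 'a \<Rightarrow> 'a" "scaleC :: complex \<Rightarrow> 'a \<Rightarrow> 'a" ..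
  obtain p where p: "range p \<subseteq> S" "Vector_Spaces.linear scaleC scaleC p" "\<forall>x\<in>S. p (id x) = x"
    using pair.linear_exists_left_inverse_on[OF complex_vector.linear_id S[unfolded csubspace_def]] by auto
  interpret p: Vector_Spaces.linear "scaleC :: complex \<Rightarrow> 'a \<Rightarrow> 'a" "scaleC :: complex \<Rightarrow> 'a \<Rightarrow> 'a" p
    by (rule p(2))
  show ?thesis
    using p by (intro that[of p]) (auto simp: p.add p.scale)
qed

lemma star_subalgebra_closure:
  assumes "star_subalgebra S"
  shows "star_subalgebra (closure S)"
proof -
  have S: "csubspace S" "1 \<in> S" "\<And>x y. x \<in> S \<Longrightarrow> y \<in> S \<Longrightarrow> x * y \<in> S" "\<And>x. x \<in> S \<Longrightarrow> star x \<in> S"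
    using assms by (auto simp: star_subalgebra_def)
  have closure_map: "f x \<in> closure S" if "continuous_on UNIV f" "\<And>x. x \<in> S \<Longrightarrow> f x \<in> closure S" "x \<in> closure S"
    for f :: "'a \<Rightarrow> 'a" and x
  proof -
    have "f ` closure S \<subseteq> closure S"
      using that(1,2) by (intro image_closure_subset) (auto intro: continuous_on_subset)
    then show ?thesis
      using that(3) by blast
  qed
  have inS: "x \<in> closure S" if "x \<in> S" for x
    using that closure_subset by blast
  have add: "x + y \<in> closure S" if "x \<in> closure S" "y \<in> closure S" for x y
  proof (rule closure_map[OF _ _ that(2)])
    fix y assume y: "y \<in> S"
    show "x + y \<in> closure S"
      by (rule closure_map[OF _ _ that(1)])
        (auto intro!: continuous_intros inS complex_vector.subspace_add[OF S(1)] y)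
  qed (intro continuous_intros)
  have mult: "x * y \<in> closure S" if "x \<in> closure S" "y \<in> closure S" for x y
  proof (rule closure_map[OF _ _ that(2)])
    fix y assume y: "y \<in> S"
    show "x * y \<in> closure S"
      by (rule closure_map[OF _ _ that(1)]) (auto intro!: continuous_intros inS S(3) y)
  qed (intro continuous_intros)
  have scale: "c *\<^sub>C x \<in> closure S" if "x \<in> closure S" for c x
    by (rule closure_map[OF _ _ that])
      (auto intro!: continuous_intros inS complex_vector.subspace_scale[OF S(1)])
  have star: "star x \<in> closure S" if "x \<in> closure S" for x
    by (rule closure_map[OF _ _ that]) (auto intro!: continuous_intros inS S(4))
  show ?thesis
    unfolding star_subalgebra_def complex_vector.subspace_def
    using S(2) complex_vector.subspace_0[OF S(1)] by (auto intro: inS add mult scale star)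
qed

lemma star_subalgebra_hull: "star_subalgebra (star_subalgebra hull X)"
  by (rule hull_in) (auto simp: star_subalgebra_def complex_vector.subspace_def)

context cqg_algebra
begin

lemma subspace_A: "csubspace A"
  and one_A: "1 \<in> A"
  and mult_A: "x \<in> A \<Longrightarrow> y \<in> A \<Longrightarrow> x * y \<in> A"
  and star_A: "x \<in> A \<Longrightarrow> star x \<in> A"
  using star_subalgebra_A by (auto simp: star_subalgebra_def)

lemmas zero_A = complex_vector.subspace_0[OF subspace_A]
lemmas add_A = complex_vector.subspace_add[OF subspace_A]
lemmas scaleC_A = complex_vector.subspace_scale[OF subspace_A]
lemmas sum_A = complex_vector.subspace_sum[OF subspace_A]

text \<open>The expression is continuous in \<open>a\<close>. The lemma is used at a = y, where it
  relates orthogonality to a dense set to the vanishing of \<open>haar (star y * y)\<close>.\<close>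

lemma haar_null_dense:
  assumes D: "closure D = UNIV" and null: "\<And>a. a \<in> D \<Longrightarrow> haar (star a * y) = 0"
  shows "haar (star a * y) = 0"
proof -
  have "continuous_on UNIV (\<lambda>a. haar (star a * y))"
    by (intro continuous_on_compose2[OF linear_continuous_on[OF bounded_linear_state[OF state_haar], of UNIV]]
        continuous_intros) auto
  then have "closed {a. haar (star a * y) = 0}"
    by (intro closed_Collect_eq continuous_intros)
  then have "closure D \<subseteq> {a. haar (star a * y) = 0}"
    using null by (intro closure_minimal) auto
  then show ?thesis
    using D by auto
qed

text \<open>A vector \<open>\<xi>\<close> orthogonal to all intertwiners from \<open>u\<close> to irreducible representations satisfies
  \<open>haar (star a * (\<Sum>k. \<xi> k *\<^sub>C u l k)) = 0\<close> for \<open>a \<in> A\<close>, hence vanishes by density of \<open>A\<close>.\<close>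

lemma unitary_rep_entries_in_A:
  assumes u: "unitary_rep T \<Delta> n u" and l: "l < n" "j < n"
  shows "u l j \<in> A"
proof -
  have slice: "(\<Sum>b<n. haar (star a * u l b) *\<^sub>C u b j) \<in> A" if "l < n" "a \<in> A" for l a
    using that(2) unfolding A_eq[THEN eqset_imp_iff]
  proof (induction rule: complex_vector.span_induct_alt)
    case base
    show ?case
      by (simp add: state_zero[OF state_haar] complex_vector.span_zero)
  next
    case (step c x y)
    then obtain m v k i where v: "irreducible_unitary_rep T \<Delta> m v" "k < m" "i < m" "x = v k i"
      by blast
    have "(\<Sum>b<n. haar (star x * u l b) *\<^sub>C u b j) = (\<Sum>r<m. haar (star (v k r) * u l j) *\<^sub>C v i r)"
      unfolding v(4) using u v that(1) l
      by (intro haar_slice) (auto simp: irreducible_unitary_rep_def unitary_rep_def)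
    also have "\<dots> \<in> cspan {u i j | n u i j. irreducible_unitary_rep T \<Delta> n u \<and> i < n \<and> j < n}"
      using v by (intro complex_vector.span_sum complex_vector.span_scale complex_vector.span_base) blast
    finally have "cnj c *\<^sub>C (\<Sum>b<n. haar (star x * u l b) *\<^sub>C u b j) + (\<Sum>b<n. haar (star y * u l b) *\<^sub>C u b j)
        \<in> cspan {u i j | n u i j. irreducible_unitary_rep T \<Delta> n u \<and> i < n \<and> j < n}"
      using step.IH by (intro complex_vector.span_add complex_vector.span_scale)
    then show ?case
      by (simp add: star_add star_scaleC distrib_right mult_scaleC_left state_add[OF state_haar]
          state_scaleC[OF state_haar] scaleC_add_left sum.distrib complex_vector.scale_sum_right scaleC_scaleC)
  qed
  obtain p where p: "\<And>x. p x \<in> A" "\<And>x. x \<in> A \<Longrightarrow> p x = x"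
    "\<And>x y. p (x + y) = p x + p y" "\<And>c x. p (c *\<^sub>C x) = c *\<^sub>C p x"
    using linear_projection_exists[OF subspace_A] by blast
  have p0: "p 0 = 0"
    using p(4)[of 0 0] by simp
  have p_sum: "p (\<Sum>i\<in>I. f i) = (\<Sum>i\<in>I. p (f i))" for I :: "nat set" and f
    by (induction I rule: infinite_finite_induct) (simp_all add: p(3) p0)
  have "p (u l j) = u l j"
  proof (rule states_separate)
    fix \<psi> :: "'a \<Rightarrow> complex"
    assume \<psi>: "state \<psi>"
    \<comment> \<open>\<xi> measures, as seen by \<psi>, how far column \<open>j\<close> is from
      \<open>A\<close>. It is orthogonal to the required vectors because the slices lie in
      \<open>A\<close> and \<open>p\<close> fixes them.\<close>
    define \<xi> where "\<xi> b = \<psi> (p (u b j)) - \<psi> (u b j)" for b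
    define y where "y l = (\<Sum>b<n. \<xi> b *\<^sub>C u l b)" for l
    have "haar (star a * y l) = 0" if "l < n" "a \<in> A" for l a
    proof -
      have "haar (star a * y l) = (\<Sum>b<n. haar (star a * u l b) * \<xi> b)"
        by (simp add: y_def sum_distrib_left mult_scaleC_right state_sum[OF state_haar]
            state_scaleC[OF state_haar] mult.commute)
      also have "\<dots> = \<psi> (p (\<Sum>b<n. haar (star a * u l b) *\<^sub>C u b j)) - \<psi> (\<Sum>b<n. haar (star a * u l b) *\<^sub>C u b j)"
        by (simp add: \<xi>_def right_diff_distrib sum_subtractf p_sum p(4) state_sum[OF \<psi>] state_scaleC[OF \<psi>])
      also have "\<dots> = 0"
        using p(2)[OF slice[OF that]] by simp
      finally show ?thesis .
    qed
    then have "haar (star (y l) * y l) = 0" if "l < n" for l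
      using haar_null_dense[OF dense_A] that by blast
    then have "haar (\<Sum>l<n. star (y l) * y l) = 0"
      by (simp add: state_sum[OF state_haar])
    then have "complex_of_real (\<Sum>k<n. (cmod (\<xi> k))\<^sup>2) = 0"
      unfolding y_def unitary_rep_isometric[OF u]
      by (simp only: state_scaleC[OF state_haar] state_one[OF state_haar] mult_1_right)
    then have "(\<Sum>k<n. (cmod (\<xi> k))\<^sup>2) = 0"
      by (simp only: of_real_eq_0_iff)
    then have "\<xi> l = 0"
      using l by (simp add: sum_nonneg_eq_0_iff)
    then show "\<psi> (p (u l j)) = \<psi> (u l j)"
      by (simp add: \<xi>_def)
  qed
  then show ?thesis
    using p(1)[of "u l j"] by simp
qed

text \<open>If \<open>haar (star (v k i) * b)\<close> is nonzero for some \<open>b \<in> B\<close>, the vectors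
  \<open>(haar (star (v k i) * b))\<^sub>i\<close>, \<open>b \<in> B\<close>, form a nonzero invariant subspace, which is everything.\<close>

lemma A_subset_dense_sub_bialgebra:
  assumes B: "star_subalgebra B" "closure B = UNIV" "\<And>b. b \<in> B \<Longrightarrow> \<Delta> b \<in> cspan (elementary_tensors T B B)"
  shows "A \<subseteq> B"
proof -
  have sub_B: "csubspace B"
    using B(1) by (simp add: star_subalgebra_def)
  have coproduct: "\<exists>(m :: nat) x y. (\<forall>r<m. x r \<in> B \<and> y r \<in> B) \<and> \<Delta> b = (\<Sum>r<m. T (x r) (y r))"
    if b: "b \<in> B" for b
  proof -
    obtain xs where xs: "set xs \<subseteq> B \<times> B" "\<Delta> b = (\<Sum>(a, b)\<leftarrow>xs. T a b)"
      by (rule span_tensors_list[OF sub_B B(3)[OF b]])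
    then have "\<Delta> b = (\<Sum>r<length xs. T (fst (xs ! r)) (snd (xs ! r)))"
      by (simp add: sum_list_sum_nth case_prod_beta atLeast0LessThan)
    moreover have "xs ! r \<in> B \<times> B" if "r < length xs" for r
      using xs(1) that nth_mem by blast
    then have "\<forall>r<length xs. fst (xs ! r) \<in> B \<and> snd (xs ! r) \<in> B"
      by (auto simp: mem_Times_iff)
    ultimately show ?thesis
      by (intro exI[of _ "length xs"] exI[of _ "\<lambda>r. fst (xs ! r)"] exI[of _ "\<lambda>r. snd (xs ! r)"]) simp
  qed
  have "v c j \<in> B" if irr: "irreducible_unitary_rep T \<Delta> n v" and cj: "c < n" "j < n" for n v c j
  proof -
    have v: "unitary_rep T \<Delta> n v" "n > 0"
      using irr by (auto simp: irreducible_unitary_rep_def)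
    \<comment> \<open>Column 0 has Haar length 1, so one of its entries is not null for the Haar
      state; density then replaces one factor by an element \<open>b0\<close> of
      \<open>B\<close>.\<close>
    have "haar (\<Sum>k<n. star (v k 0) * v k 0) = 1"
      using v by (simp add: unitary_rep_def state_one[OF state_haar])
    then have "(\<Sum>k<n. haar (star (v k 0) * v k 0)) \<noteq> 0"
      by (simp add: state_sum[OF state_haar])
    then obtain k where k: "k < n" "haar (star (v k 0) * v k 0) \<noteq> 0"
      by (meson lessThan_iff sum.neutral)
    have "\<exists>b\<in>B. haar (star b * v k 0) \<noteq> 0"
      using k(2) haar_null_dense[OF B(2), of "v k 0" "v k 0"] by blast
    then obtain b0 where b0: "b0 \<in> B" "haar (star (v k 0) * b0) \<noteq> 0"
      using state_star[OF state_haar, of "star _ * v k 0"] by (auto simp: star_mult star_star)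
    define t where "t b i = (if i < n then haar (star (v k i) * b) else 0)" for b i
    define W where "W = t ` B"
    have slice: "(\<Sum>i<n. t b i *\<^sub>C v c i) = (\<Sum>r<m. t (x r) c *\<^sub>C y r)"
      if "\<Delta> b = (\<Sum>r<m. T (x r) (y r))" "c < n" for b c x y and m :: nat
      using haar_slice[OF v(1) that(1) k(1) that(2)] that(2) by (simp add: t_def)
    have "invariant_subspace n v W"
      unfolding invariant_subspace_def
    proof (intro conjI ballI allI)
      show "W \<subseteq> {w. \<forall>i\<ge>n. w i = 0}"
        by (auto simp: W_def t_def)
      show "(\<lambda>_. 0) \<in> W"
        unfolding W_def using complex_vector.subspace_0[OF sub_B]
        by (intro image_eqI[of _ _ 0]) (auto simp: t_def state_zero[OF state_haar])
      show "(\<lambda>i. w i + w' i) \<in> W" if W: "w \<in> W" "w' \<in> W" for w w'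
      proof -
        obtain b b' where "b \<in> B" "b' \<in> B" "w = t b" "w' = t b'"
          using W by (auto simp: W_def)
        then show ?thesis
          unfolding W_def using complex_vector.subspace_add[OF sub_B]
          by (intro image_eqI[of _ _ "b + b'"]) (auto simp: t_def distrib_left state_add[OF state_haar])
      qed
      show "(\<lambda>i. c * w i) \<in> W" if W: "w \<in> W" for c w
      proof -
        obtain b where "b \<in> B" "w = t b"
          using W by (auto simp: W_def)
        then show ?thesis
          unfolding W_def using complex_vector.subspace_scale[OF sub_B]
          by (intro image_eqI[of _ _ "c *\<^sub>C b"]) (auto simp: t_def mult_scaleC_right state_scaleC[OF state_haar])
      qed
      show "\<exists>(m :: nat) z a. (\<forall>r<m. z r \<in> W) \<and> (\<forall>i<n. (\<Sum>j<n. w j *\<^sub>C v i j) = (\<Sum>r<m. z r i *\<^sub>C a r))"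
        if W: "w \<in> W" for w
      proof -
        obtain b where b: "b \<in> B" "w = t b"
          using W by (auto simp: W_def)
        obtain m :: nat and x y where xy: "\<forall>r<m. x r \<in> B \<and> y r \<in> B" "\<Delta> b = (\<Sum>r<m. T (x r) (y r))"
          using coproduct[OF b(1)] by blast
        show ?thesis
          using xy(1) slice[OF xy(2)]
          by (intro exI[of _ m] exI[of _ "\<lambda>r. t (x r)"] exI[of _ y]) (auto simp: W_def b)
      qed
    qed
    moreover have "W \<noteq> {\<lambda>_. 0}"
    proof
      assume "W = {\<lambda>_. 0}"
      then have "t b0 = (\<lambda>_. 0)"
        using b0(1) by (auto simp: W_def)
      then show False
        using b0(2) v(2) by (auto simp: t_def fun_eq_iff split: if_splits)
    qed
    ultimately have "W = {w. \<forall>i\<ge>n. w i = 0}"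
      using irr by (auto simp: irreducible_unitary_rep_def)
    then have "(\<lambda>i. if i = j then 1 else 0) \<in> W"
      using cj by auto
    then obtain b where b: "b \<in> B" "(\<lambda>i. if i = j then 1 else 0) = t b"
      unfolding W_def by blast
    have tb: "t b i = (if i = j then 1 else 0)" for i
      using fun_cong[OF b(2)] by simp
    obtain m :: nat and x y where xy: "\<forall>r<m. x r \<in> B \<and> y r \<in> B" "\<Delta> b = (\<Sum>r<m. T (x r) (y r))"
      using coproduct[OF b(1)] by blast
    \<comment> \<open>As \<open>t b\<close> is the basis vector at \<open>j\<close>, one side of
      \<open>slice\<close> is the single entry \<open>v c j\<close>, while the other is a
      combination of elements \<open>y r\<close> of \<open>B\<close>.\<close>
    have "v c j = (\<Sum>i<n. t b i *\<^sub>C v c i)"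
      using cj by (simp add: tb if_distrib[of "\<lambda>c. c *\<^sub>C _"] scaleC_one cong: if_cong)
    also have "\<dots> = (\<Sum>r<m. t (x r) c *\<^sub>C y r)"
      by (rule slice[OF xy(2) cj(1)])
    also have "\<dots> \<in> B"
      using xy(1) by (intro complex_vector.subspace_sum[OF sub_B] complex_vector.subspace_scale[OF sub_B]) auto
    finally show ?thesis .
  qed
  then show ?thesis
    unfolding A_eq using sub_B by (intro complex_vector.span_minimal) auto
qed

text \<open>The hypothesis only says that the entries generate a dense star-subalgebra. Since this
  subalgebra is stable under \<Delta>, \<open>A_subset_dense_sub_bialgebra\<close> upgrades density
  to containment of \<open>A\<close>.\<close>

lemma A_subset_generated:
  assumes u: "unitary_rep T \<Delta> n u"
    and gen: "(\<lambda>S. star_subalgebra S \<and> closed S) hull {u i j | i j. i < n \<and> j < n} = UNIV"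
  shows "A \<subseteq> star_subalgebra hull {u i j | i j. i < n \<and> j < n}" (is "A \<subseteq> ?B")
proof (rule A_subset_dense_sub_bialgebra)
  show B: "star_subalgebra ?B"
    by (rule star_subalgebra_hull)
  have u_in_B: "u i j \<in> ?B" if "i < n" "j < n" for i j
    using that by (intro hull_inc) blast
  have "(\<lambda>S. star_subalgebra S \<and> closed S) hull {u i j | i j. i < n \<and> j < n} \<subseteq> closure ?B"
  proof (rule hull_minimal)
    show "{u i j | i j. i < n \<and> j < n} \<subseteq> closure ?B"
      by (rule order_trans[OF hull_subset closure_subset])
    show "star_subalgebra (closure ?B) \<and> closed (closure ?B)"
      using star_subalgebra_closure[OF B] by simp
  qed
  then show "closure ?B = UNIV"
    using gen by auto
  have alg: "star_subalgebra (cspan (elementary_tensors T ?B ?B))"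
    by (intro star_subalgebra_span_tensors B)
  have "1 \<in> cspan (elementary_tensors T ?B ?B)"
    "\<And>x y. x \<in> cspan (elementary_tensors T ?B ?B) \<Longrightarrow> y \<in> cspan (elementary_tensors T ?B ?B) \<Longrightarrow>
       x * y \<in> cspan (elementary_tensors T ?B ?B)"
    "\<And>x. x \<in> cspan (elementary_tensors T ?B ?B) \<Longrightarrow> star x \<in> cspan (elementary_tensors T ?B ?B)"
    using alg unfolding star_subalgebra_def by blast+
  then have "star_subalgebra {b. \<Delta> b \<in> cspan (elementary_tensors T ?B ?B)}"
    unfolding star_subalgebra_def complex_vector.subspace_def
    using Delta_scaleC[of 0 0]
    by (simp add: Delta_add Delta_scaleC Delta_mult Delta_star Delta_one complex_vector.span_zero
        complex_vector.span_add complex_vector.span_scale)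
  moreover have "\<Delta> (u i j) \<in> cspan (elementary_tensors T ?B ?B)" if "i < n" "j < n" for i j
  proof -
    have "\<Delta> (u i j) = (\<Sum>k<n. T (u i k) (u k j))"
      using u that by (simp add: unitary_rep_def)
    also have "\<dots> \<in> cspan (elementary_tensors T ?B ?B)"
      using u_in_B that unfolding elementary_tensors_def
      by (intro complex_vector.span_sum complex_vector.span_base) auto
    finally show ?thesis .
  qed
  ultimately have "?B \<subseteq> {b. \<Delta> b \<in> cspan (elementary_tensors T ?B ?B)}"
    by (intro hull_minimal) auto
  then show "\<Delta> b \<in> cspan (elementary_tensors T ?B ?B)" if "b \<in> ?B" for b
    using that by blast
qed

end

section \<open>The Hilbert basis theorem\<close>

definition subring_set :: "'r :: comm_ring_1 set \<Rightarrow> bool" where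
  "subring_set R \<longleftrightarrow> 1 \<in> R \<and> (\<forall>x\<in>R. \<forall>y\<in>R. x - y \<in> R \<and> x * y \<in> R)"

definition submodule_set :: "'r :: comm_ring_1 set \<Rightarrow> 'r set \<Rightarrow> bool" where
  "submodule_set R M \<longleftrightarrow> 0 \<in> M \<and> (\<forall>x\<in>M. \<forall>y\<in>M. x + y \<in> M) \<and> (\<forall>r\<in>R. \<forall>x\<in>M. r * x \<in> M)"

definition noetherian_set :: "'r :: comm_ring_1 set \<Rightarrow> bool" where
  "noetherian_set R \<longleftrightarrow>
     (\<forall>M. submodule_set R M \<and> M \<subseteq> R \<longrightarrow> (\<exists>S. finite S \<and> S \<subseteq> M \<and> M \<subseteq> submodule_set R hull S))"

text \<open>A quotient of the polynomial ring over \<open>R\<close>: \<open>x\<close> may be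
  algebraic, so coefficients need not be unique. This keeps iterated extensions inside one
  type.\<close>

definition adjoin :: "'r :: comm_ring_1 set \<Rightarrow> 'r \<Rightarrow> 'r set" where
  "adjoin R x = {\<Sum>i<d. c i * x ^ i | (d :: nat) c. \<forall>i. c i \<in> R}"

lemma submodule_setD:
  assumes "submodule_set R M"
  shows "0 \<in> M" "x \<in> M \<Longrightarrow> y \<in> M \<Longrightarrow> x + y \<in> M" "r \<in> R \<Longrightarrow> x \<in> M \<Longrightarrow> r * x \<in> M"
  using assms by (auto simp: submodule_set_def)

lemma submodule_set_hull: "submodule_set R (submodule_set R hull S)"
  by (rule hull_in) (auto simp: submodule_set_def)

lemma submodule_set_diff:
  assumes R: "subring_set R" and M: "submodule_set R M" and "x \<in> M" "y \<in> M"
  shows "x - y \<in> M"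
proof -
  have "(1 - 1) - 1 \<in> R"
    using R unfolding subring_set_def by blast
  then have "((1 - 1) - 1) * y \<in> M"
    using submodule_setD(3)[OF M] assms(4) by blast
  then show ?thesis
    using submodule_setD(2)[OF M assms(3)] by fastforce
qed

context
  fixes R :: "'r :: comm_ring_1 set"
  assumes R: "subring_set R"
begin

lemma subring_set_1: "1 \<in> R"
  and subring_set_diff: "x \<in> R \<Longrightarrow> y \<in> R \<Longrightarrow> x - y \<in> R"
  and subring_set_mult: "x \<in> R \<Longrightarrow> y \<in> R \<Longrightarrow> x * y \<in> R"
  using R by (auto simp: subring_set_def)

lemma subring_set_0: "0 \<in> R"
  using subring_set_diff[OF subring_set_1 subring_set_1] by simp

lemma subring_set_minus: "x \<in> R \<Longrightarrow> - x \<in> R"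
  using subring_set_diff[OF subring_set_0] by simp

lemma subring_set_add: "x \<in> R \<Longrightarrow> y \<in> R \<Longrightarrow> x + y \<in> R"
  using subring_set_diff[OF _ subring_set_minus] by simp

lemma adjoin_add: "p \<in> adjoin R x \<Longrightarrow> q \<in> adjoin R x \<Longrightarrow> p + q \<in> adjoin R x"
proof -
  assume "p \<in> adjoin R x" "q \<in> adjoin R x"
  then obtain d c e b where c: "\<forall>i. c i \<in> R" "\<forall>i. b i \<in> R"
    and pq: "p = (\<Sum>i<d. c i * x ^ i)" "q = (\<Sum>i<e. b i * x ^ i)"
    unfolding adjoin_def by blast
  define m where "m = max d e"
  have pad: "(\<Sum>i<k. a i * x ^ i) = (\<Sum>i<m. (if i < k then a i else 0) * x ^ i)" if "k \<le> m" for k a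
  proof -
    have "(\<Sum>i<m. (if i < k then a i else 0) * x ^ i) = (\<Sum>i<k. (if i < k then a i else 0) * x ^ i)"
      using that by (intro sum.mono_neutral_right) auto
    then show ?thesis
      by simp
  qed
  have "p + q = (\<Sum>i<m. ((if i < d then c i else 0) + (if i < e then b i else 0)) * x ^ i)"
    unfolding pq pad[of d, unfolded m_def, simplified, folded m_def] pad[of e, unfolded m_def, simplified, folded m_def]
    by (simp add: sum.distrib distrib_right)
  then show "p + q \<in> adjoin R x"
    unfolding adjoin_def using c
    by (intro CollectI exI[of _ m] exI[of _ "\<lambda>i. (if i < d then c i else 0) + (if i < e then b i else 0)"])
      (auto intro: subring_set_add subring_set_0)
qed

lemma adjoin_scale:
  assumes "r \<in> R" "p \<in> adjoin R x"
  shows "r * p \<in> adjoin R x"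
proof -
  obtain d c where c: "\<forall>i. c i \<in> R" and p: "p = (\<Sum>i<d. c i * x ^ i)"
    using assms(2) unfolding adjoin_def by blast
  have "r * p = (\<Sum>i<d. (r * c i) * x ^ i)"
    by (simp add: p sum_distrib_left mult.assoc)
  then show ?thesis
    unfolding adjoin_def using c assms(1)
    by (intro CollectI exI[of _ d] exI[of _ "\<lambda>i. r * c i"]) (simp add: subring_set_mult)
qed

lemma adjoin_shift:
  assumes "p \<in> adjoin R x"
  shows "x * p \<in> adjoin R x"
proof -
  obtain d c where c: "\<forall>i. c i \<in> R" and p: "p = (\<Sum>i<d. c i * x ^ i)"
    using assms unfolding adjoin_def by blast
  have "x * p = (\<Sum>i<Suc d. (case i of 0 \<Rightarrow> 0 | Suc j \<Rightarrow> c j) * x ^ i)"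
    unfolding sum.lessThan_Suc_shift by (simp add: p sum_distrib_left mult_ac)
  moreover have "\<forall>i. (case i of 0 \<Rightarrow> 0 | Suc j \<Rightarrow> c j) \<in> R"
    using c subring_set_0 by (simp split: nat.split)
  ultimately show ?thesis
    unfolding adjoin_def by blast
qed

lemma base_subset_adjoin: "R \<subseteq> adjoin R x"
proof
  fix r assume "r \<in> R"
  then show "r \<in> adjoin R x"
    unfolding adjoin_def by (intro CollectI exI[of _ 1] exI[of _ "\<lambda>_. r"]) simp
qed

lemma adjoined_in_adjoin: "x \<in> adjoin R x"
  using adjoin_shift[of 1 x] base_subset_adjoin subring_set_1 by auto

lemma subring_set_adjoin: "subring_set (adjoin R x)"
proof -
  have pow: "x ^ i * q \<in> adjoin R x" if "q \<in> adjoin R x" for i q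
    using that by (induction i) (simp_all add: adjoin_shift mult.assoc)
  have "p * q \<in> adjoin R x" if p: "p \<in> adjoin R x" and q: "q \<in> adjoin R x" for p q
  proof -
    obtain d c where c: "\<forall>i. c i \<in> R" and p: "p = (\<Sum>i<d. c i * x ^ i)"
      using p unfolding adjoin_def by blast
    have "(\<Sum>i<d. c i * (x ^ i * q)) \<in> adjoin R x"
    proof (induction d)
      case 0
      show ?case
        using base_subset_adjoin subring_set_0 by auto
    next
      case (Suc d)
      then show ?case
        using c q by (simp add: adjoin_add adjoin_scale pow)
    qed
    then show ?thesis
      by (simp add: p sum_distrib_right mult.assoc)
  qed
  moreover have "p - q \<in> adjoin R x" if "p \<in> adjoin R x" "q \<in> adjoin R x" for p q
    using adjoin_add[OF that(1) adjoin_scale[OF subring_set_minus[OF subring_set_1] that(2)]] by simp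
  ultimately show ?thesis
    unfolding subring_set_def using subsetD[OF base_subset_adjoin subring_set_1] by auto
qed

text \<open>Coefficients at \<open>x ^ d\<close> of those elements of \<open>M\<close> that have
  some expression of degree at most \<open>d\<close>. The existential quantifier is essential, since
  an element may have several expressions.\<close>

definition leading :: "'r \<Rightarrow> 'r set \<Rightarrow> nat \<Rightarrow> 'r set" where
  "leading x M d = {r \<in> R. \<exists>c. (\<forall>i. c i \<in> R) \<and> r * x ^ d + (\<Sum>i<d. c i * x ^ i) \<in> M}"

lemma submodule_leading:
  assumes M: "submodule_set (adjoin R x) M"
  shows "submodule_set R (leading x M d)"
  unfolding submodule_set_def
proof (intro conjI ballI)
  show "0 \<in> leading x M d"
    unfolding leading_def using subring_set_0 submodule_setD(1)[OF M]
    by (intro CollectI conjI exI[of _ "\<lambda>_. 0"]) auto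
  show "r + s \<in> leading x M d" if rs: "r \<in> leading x M d" "s \<in> leading x M d" for r s
  proof -
    obtain b c where "r \<in> R" "s \<in> R" and bc: "\<forall>i. b i \<in> R" "\<forall>i. c i \<in> R"
      "r * x ^ d + (\<Sum>i<d. b i * x ^ i) \<in> M" "s * x ^ d + (\<Sum>i<d. c i * x ^ i) \<in> M"
      using rs unfolding leading_def by blast
    moreover have "(r + s) * x ^ d + (\<Sum>i<d. (b i + c i) * x ^ i) =
        (r * x ^ d + (\<Sum>i<d. b i * x ^ i)) + (s * x ^ d + (\<Sum>i<d. c i * x ^ i))"
      by (simp add: distrib_right sum.distrib algebra_simps)
    ultimately show ?thesis
      unfolding leading_def using submodule_setD(2)[OF M]
      by (intro CollectI conjI exI[of _ "\<lambda>i. b i + c i"]) (auto intro: subring_set_add)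
  qed
  show "t * r \<in> leading x M d" if t: "t \<in> R" and r: "r \<in> leading x M d" for t r
  proof -
    obtain b where "r \<in> R" and b: "\<forall>i. b i \<in> R" "r * x ^ d + (\<Sum>i<d. b i * x ^ i) \<in> M"
      using r unfolding leading_def by blast
    moreover have "(t * r) * x ^ d + (\<Sum>i<d. (t * b i) * x ^ i) = t * (r * x ^ d + (\<Sum>i<d. b i * x ^ i))"
      by (simp add: distrib_left sum_distrib_left mult_ac)
    moreover have "t \<in> adjoin R x"
      using t base_subset_adjoin by blast
    ultimately show ?thesis
      unfolding leading_def using submodule_setD(3)[OF M] t
      by (intro CollectI conjI exI[of _ "\<lambda>i. t * b i"]) (auto intro: subring_set_mult)
  qed
qed

lemma leading_Suc:
  assumes M: "submodule_set (adjoin R x) M"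
  shows "leading x M d \<subseteq> leading x M (Suc d)"
proof
  fix r assume "r \<in> leading x M d"
  then obtain b where r: "r \<in> R" and b: "\<forall>i. b i \<in> R" "r * x ^ d + (\<Sum>i<d. b i * x ^ i) \<in> M"
    unfolding leading_def by blast
  have "r * x ^ Suc d + (\<Sum>i<Suc d. (case i of 0 \<Rightarrow> 0 | Suc j \<Rightarrow> b j) * x ^ i) =
      x * (r * x ^ d + (\<Sum>i<d. b i * x ^ i))"
    unfolding sum.lessThan_Suc_shift by (simp add: sum_distrib_left distrib_left mult_ac)
  also have "\<dots> \<in> M"
    using submodule_setD(3)[OF M adjoined_in_adjoin b(2)] .
  finally show "r \<in> leading x M (Suc d)"
    unfolding leading_def using r b(1) subring_set_0
    by (intro CollectI conjI exI[of _ "\<lambda>i. case i of 0 \<Rightarrow> 0 | Suc j \<Rightarrow> b j"]) (auto split: nat.split)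
qed

lemma leading_mono:
  assumes "submodule_set (adjoin R x) M" "d \<le> e"
  shows "leading x M d \<subseteq> leading x M e"
  using assms(2) leading_Suc[OF assms(1)] by (rule lift_Suc_mono_le[rotated])

text \<open>Descent on the length of an expression: subtracting an element of \<open>J\<close> with
  the same top coefficient leaves a shorter expression, still in \<open>I\<close>.\<close>

lemma submodule_le_if_leading_le:
  assumes I: "submodule_set (adjoin R x) I" "I \<subseteq> adjoin R x"
    and J: "submodule_set (adjoin R x) J" "J \<subseteq> I"
    and le: "\<And>d. leading x I d \<subseteq> leading x J d"
  shows "I \<subseteq> J"
proof
  fix f assume f: "f \<in> I"
  then obtain d c where "\<forall>i. c i \<in> R" "f = (\<Sum>i<d. c i * x ^ i)"
    using I(2) unfolding adjoin_def by blast
  moreover have "(\<Sum>i<d. c i * x ^ i) \<in> J" if "\<forall>i. c i \<in> R" "(\<Sum>i<d. c i * x ^ i) \<in> I" for d c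
    using that
  proof (induction d arbitrary: c)
    case 0
    then show ?case
      using submodule_setD(1)[OF J(1)] by simp
  next
    case (Suc d)
    then have "c d \<in> leading x I d"
      unfolding leading_def by (auto simp: add.commute)
    then have "c d \<in> leading x J d"
      using le by blast
    then obtain b where b: "\<forall>i. b i \<in> R" "c d * x ^ d + (\<Sum>i<d. b i * x ^ i) \<in> J"
      unfolding leading_def by blast
    have eq: "(\<Sum>i<Suc d. c i * x ^ i) =
        (c d * x ^ d + (\<Sum>i<d. b i * x ^ i)) + (\<Sum>i<d. (c i - b i) * x ^ i)"
      by (simp add: left_diff_distrib sum_subtractf)
    have "(\<Sum>i<Suc d. c i * x ^ i) - (c d * x ^ d + (\<Sum>i<d. b i * x ^ i)) \<in> I"
      using Suc.prems(2) b(2) J(2) by (intro submodule_set_diff[OF subring_set_adjoin I(1)]) auto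
    then have "(\<Sum>i<d. (c i - b i) * x ^ i) \<in> I"
      unfolding eq by simp
    then have "(\<Sum>i<d. (c i - b i) * x ^ i) \<in> J"
      using Suc.prems(1) b(1) by (intro Suc.IH) (auto intro: subring_set_diff)
    then show ?case
      unfolding eq using b(2) submodule_setD(2)[OF J(1)] by blast
  qed
  ultimately show "f \<in> J"
    using f by blast
qed

text \<open>The modules \<open>leading x I d\<close> increase with \<open>d\<close>, and finite
  generation of their union makes them stop at some \<open>D\<close>. Lifting generators of the
  finitely many modules with d \<le> D gives generators of \<open>I\<close>.\<close>

theorem Hilbert_basis:
  assumes noeth: "noetherian_set R"
  shows "noetherian_set (adjoin R x)"
  unfolding noetherian_set_def
proof (intro allI impI)
  fix I assume "submodule_set (adjoin R x) I \<and> I \<subseteq> adjoin R x"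
  then have I: "submodule_set (adjoin R x) I" "I \<subseteq> adjoin R x"
    by auto
  have fg: "\<exists>S. finite S \<and> S \<subseteq> M \<and> M \<subseteq> submodule_set R hull S" if "submodule_set R M" "M \<subseteq> R" for M
    using noeth that unfolding noetherian_set_def by blast
  have sub: "leading x M d \<subseteq> R" for M d
    by (auto simp: leading_def)
  define L where "L = (\<Union>d. leading x I d)"
  have "submodule_set R L"
    unfolding submodule_set_def
  proof (intro conjI ballI)
    show "0 \<in> L"
      using submodule_setD(1)[OF submodule_leading[OF I(1)]] by (auto simp: L_def)
    show "r + s \<in> L" if rs: "r \<in> L" "s \<in> L" for r s
    proof -
      obtain d e where "r \<in> leading x I d" "s \<in> leading x I e"
        using rs by (auto simp: L_def)
      then have "r \<in> leading x I (max d e)" "s \<in> leading x I (max d e)"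
        using leading_mono[OF I(1)] by (meson max.cobounded1 max.cobounded2 subsetD)+
      then show ?thesis
        unfolding L_def using submodule_setD(2)[OF submodule_leading[OF I(1)]] by blast
    qed
    show "t * r \<in> L" if "t \<in> R" "r \<in> L" for t r
      using that submodule_setD(3)[OF submodule_leading[OF I(1)]] by (auto simp: L_def)
  qed
  moreover have "L \<subseteq> R"
    using sub by (auto simp: L_def)
  ultimately have "\<exists>S. finite S \<and> S \<subseteq> L \<and> L \<subseteq> submodule_set R hull S"
    by (rule fg)
  then obtain S where S: "finite S" "S \<subseteq> L" "L \<subseteq> submodule_set R hull S"
    by (elim exE conjE)
  have "\<exists>D. S \<subseteq> leading x I D"
    using S(1,2)
  proof (induction S rule: finite_induct)
    case (insert s S)
    then obtain D e where "S \<subseteq> leading x I D" "s \<in> leading x I e"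
      by (auto simp: L_def)
    then have "insert s S \<subseteq> leading x I (max D e)"
      using leading_mono[OF I(1), of D "max D e"] leading_mono[OF I(1), of e "max D e"] by auto
    then show ?case
      by blast
  qed auto
  then obtain D where "S \<subseteq> leading x I D" ..
  then have LD: "L \<subseteq> leading x I D"
    using S(3) hull_minimal[of S "leading x I D" "submodule_set R"] submodule_leading[OF I(1)] by blast
  have "\<forall>d. \<exists>S. finite S \<and> S \<subseteq> leading x I d \<and> leading x I d \<subseteq> submodule_set R hull S"
    by (intro allI fg submodule_leading[OF I(1)] sub)
  then obtain Sd where Sd: "\<And>d. finite (Sd d)" "\<And>d. Sd d \<subseteq> leading x I d"
    "\<And>d. leading x I d \<subseteq> submodule_set R hull Sd d"
    by metis
  have "\<forall>d. \<forall>s\<in>Sd d. \<exists>c. (\<forall>i. c i \<in> R) \<and> s * x ^ d + (\<Sum>i<d. c i * x ^ i) \<in> I"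
    using Sd(2) unfolding leading_def by blast
  then obtain c where c: "\<And>d s. s \<in> Sd d \<Longrightarrow> (\<forall>i. c d s i \<in> R) \<and> s * x ^ d + (\<Sum>i<d. c d s i * x ^ i) \<in> I"
    by metis
  define gens where "gens = (\<Union>d\<le>D. (\<lambda>s. s * x ^ d + (\<Sum>i<d. c d s i * x ^ i)) ` Sd d)"
  have gens: "finite gens" "gens \<subseteq> I"
    using Sd(1) c by (auto simp: gens_def)
  define J where "J = submodule_set (adjoin R x) hull gens"
  have J: "submodule_set (adjoin R x) J" "J \<subseteq> I"
    unfolding J_def by (rule submodule_set_hull) (rule hull_minimal[where S = "submodule_set (adjoin R x)", OF gens(2) I(1)])
  have leD: "leading x I d \<subseteq> leading x J d" if "d \<le> D" for d
  proof -
    have "Sd d \<subseteq> leading x J d"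
    proof
      fix s assume s: "s \<in> Sd d"
      have "s * x ^ d + (\<Sum>i<d. c d s i * x ^ i) \<in> J"
        unfolding J_def using s that by (intro hull_inc) (auto simp: gens_def)
      moreover have "s \<in> R"
        using s Sd(2) sub by blast
      ultimately show "s \<in> leading x J d"
        unfolding leading_def using c[OF s] by blast
    qed
    then have "submodule_set R hull Sd d \<subseteq> leading x J d"
      using submodule_leading[OF J(1)] by (rule hull_minimal)
    then show ?thesis
      using Sd(3) by blast
  qed
  \<comment> \<open>Above \<open>D\<close> the left side is contained in
    \<open>leading x I D\<close>, hence in \<open>leading x J D\<close>, and the modules of
    \<open>J\<close> increase as well.\<close>
  have "leading x I d \<subseteq> leading x J d" for d
  proof (cases "d \<le> D")
    case False
    have "leading x I d \<subseteq> leading x I D"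
      using LD by (auto simp: L_def)
    then show ?thesis
      using leD[of D] leading_mono[OF J(1), of D d] False by auto
  qed (rule leD)
  then have "I \<subseteq> J"
    by (rule submodule_le_if_leading_le[OF I J])
  then show "\<exists>S. finite S \<and> S \<subseteq> I \<and> I \<subseteq> submodule_set (adjoin R x) hull S"
    using gens unfolding J_def by blast
qed

end

text \<open>The finite set has to be chosen from \<open>F\<close> itself, not merely from the ideal
  of \<open>F\<close>. Therefore that ideal is built as a directed union over finite subsets, one of
  which captures all of its finitely many generators.\<close>

lemma noetherian_common_zeros:
  fixes R :: "('p \<Rightarrow> complex) set"
  assumes R: "subring_set R" "noetherian_set R" and F: "F \<subseteq> R"
  shows "\<exists>F'. finite F' \<and> F' \<subseteq> F \<and> (\<forall>p. (\<forall>f\<in>F'. f p = 0) \<longrightarrow> (\<forall>f\<in>F. f p = 0))"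
proof -
  define N where "N = (\<Union>F'\<in>{F'. finite F' \<and> F' \<subseteq> F}. submodule_set R hull F')"
  have NI: "f \<in> N" if "finite F'" "F' \<subseteq> F" "f \<in> submodule_set R hull F'" for f F'
    using that unfolding N_def by blast
  note hullD = submodule_setD[OF submodule_set_hull]
  have "submodule_set R N"
    unfolding submodule_set_def
  proof (intro conjI ballI)
    show "0 \<in> N"
      using NI[of "{}"] hullD(1) by blast
    show "f + g \<in> N" if fg: "f \<in> N" "g \<in> N" for f g
    proof -
      obtain F1 F2 where "finite F1" "F1 \<subseteq> F" "f \<in> submodule_set R hull F1"
        "finite F2" "F2 \<subseteq> F" "g \<in> submodule_set R hull F2"
        using fg unfolding N_def by blast
      then show ?thesis
        using hull_mono[of F1 "F1 \<union> F2" "submodule_set R"] hull_mono[of F2 "F1 \<union> F2" "submodule_set R"]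
        by (intro NI[of "F1 \<union> F2"] hullD(2)) auto
    qed
    show "r * f \<in> N" if "r \<in> R" "f \<in> N" for r f
      using that hullD(3) unfolding N_def by blast
  qed
  moreover have "N \<subseteq> R"
  proof -
    have "submodule_set R R"
      using R(1) by (simp add: submodule_set_def subring_set_0 subring_set_add subring_set_mult)
    then show ?thesis
      using F hull_minimal[of _ R "submodule_set R"] unfolding N_def by blast
  qed
  ultimately have "\<exists>S. finite S \<and> S \<subseteq> N \<and> N \<subseteq> submodule_set R hull S"
    using R(2) unfolding noetherian_set_def by simp
  then obtain S where S: "finite S" "S \<subseteq> N" "N \<subseteq> submodule_set R hull S"
    by (elim exE conjE)
  have "\<exists>F'. finite F' \<and> F' \<subseteq> F \<and> S \<subseteq> submodule_set R hull F'"
    using S(1,2)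
  proof (induction S rule: finite_induct)
    case (insert s S)
    then obtain F1 where F1: "finite F1" "F1 \<subseteq> F" "S \<subseteq> submodule_set R hull F1"
      by auto
    obtain F2 where F2: "finite F2" "F2 \<subseteq> F" "s \<in> submodule_set R hull F2"
      using insert.prems unfolding N_def by auto
    show ?case
      using F1 F2 hull_mono[of F1 "F1 \<union> F2" "submodule_set R"] hull_mono[of F2 "F1 \<union> F2" "submodule_set R"]
      by (intro exI[of _ "F1 \<union> F2"] conjI) auto
  qed auto
  then obtain F' where F': "finite F'" "F' \<subseteq> F" "S \<subseteq> submodule_set R hull F'"
    by blast
  then have N: "N \<subseteq> submodule_set R hull F'"
    using S(3) hull_minimal[where S = "submodule_set R", OF F'(3) submodule_set_hull[of R F']] by blast
  have "f p = 0" if zero: "\<And>f. f \<in> F' \<Longrightarrow> f p = 0" and f: "f \<in> F" for p f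
  proof -
    have "submodule_set R {f. f p = 0}"
      by (auto simp: submodule_set_def)
    then have "submodule_set R hull F' \<subseteq> {f. f p = 0}"
      using zero by (intro hull_minimal) auto
    moreover have "f \<in> N"
      using f by (intro NI[of "{f}"] hull_inc) auto
    ultimately show ?thesis
      using N by blast
  qed
  then show ?thesis
    using F'(1,2) by (intro exI[of _ F']) blast
qed

text \<open>Starting from the field of constants, where one nonzero element generates any nonzero
  ideal, the members of \<open>X\<close> are adjoined one by one with
  \<open>Hilbert_basis\<close>.\<close>

lemma polynomial_functions_exist:
  fixes X :: "('p \<Rightarrow> complex) set"
  assumes "finite X"
  obtains R where "subring_set R" "noetherian_set R" "X \<subseteq> R" "\<And>c. (\<lambda>_. c) \<in> R"
proof -
  have "\<exists>R. subring_set R \<and> noetherian_set R \<and> X \<subseteq> R \<and> (\<forall>c. (\<lambda>_. c) \<in> R)"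
    using assms
  proof (induction X rule: finite_induct)
    case empty
    define R where "R = range (\<lambda>(c :: complex) (_ :: 'p). c)"
    have "subring_set R"
      unfolding subring_set_def R_def by (auto simp: fun_eq_iff image_iff)
    moreover have "noetherian_set R"
      unfolding noetherian_set_def
    proof (intro allI impI)
      fix M assume M: "submodule_set R M \<and> M \<subseteq> R"
      show "\<exists>S. finite S \<and> S \<subseteq> M \<and> M \<subseteq> submodule_set R hull S"
      proof (cases "M \<subseteq> {0}")
        case True
        then show ?thesis
          using submodule_setD(1)[OF submodule_set_hull] by (intro exI[of _ "{}"]) auto
      next
        case False
        then obtain f where f: "f \<in> M" "f \<noteq> 0"
          by blast
        then obtain c where c: "f = (\<lambda>_. c)"
          using M by (auto simp: R_def)
        then have "c \<noteq> 0"
          using f(2) by (auto simp: zero_fun_def)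
        have "g \<in> submodule_set R hull {f}" if "g \<in> M" for g
        proof -
          obtain b where "g = (\<lambda>_. b)"
            using \<open>g \<in> M\<close> M unfolding R_def by blast
          then have "g = (\<lambda>_. b / c) * f"
            using \<open>c \<noteq> 0\<close> by (simp add: c fun_eq_iff)
          moreover have "(\<lambda>_. b / c) \<in> R"
            by (simp add: R_def)
          ultimately show ?thesis
            using submodule_setD(3)[OF submodule_set_hull, of _ R f "{f}"] by (simp add: hull_inc)
        qed
        then show ?thesis
          using f by (intro exI[of _ "{f}"]) auto
      qed
    qed
    ultimately show ?case
      by (intro exI[of _ R]) (auto simp: R_def)
  next
    case (insert x X)
    then obtain R where R: "subring_set R" "noetherian_set R" "X \<subseteq> R" "\<forall>c. (\<lambda>_. c) \<in> R"
      by blast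
    then show ?case
      using subring_set_adjoin[OF R(1)] Hilbert_basis[OF R(1,2)] adjoined_in_adjoin[OF R(1)]
        base_subset_adjoin[OF R(1)]
      by (intro exI[of _ "adjoin R x"]) blast
  qed
  then show ?thesis
    using that by blast
qed

section \<open>Automorphisms close to the identity\<close>

text \<open>For a vector in the kernel, the equation at an entry of largest modulus \<open>m\<close>
  would give \<open>m \<le> real n * e * m < m\<close>.\<close>

lemma near_identity_invertible:
  fixes t :: "nat \<Rightarrow> nat \<Rightarrow> complex"
  assumes near: "\<And>i j. i < n \<Longrightarrow> j < n \<Longrightarrow> cmod (t i j - (if i = j then 1 else 0)) \<le> e"
    and e: "real n * e < 1"
  obtains q where "\<And>i j. i < n \<Longrightarrow> j < n \<Longrightarrow> (\<Sum>k<n. t i k * q k j) = (if i = j then 1 else 0)"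
    and "\<And>i j. i < n \<Longrightarrow> j < n \<Longrightarrow> (\<Sum>k<n. q i k * t k j) = (if i = j then 1 else 0)"
proof -
  define M where "M = mat n n (\<lambda>(i, j). t i j)"
  have M: "M \<in> carrier_mat n n"
    by (simp add: M_def)
  have "det M \<noteq> 0"
  proof
    assume "det M = 0"
    then obtain v where v: "v \<in> carrier_vec n" "v \<noteq> 0\<^sub>v n" "mult_mat_vec M v = 0\<^sub>v n"
      using det_0_iff_vec_prod_zero[OF M] by blast
    define w where "w i = vec_index v i" for i
    have zero: "(\<Sum>j<n. t i j * w j) = 0" if "i < n" for i
    proof -
      have "vec_index (mult_mat_vec M v) i = (\<Sum>j<n. t i j * w j)"
        using that v(1) by (simp add: M_def scalar_prod_def w_def atLeast0LessThan)
      then show ?thesis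
        using v(3) that by simp
    qed
    have nz: "\<exists>i<n. w i \<noteq> 0"
      using v(1,2) by (metis carrier_vecD dim_vec eq_vecI index_zero_vec(1) index_zero_vec(2) w_def)
    define m where "m = Max ((\<lambda>i. cmod (w i)) ` {..<n})"
    have "n > 0"
      using nz by auto
    then have "m \<in> (\<lambda>i. cmod (w i)) ` {..<n}"
      unfolding m_def by (intro Max_in) auto
    then obtain i where i: "i < n" "cmod (w i) = m"
      by auto
    have le: "cmod (w j) \<le> m" if "j < n" for j
      unfolding m_def using that by (intro Max_ge) auto
    have m: "m > 0"
      using nz le by (metis norm_le_zero_iff not_le order_trans)
    have "w i = (\<Sum>j<n. (if i = j then w j else 0) - t i j * w j)"
      using zero[OF i(1)] i(1) by (simp add: sum_subtractf)
    also have "\<dots> = (\<Sum>j<n. ((if i = j then 1 else 0) - t i j) * w j)"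
      by (intro sum.cong refl) (simp add: left_diff_distrib)
    finally have "m \<le> (\<Sum>j<n. cmod (((if i = j then 1 else 0) - t i j) * w j))"
      unfolding i(2)[symmetric] by (metis norm_sum)
    also have "\<dots> \<le> (\<Sum>j<n. e * m)"
    proof (rule sum_mono)
      fix j assume "j \<in> {..<n}"
      then have "cmod ((if i = j then 1 else 0) - t i j) \<le> e" "cmod (w j) \<le> m"
        using near[OF i(1), of j] le[of j] by (simp_all only: norm_minus_commute lessThan_iff)
      then show "cmod (((if i = j then 1 else 0) - t i j) * w j) \<le> e * m"
        unfolding norm_mult using m by (intro mult_mono order_trans[OF norm_ge_zero]) auto
    qed
    also have "\<dots> = (real n * e) * m"
      by simp
    also have "\<dots> < 1 * m"
      using e m by (intro mult_strict_right_mono)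
    finally show False
      by simp
  qed
  then obtain Q where Q: "Q \<in> carrier_mat n n" "M * Q = 1\<^sub>m n" "Q * M = 1\<^sub>m n"
    using det_non_zero_imp_unit[OF M, of "()"]
    by (auto simp: Units_def ring_mat_def)
  define q where "q i j = index_mat Q (i, j)" for i j
  have "(\<Sum>k<n. t i k * q k j) = (if i = j then 1 else 0)" if "i < n" "j < n" for i j
  proof -
    have "index_mat (M * Q) (i, j) = (\<Sum>k<n. t i k * q k j)"
      using that Q(1) by (simp add: M_def scalar_prod_def q_def atLeast0LessThan)
    then show ?thesis
      using that by (simp add: Q)
  qed
  moreover have "(\<Sum>k<n. q i k * t k j) = (if i = j then 1 else 0)" if "i < n" "j < n" for i j
  proof -
    have "index_mat (Q * M) (i, j) = (\<Sum>k<n. q i k * t k j)"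
      using that Q(1) by (simp add: M_def scalar_prod_def q_def atLeast0LessThan)
    then show ?thesis
      using that by (simp add: Q)
  qed
  ultimately show ?thesis
    by (rule that)
qed

text \<open>The norm of \<open>'a\<close> is one of the competing C*-seminorms. So closeness in the
  universal norm implies closeness in the norm for which the Haar state is contractive.\<close>

lemma norm_le_universal_norm: "ereal (norm a) \<le> universal_norm A (a :: 'a :: cstar_algebra)"
proof -
  have "cstar_seminorm_on A norm"
    by (simp add: cstar_seminorm_on_def norm_triangle_ineq norm_scaleC norm_mult_ineq cstar_identity)
  then show ?thesis
    unfolding universal_norm_def by (intro SUP_upper) simp
qed

section \<open>The automorphism group and its inner subgroup\<close>

context cqg_algebra
begin

abbreviation "G \<equiv> aut_group T \<Delta> A"

lemma aut_iff: "\<alpha> \<in> carrier G \<longleftrightarrow> \<alpha> \<in> Bij A \<and>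
    (\<forall>a\<in>A. \<forall>b\<in>A. \<alpha> (a + b) = \<alpha> a + \<alpha> b) \<and> (\<forall>c. \<forall>a\<in>A. \<alpha> (c *\<^sub>C a) = c *\<^sub>C \<alpha> a) \<and>
    (\<forall>a\<in>A. \<forall>b\<in>A. \<alpha> (a * b) = \<alpha> a * \<alpha> b) \<and> (\<forall>a\<in>A. \<alpha> (star a) = star (\<alpha> a)) \<and>
    (\<forall>a\<in>A. \<forall>xs. set xs \<subseteq> A \<times> A \<and> \<Delta> a = (\<Sum>(x, y)\<leftarrow>xs. T x y) \<longrightarrow>
       \<Delta> (\<alpha> a) = (\<Sum>(x, y)\<leftarrow>xs. T (\<alpha> x) (\<alpha> y)))"
  by (simp add: aut_group_def)

context
  fixes \<alpha>
  assumes \<alpha>: "\<alpha> \<in> carrier G"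
begin

lemma aut_Bij: "\<alpha> \<in> Bij A"
  and aut_add: "a \<in> A \<Longrightarrow> b \<in> A \<Longrightarrow> \<alpha> (a + b) = \<alpha> a + \<alpha> b"
  and aut_scaleC: "a \<in> A \<Longrightarrow> \<alpha> (c *\<^sub>C a) = c *\<^sub>C \<alpha> a"
  and aut_mult: "a \<in> A \<Longrightarrow> b \<in> A \<Longrightarrow> \<alpha> (a * b) = \<alpha> a * \<alpha> b"
  and aut_star: "a \<in> A \<Longrightarrow> \<alpha> (star a) = star (\<alpha> a)"
  and aut_Delta: "a \<in> A \<Longrightarrow> set xs \<subseteq> A \<times> A \<Longrightarrow> \<Delta> a = (\<Sum>(x, y)\<leftarrow>xs. T x y) \<Longrightarrow>
       \<Delta> (\<alpha> a) = (\<Sum>(x, y)\<leftarrow>xs. T (\<alpha> x) (\<alpha> y))"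
  using \<alpha> unfolding aut_iff by blast+

lemma aut_bij: "bij_betw \<alpha> A A"
  using aut_Bij by (simp add: Bij_def)

lemma aut_in_A: "a \<in> A \<Longrightarrow> \<alpha> a \<in> A"
  using bij_betwE[OF aut_bij] by blast

lemma aut_zero: "\<alpha> 0 = 0"
  using aut_scaleC[OF zero_A, of 0] by simp

text \<open>Surjectivity provides a preimage of 1, and multiplicativity then makes the image of 1 a
  unit element.\<close>

lemma aut_one: "\<alpha> 1 = 1"
proof -
  obtain a where a: "a \<in> A" "\<alpha> a = 1"
    using aut_bij one_A unfolding bij_betw_def by (metis imageE)
  then show ?thesis
    using aut_mult[OF a(1) one_A] by simp
qed

lemma aut_sum: "(\<And>i. i \<in> I \<Longrightarrow> f i \<in> A) \<Longrightarrow> \<alpha> (\<Sum>i\<in>I. f i) = (\<Sum>i\<in>I. \<alpha> (f i))"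
  by (induction I rule: infinite_finite_induct) (simp_all add: aut_zero aut_add sum_A)

lemma aut_Delta_sum:
  assumes "a \<in> A" "\<And>k. k < (n :: nat) \<Longrightarrow> x k \<in> A \<and> y k \<in> A" "\<Delta> a = (\<Sum>k<n. T (x k) (y k))"
  shows "\<Delta> (\<alpha> a) = (\<Sum>k<n. T (\<alpha> (x k)) (\<alpha> (y k)))"
proof -
  have conv: "(\<Sum>(x, y)\<leftarrow>map (\<lambda>k. (x k, y k)) [0..<n]. f x y) = (\<Sum>k<n. f (x k) (y k))" for f :: "'a \<Rightarrow> 'a \<Rightarrow> 'b"
    by (simp add: o_def interv_sum_list_conv_sum_set_nat atLeast0LessThan)
  have "set (map (\<lambda>k. (x k, y k)) [0..<n]) \<subseteq> A \<times> A"
    using assms(2) by auto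
  from aut_Delta[OF assms(1) this, unfolded conv] assms(3) show ?thesis
    by simp
qed

lemma aut_unitary_rep:
  assumes u: "unitary_rep T \<Delta> n u"
  shows "unitary_rep T \<Delta> n (\<lambda>i j. \<alpha> (u i j))"
proof -
  note u_A = unitary_rep_entries_in_A[OF u]
  have "\<Delta> (\<alpha> (u i j)) = (\<Sum>k<n. T (\<alpha> (u i k)) (\<alpha> (u k j)))" if "i < n" "j < n" for i j
    using u that by (intro aut_Delta_sum) (auto simp: unitary_rep_def u_A)
  moreover have "(\<Sum>k<n. star (\<alpha> (u k i)) * \<alpha> (u k j)) = \<alpha> (\<Sum>k<n. star (u k i) * u k j)"
    if "i < n" "j < n" for i j
    using that by (subst aut_sum) (auto simp: u_A mult_A star_A aut_mult aut_star)
  moreover have "(\<Sum>k<n. \<alpha> (u i k) * star (\<alpha> (u j k))) = \<alpha> (\<Sum>k<n. u i k * star (u j k))"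
    if "i < n" "j < n" for i j
    using that by (subst aut_sum) (auto simp: u_A mult_A star_A aut_mult aut_star)
  ultimately show ?thesis
    using u by (simp add: unitary_rep_def aut_zero aut_one)
qed

end

text \<open>Pushing a presentation of \<open>\<Delta> (\<beta> a)\<close> forward by \<alpha> gives
  a second presentation of \<open>\<Delta> a\<close>. Applying \<beta> to both factors of the two
  presentations gives equal results; \<open>p\<close> makes this a bilinear map on the whole
  algebra, as \<open>tensor_list_eq\<close> requires.\<close>

lemma inverse_aut_Delta:
  assumes \<alpha>: "\<alpha> \<in> carrier G" and \<beta>: "\<And>a. a \<in> A \<Longrightarrow> \<beta> a \<in> A" "\<And>a. a \<in> A \<Longrightarrow> \<alpha> (\<beta> a) = a"
    "\<And>a. a \<in> A \<Longrightarrow> \<beta> (\<alpha> a) = a"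
    "\<And>a b. a \<in> A \<Longrightarrow> b \<in> A \<Longrightarrow> \<beta> (a + b) = \<beta> a + \<beta> b" "\<And>c a. a \<in> A \<Longrightarrow> \<beta> (c *\<^sub>C a) = c *\<^sub>C \<beta> a"
    and a: "a \<in> A" and xs: "set xs \<subseteq> A \<times> A" "\<Delta> a = (\<Sum>(x, y)\<leftarrow>xs. T x y)"
  shows "\<Delta> (\<beta> a) = (\<Sum>(x, y)\<leftarrow>xs. T (\<beta> x) (\<beta> y))"
proof -
  obtain p where p: "\<And>x. p x \<in> A" "\<And>x. x \<in> A \<Longrightarrow> p x = x"
    "\<And>x y. p (x + y) = p x + p y" "\<And>c x. p (c *\<^sub>C x) = c *\<^sub>C p x"
    using linear_projection_exists[OF subspace_A] by blast
  obtain ys where ys: "set ys \<subseteq> A \<times> A" "\<Delta> (\<beta> a) = (\<Sum>(x, y)\<leftarrow>ys. T x y)"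
    by (rule span_tensors_list[OF subspace_A Delta_A[OF \<beta>(1)[OF a]]])
  define zs where "zs = map (\<lambda>(x, y). (\<alpha> x, \<alpha> y)) ys"
  have zs_map: "(\<Sum>(x, y)\<leftarrow>zs. f x y) = (\<Sum>(x, y)\<leftarrow>ys. f (\<alpha> x) (\<alpha> y))" for f :: "'a \<Rightarrow> 'a \<Rightarrow> 'b"
    by (simp add: zs_def o_def case_prod_beta')
  have "(\<Sum>(x, y)\<leftarrow>zs. T x y) = (\<Sum>(x, y)\<leftarrow>xs. T x y)"
    using aut_Delta[OF \<alpha> \<beta>(1)[OF a] ys] \<beta>(2)[OF a] xs(2) by (simp add: zs_map)
  then have "(\<Sum>(x, y)\<leftarrow>zs. T (\<beta> (p x)) (\<beta> (p y))) = (\<Sum>(x, y)\<leftarrow>xs. T (\<beta> (p x)) (\<beta> (p y)))"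
    by (rule tensor_list_eq[where \<beta> = "\<lambda>x y. T (\<beta> (p x)) (\<beta> (p y))"])
      (simp_all add: p \<beta> T_add_left T_add_right T_scaleC_left T_scaleC_right)
  also have "(\<Sum>(x, y)\<leftarrow>zs. T (\<beta> (p x)) (\<beta> (p y))) = (\<Sum>(x, y)\<leftarrow>ys. T x y)"
    unfolding zs_map using ys(1)
    by (intro arg_cong[where f = sum_list] map_cong refl) (auto simp: aut_in_A[OF \<alpha>] p \<beta>)
  also have "(\<Sum>(x, y)\<leftarrow>xs. T (\<beta> (p x)) (\<beta> (p y))) = (\<Sum>(x, y)\<leftarrow>xs. T (\<beta> x) (\<beta> y))"
    using xs(1) by (intro arg_cong[where f = sum_list] map_cong refl) (auto simp: p)
  finally show ?thesis
    by (simp add: ys)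
qed

lemma group_aut: "group G"
proof -
  have "subgroup (carrier G) (BijGroup A)"
  proof (rule group.subgroupI[OF group_BijGroup])
    show "carrier G \<subseteq> carrier (BijGroup A)"
      by (auto simp: aut_iff BijGroup_def)
    have "(\<lambda>x\<in>A. x) \<in> carrier G"
      unfolding aut_iff
    proof (intro conjI ballI allI impI)
      fix a xs
      assume "a \<in> A" and xs: "set xs \<subseteq> A \<times> A \<and> \<Delta> a = (\<Sum>(x, y)\<leftarrow>xs. T x y)"
      then have "(\<Sum>(x, y)\<leftarrow>xs. T ((\<lambda>x\<in>A. x) x) ((\<lambda>x\<in>A. x) y)) = (\<Sum>(x, y)\<leftarrow>xs. T x y)"
        by (intro arg_cong[where f = sum_list] map_cong refl) auto
      then show "\<Delta> ((\<lambda>x\<in>A. x) a) = (\<Sum>(x, y)\<leftarrow>xs. T ((\<lambda>x\<in>A. x) x) ((\<lambda>x\<in>A. x) y))"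
        using \<open>a \<in> A\<close> xs by simp
    qed (simp_all add: id_Bij add_A scaleC_A mult_A star_A)
    then show "carrier G \<noteq> {}"
      by blast
    show "inv\<^bsub>BijGroup A\<^esub> \<alpha> \<in> carrier G" if \<alpha>: "\<alpha> \<in> carrier G" for \<alpha>
    proof -
      define \<beta> where "\<beta> = (\<lambda>x\<in>A. inv_into A \<alpha> x)"
      have img: "\<alpha> ` A = A" and inj: "inj_on \<alpha> A"
        using aut_bij[OF \<alpha>] by (auto simp: bij_betw_def)
      have \<beta>A: "\<beta> a \<in> A" and \<alpha>\<beta>: "\<alpha> (\<beta> a) = a" if "a \<in> A" for a
        using that img inv_into_into[of a \<alpha> A] f_inv_into_f[of a \<alpha> A] by (simp_all add: \<beta>_def)
      have \<beta>\<alpha>: "\<beta> (\<alpha> a) = a" if "a \<in> A" for a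
        using that inj aut_in_A[OF \<alpha>] by (simp add: \<beta>_def)
      have eqI: "\<beta> b = a" if "a \<in> A" "\<alpha> a = b" for a b
        using \<beta>\<alpha> that by blast
      have add: "\<beta> (a + b) = \<beta> a + \<beta> b" if "a \<in> A" "b \<in> A" for a b
        using that by (intro eqI) (simp_all add: add_A \<beta>A aut_add[OF \<alpha>] \<alpha>\<beta>)
      have scale: "\<beta> (c *\<^sub>C a) = c *\<^sub>C \<beta> a" if "a \<in> A" for c a
        using that by (intro eqI) (simp_all add: scaleC_A \<beta>A aut_scaleC[OF \<alpha>] \<alpha>\<beta>)
      have "\<beta> (a * b) = \<beta> a * \<beta> b" if "a \<in> A" "b \<in> A" for a b
        using that by (intro eqI) (simp_all add: mult_A \<beta>A aut_mult[OF \<alpha>] \<alpha>\<beta>)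
      moreover have "\<beta> (star a) = star (\<beta> a)" if "a \<in> A" for a
        using that by (intro eqI) (simp_all add: star_A \<beta>A aut_star[OF \<alpha>] \<alpha>\<beta>)
      moreover have "\<beta> \<in> Bij A"
        unfolding \<beta>_def by (rule restrict_inv_into_Bij[OF aut_Bij[OF \<alpha>]])
      ultimately have "\<beta> \<in> carrier G"
        unfolding aut_iff using add scale inverse_aut_Delta[OF \<alpha> \<beta>A \<alpha>\<beta> \<beta>\<alpha> add scale] by blast
      then show ?thesis
        by (simp add: inv_BijGroup[OF aut_Bij[OF \<alpha>]] \<beta>_def)
    qed
    show "\<alpha> \<otimes>\<^bsub>BijGroup A\<^esub> \<beta> \<in> carrier G" if \<alpha>: "\<alpha> \<in> carrier G" and \<beta>: "\<beta> \<in> carrier G" for \<alpha> \<beta>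
    proof -
      define \<gamma> where "\<gamma> = compose A \<alpha> \<beta>"
      have \<gamma>: "\<gamma> a = \<alpha> (\<beta> a)" if "a \<in> A" for a
        using that by (simp add: \<gamma>_def compose_eq)
      note rules = aut_in_A[OF \<beta>] aut_add[OF \<alpha>] aut_add[OF \<beta>] aut_mult[OF \<alpha>] aut_mult[OF \<beta>]
        aut_star[OF \<alpha>] aut_star[OF \<beta>] aut_scaleC[OF \<alpha>] aut_scaleC[OF \<beta>]
      have "\<gamma> \<in> carrier G"
        unfolding aut_iff
      proof (intro conjI ballI allI impI)
        show "\<gamma> \<in> Bij A"
          unfolding \<gamma>_def by (rule compose_Bij[OF aut_Bij[OF \<alpha>] aut_Bij[OF \<beta>]])
        fix a xs
        assume a: "a \<in> A" and xs: "set xs \<subseteq> A \<times> A \<and> \<Delta> a = (\<Sum>(x, y)\<leftarrow>xs. T x y)"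
        have "\<Delta> (\<beta> a) = (\<Sum>(x, y)\<leftarrow>map (\<lambda>(x, y). (\<beta> x, \<beta> y)) xs. T x y)"
          using aut_Delta[OF \<beta> a, of xs] xs by (simp add: o_def case_prod_beta')
        then have "\<Delta> (\<alpha> (\<beta> a)) = (\<Sum>(x, y)\<leftarrow>map (\<lambda>(x, y). (\<beta> x, \<beta> y)) xs. T (\<alpha> x) (\<alpha> y))"
          using xs by (intro aut_Delta[OF \<alpha> aut_in_A[OF \<beta> a]]) (auto intro: aut_in_A[OF \<beta>])
        also have "\<dots> = (\<Sum>(x, y)\<leftarrow>xs. T (\<alpha> (\<beta> x)) (\<alpha> (\<beta> y)))"
          by (simp add: o_def case_prod_beta')
        also have "\<dots> = (\<Sum>(x, y)\<leftarrow>xs. T (\<gamma> x) (\<gamma> y))"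
          using xs by (intro arg_cong[where f = sum_list] map_cong refl) (auto simp: \<gamma>)
        finally show "\<Delta> (\<gamma> a) = (\<Sum>(x, y)\<leftarrow>xs. T (\<gamma> x) (\<gamma> y))"
          by (simp add: \<gamma> a)
      qed (simp_all add: \<gamma> add_A mult_A scaleC_A star_A rules)
      then show ?thesis
        using \<alpha> \<beta> by (simp add: BijGroup_def \<gamma>_def aut_iff)
    qed
  qed
  then have "group (BijGroup A\<lparr>carrier := carrier G\<rparr>)"
    by (rule subgroup.subgroup_is_group[OF _ group_BijGroup])
  then show ?thesis
    by (simp add: aut_group_def)
qed

lemma aut_group_mult:
  assumes "\<alpha> \<in> carrier G" "\<beta> \<in> carrier G" "a \<in> A"
  shows "(\<alpha> \<otimes>\<^bsub>G\<^esub> \<beta>) a = \<alpha> (\<beta> a)"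
  using aut_Bij[OF assms(1)] aut_Bij[OF assms(2)] assms(3)
  by (simp add: aut_group_def BijGroup_def compose_eq)

lemma aut_group_one: "a \<in> A \<Longrightarrow> \<one>\<^bsub>G\<^esub> a = a"
  by (simp add: aut_group_def BijGroup_def)

lemma aut_group_inv:
  assumes "\<alpha> \<in> carrier G" "a \<in> A"
  shows "(inv\<^bsub>G\<^esub> \<alpha>) (\<alpha> a) = a" "\<alpha> ((inv\<^bsub>G\<^esub> \<alpha>) a) = a"
proof -
  interpret group G
    by (rule group_aut)
  show "(inv\<^bsub>G\<^esub> \<alpha>) (\<alpha> a) = a" "\<alpha> ((inv\<^bsub>G\<^esub> \<alpha>) a) = a"
    using assms aut_group_mult[of "inv\<^bsub>G\<^esub> \<alpha>" \<alpha> a] aut_group_mult[of \<alpha> "inv\<^bsub>G\<^esub> \<alpha>" a]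
    by (simp_all add: aut_group_one)
qed

text \<open>In the definition of invariant subspace the coefficients range over the whole algebra, where
  automorphisms are not defined; a linear projection moves them into \<open>A\<close>.\<close>

lemma aut_irreducible:
  assumes \<alpha>: "\<alpha> \<in> carrier G" and irr: "irreducible_unitary_rep T \<Delta> n u"
  shows "irreducible_unitary_rep T \<Delta> n (\<lambda>i j. \<alpha> (u i j))"
proof -
  interpret group G
    by (rule group_aut)
  have u: "unitary_rep T \<Delta> n u"
    using irr by (simp add: irreducible_unitary_rep_def)
  note u_A = unitary_rep_entries_in_A[OF u]
  define \<beta> where "\<beta> = inv\<^bsub>G\<^esub> \<alpha>"
  have \<beta>: "\<beta> \<in> carrier G"
    using \<alpha> by (simp add: \<beta>_def)
  have \<beta>\<alpha>: "\<beta> (\<alpha> a) = a" if "a \<in> A" for a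
    unfolding \<beta>_def by (rule aut_group_inv(1)[OF \<alpha> that])
  obtain p where p: "\<And>x. p x \<in> A" "\<And>x. x \<in> A \<Longrightarrow> p x = x"
    "\<And>x y. p (x + y) = p x + p y" "\<And>c x. p (c *\<^sub>C x) = c *\<^sub>C p x"
    using linear_projection_exists[OF subspace_A] by blast
  have p0: "p 0 = 0"
    using p(4)[of 0 0] by simp
  have p_sum: "p (\<Sum>i\<in>I. f i) = (\<Sum>i\<in>I. p (f i))" for I :: "nat set" and f
    by (induction I rule: infinite_finite_induct) (simp_all add: p(3) p0)
  have "invariant_subspace n u W" if W: "invariant_subspace n (\<lambda>i j. \<alpha> (u i j)) W" for W
    unfolding invariant_subspace_def
  proof (intro conjI ballI allI)
    fix w assume w: "w \<in> W"
    have "\<forall>w\<in>W. \<exists>(m :: nat) v a. (\<forall>r<m. v r \<in> W) \<and>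
        (\<forall>i<n. (\<Sum>j<n. w j *\<^sub>C \<alpha> (u i j)) = (\<Sum>r<m. v r i *\<^sub>C a r))"
      using W unfolding invariant_subspace_def by (elim conjE)
    from this[rule_format, OF w] obtain m :: nat and v a where va: "\<forall>r<m. v r \<in> W"
      "\<forall>i<n. (\<Sum>j<n. w j *\<^sub>C \<alpha> (u i j)) = (\<Sum>r<m. v r i *\<^sub>C a r)"
      by (elim exE conjE)
    have "(\<Sum>j<n. w j *\<^sub>C u i j) = (\<Sum>r<m. v r i *\<^sub>C \<beta> (p (a r)))" if i: "i < n" for i
    proof -
      have *: "(\<Sum>j<n. w j *\<^sub>C \<alpha> (u i j)) \<in> A"
        using i by (intro sum_A scaleC_A aut_in_A[OF \<alpha>] u_A) auto
      have "(\<Sum>j<n. w j *\<^sub>C u i j) = \<beta> (\<Sum>j<n. w j *\<^sub>C \<alpha> (u i j))"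
        using i by (subst aut_sum[OF \<beta>]) (auto simp: aut_scaleC[OF \<beta>] scaleC_A aut_in_A[OF \<alpha>] u_A \<beta>\<alpha>)
      also have "\<dots> = \<beta> (p (\<Sum>r<m. v r i *\<^sub>C a r))"
        using p(2)[OF *] va(2) i by simp
      also have "\<dots> = (\<Sum>r<m. v r i *\<^sub>C \<beta> (p (a r)))"
        by (simp add: p_sum p(1,4) aut_sum[OF \<beta>] aut_scaleC[OF \<beta>] scaleC_A)
      finally show ?thesis .
    qed
    then show "\<exists>(m :: nat) v a. (\<forall>r<m. v r \<in> W) \<and> (\<forall>i<n. (\<Sum>j<n. w j *\<^sub>C u i j) = (\<Sum>r<m. v r i *\<^sub>C a r))"
      using va(1) by (intro exI[of _ m] exI[of _ v] exI[of _ "\<lambda>r. \<beta> (p (a r))"]) blast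
  qed (use W in \<open>unfold invariant_subspace_def, blast+\<close>)
  then show ?thesis
    using irr aut_unitary_rep[OF \<alpha> u] unfolding irreducible_unitary_rep_def by blast
qed

lemma irreducible_character_in_A: "\<theta> \<in> irreducible_characters T \<Delta> \<Longrightarrow> \<theta> \<in> A"
  unfolding irreducible_characters_def irreducible_unitary_rep_def
  using unitary_rep_entries_in_A by (auto intro!: sum_A)

lemma aut_irreducible_character:
  assumes \<alpha>: "\<alpha> \<in> carrier G" and "\<theta> \<in> irreducible_characters T \<Delta>"
  shows "\<alpha> \<theta> \<in> irreducible_characters T \<Delta>"
proof -
  obtain n u where u: "irreducible_unitary_rep T \<Delta> n u" "\<theta> = (\<Sum>i<n. u i i)"
    using assms(2) by (auto simp: irreducible_characters_def)
  then have "\<alpha> \<theta> = (\<Sum>i<n. \<alpha> (u i i))"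
    using unitary_rep_entries_in_A
    by (auto simp: irreducible_unitary_rep_def intro!: aut_sum[OF \<alpha>])
  then show ?thesis
    unfolding irreducible_characters_def using aut_irreducible[OF \<alpha> u(1)]
    by (intro CollectI exI[of _ n] exI[of _ "\<lambda>i j. \<alpha> (u i j)"] conjI)
qed

text \<open>Automorphisms permute the irreducible characters, so conjugating an automorphism that
  fixes all of them gives another such one.\<close>

lemma normal_inner: "inner_aut T \<Delta> A \<lhd> G"
proof -
  interpret group G
    by (rule group_aut)
  note in_A = irreducible_character_in_A
  have inv_fixes: "(inv\<^bsub>G\<^esub> \<alpha>) \<theta> = \<theta>" if "\<alpha> \<in> carrier G" "\<alpha> \<theta> = \<theta>" "\<theta> \<in> A" for \<alpha> \<theta>
    using aut_group_inv(1)[OF that(1,3)] that(2) by simp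
  have "subgroup (inner_aut T \<Delta> A) G"
  proof (rule subgroupI)
    have "\<one>\<^bsub>G\<^esub> \<in> inner_aut T \<Delta> A"
      by (simp add: inner_aut_def aut_group_one in_A)
    then show "inner_aut T \<Delta> A \<noteq> {}"
      by blast
  qed (auto simp: inner_aut_def aut_group_mult in_A inv_fixes)
  moreover have "x \<otimes>\<^bsub>G\<^esub> h \<otimes>\<^bsub>G\<^esub> inv\<^bsub>G\<^esub> x \<in> inner_aut T \<Delta> A" if x: "x \<in> carrier G" and h: "h \<in> inner_aut T \<Delta> A" for x h
  proof -
    have hG: "h \<in> carrier G"
      using h by (simp add: inner_aut_def)
    have "(x \<otimes>\<^bsub>G\<^esub> h \<otimes>\<^bsub>G\<^esub> inv\<^bsub>G\<^esub> x) \<theta> = \<theta>" if \<theta>: "\<theta> \<in> irreducible_characters T \<Delta>" for \<theta>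
    proof -
      have "(inv\<^bsub>G\<^esub> x) \<theta> \<in> irreducible_characters T \<Delta>"
        by (rule aut_irreducible_character[OF inv_closed[OF x] \<theta>])
      then have "h ((inv\<^bsub>G\<^esub> x) \<theta>) = (inv\<^bsub>G\<^esub> x) \<theta>"
        using h unfolding inner_aut_def by blast
      then show ?thesis
        using x hG in_A[OF \<theta>]
        by (simp add: aut_group_mult aut_in_A[of "inv\<^bsub>G\<^esub> x"] aut_group_inv)
    qed
    then show ?thesis
      using x hG by (simp add: inner_aut_def)
  qed
  ultimately show ?thesis
    by (simp add: normal_inv_iff)
qed

text \<open>Normality reconciles the right cosets that make up the quotient with the left translates
  that define the topology.\<close>

lemma inner_coset_eq:
  assumes \<alpha>: "\<alpha> \<in> carrier G" and \<nu>: "\<nu> \<in> inner_aut T \<Delta> A"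
  shows "inner_aut T \<Delta> A #>\<^bsub>G\<^esub> (\<alpha> \<otimes>\<^bsub>G\<^esub> \<nu>) = inner_aut T \<Delta> A #>\<^bsub>G\<^esub> \<alpha>"
proof -
  interpret normal "inner_aut T \<Delta> A" G
    by (rule normal_inner)
  have "\<alpha> \<otimes>\<^bsub>G\<^esub> \<nu> \<in> \<alpha> <#\<^bsub>G\<^esub> inner_aut T \<Delta> A"
    using \<nu> by (auto simp: l_coset_def)
  then have "\<alpha> \<otimes>\<^bsub>G\<^esub> \<nu> \<in> inner_aut T \<Delta> A #>\<^bsub>G\<^esub> \<alpha>"
    using coset_eq \<alpha> by blast
  then show ?thesis
    using repr_independence[OF _ \<alpha> subgroup_axioms] by simp
qed

text \<open>The matrix \<open>t = haar (star (\<alpha> u) * u)\<close> intertwines \<open>u\<close> and \<open>\<alpha> u\<close>, and is close to the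
  identity.\<close>

lemma near_identity_aut:
  assumes u: "unitary_rep T \<Delta> n u"
  shows "\<exists>e>0. \<forall>\<alpha>\<in>carrier G. (\<forall>i<n. \<forall>j<n. norm (\<alpha> (u i j) - u i j) < e) \<longrightarrow>
    (\<forall>i<n. \<forall>j<n. \<exists>c. \<alpha> (u i j) = (\<Sum>k<n. \<Sum>l<n. c k l *\<^sub>C u k l)) \<and>
    \<alpha> (\<Sum>i<n. u i i) = (\<Sum>i<n. u i i)"
proof -
  \<comment> \<open>\<open>M\<close> dominates every column sum of norms, and the summand 1 keeps it
    positive. With the \<open>e\<close> below, \<open>real n * (e * M)\<close> equals n / (2 (n +
    1)), as \<open>near_identity_invertible\<close> needs.\<close>
  define M where "M = 1 + (\<Sum>k<n. \<Sum>j<n. norm (u k j))"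
  define e where "e = 1 / (2 * (real n + 1) * M)"
  have M: "M > 0"
    unfolding M_def by (intro add_pos_nonneg sum_nonneg) auto
  then have e: "e > 0"
    by (simp add: e_def)
  have small: "real n * (e * M) < 1"
  proof -
    have "e * M = 1 / (2 * (real n + 1))"
      using M by (simp add: e_def)
    then show ?thesis
      by (simp only:) (simp add: field_simps)
  qed
  note u_A = unitary_rep_entries_in_A[OF u]
  have "(\<forall>i<n. \<forall>j<n. \<exists>c. \<alpha> (u i j) = (\<Sum>k<n. \<Sum>l<n. c k l *\<^sub>C u k l)) \<and> \<alpha> (\<Sum>i<n. u i i) = (\<Sum>i<n. u i i)"
    if \<alpha>: "\<alpha> \<in> carrier G" and near: "\<And>i j. i < n \<Longrightarrow> j < n \<Longrightarrow> norm (\<alpha> (u i j) - u i j) < e" for \<alpha>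
  proof -
    define v where "v i j = \<alpha> (u i j)" for i j
    have v: "unitary_rep T \<Delta> n v"
      unfolding v_def by (rule aut_unitary_rep[OF \<alpha> u])
    define t where "t i j = haar (\<Sum>k<n. star (v k i) * u k j)" for i j
    have "cmod (t i j - (if i = j then 1 else 0)) \<le> e * M" if ij: "i < n" "j < n" for i j
    proof -
      \<comment> \<open>Unitarity of \<open>u\<close> writes the Kronecker delta as the same average
        with \<open>u\<close> in place of \<open>v\<close>, so only the differences
        \<open>v k i - u k i\<close> remain.\<close>
      have "t i j - (if i = j then 1 else 0) = haar (\<Sum>k<n. star (v k i) * u k j) - haar (\<Sum>k<n. star (u k i) * u k j)"
        using u ij by (simp add: t_def unitary_rep_def state_one[OF state_haar] state_zero[OF state_haar])
      also have "\<dots> = haar (\<Sum>k<n. star (v k i - u k i) * u k j)"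
        by (simp add: star_diff left_diff_distrib sum_subtractf state_diff[OF state_haar])
      finally have "cmod (t i j - (if i = j then 1 else 0)) \<le> norm (\<Sum>k<n. star (v k i - u k i) * u k j)"
        using state_norm_le[OF state_haar] by metis
      also have "\<dots> \<le> (\<Sum>k<n. e * norm (u k j))"
      proof (rule sum_norm_le)
        fix k assume "k \<in> {..<n}"
        then have "norm (v k i - u k i) \<le> e"
          using near[of k i] ij by (simp add: v_def less_imp_le)
        then show "norm (star (v k i - u k i) * u k j) \<le> e * norm (u k j)"
          using norm_mult_ineq[of "star (v k i - u k i)" "u k j"]
            mult_right_mono[of "norm (v k i - u k i)" e "norm (u k j)"] by simp
      qed
      also have "\<dots> = e * (\<Sum>k<n. norm (u k j))"
        by (simp add: sum_distrib_left)
      also have "(\<Sum>k<n. norm (u k j)) \<le> (\<Sum>k<n. \<Sum>j<n. norm (u k j))"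
        using ij by (intro sum_mono member_le_sum) auto
      then have "e * (\<Sum>k<n. norm (u k j)) \<le> e * M"
        using e by (intro mult_left_mono) (auto simp: M_def)
      finally show ?thesis .
    qed
    from near_identity_invertible[OF this small] obtain q where
      tq: "\<And>i j. i < n \<Longrightarrow> j < n \<Longrightarrow> (\<Sum>k<n. t i k * q k j) = (if i = j then 1 else 0)" and
      qt: "\<And>i j. i < n \<Longrightarrow> j < n \<Longrightarrow> (\<Sum>k<n. q i k * t k j) = (if i = j then 1 else 0)"
      by blast
    have intertwine: "(\<Sum>b<n. t c b *\<^sub>C u b j) = (\<Sum>i<n. t i j *\<^sub>C v c i)" if cj: "c < n" "j < n" for c j
    proof -
      have "(\<Sum>b<n. haar (star (v k c) * u k b) *\<^sub>C u b j) = (\<Sum>i<n. haar (star (v k i) * u k j) *\<^sub>C v c i)"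
        if "k < n" for k
        using u that cj by (intro haar_slice[OF v]) (auto simp: unitary_rep_def)
      then have "(\<Sum>k<n. \<Sum>b<n. haar (star (v k c) * u k b) *\<^sub>C u b j) =
          (\<Sum>k<n. \<Sum>i<n. haar (star (v k i) * u k j) *\<^sub>C v c i)"
        by (simp cong: sum.cong_simp)
      then show ?thesis
        unfolding t_def state_sum[OF state_haar] complex_vector.scale_sum_left
        by (subst (1 2) sum.swap)
    qed
    \<comment> \<open>In matrix form, t u = v t becomes v = t u q with \<open>q\<close> the inverse
      of \<open>t\<close>. This gives the span statement, and cyclicity of the trace gives the
      character.\<close>
    have eq: "v c k = (\<Sum>b<n. \<Sum>j<n. (t c b * q j k) *\<^sub>C u b j)" if ck: "c < n" "k < n" for c k
    proof -
      have "v c k = (\<Sum>i<n. (if i = k then 1 else 0) *\<^sub>C v c i)"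
        using ck by (simp add: if_distrib[of "\<lambda>c. c *\<^sub>C _"] scaleC_one cong: if_cong)
      also have "\<dots> = (\<Sum>i<n. \<Sum>j<n. (t i j * q j k) *\<^sub>C v c i)"
        using ck by (intro sum.cong refl) (simp add: tq flip: complex_vector.scale_sum_left)
      also have "\<dots> = (\<Sum>j<n. \<Sum>i<n. (t i j * q j k) *\<^sub>C v c i)"
        by (rule sum.swap)
      also have "\<dots> = (\<Sum>j<n. q j k *\<^sub>C (\<Sum>b<n. t c b *\<^sub>C u b j))"
        using ck by (intro sum.cong refl)
          (simp add: intertwine complex_vector.scale_sum_right scaleC_scaleC mult.commute)
      also have "\<dots> = (\<Sum>j<n. \<Sum>b<n. (t c b * q j k) *\<^sub>C u b j)"
        by (simp add: complex_vector.scale_sum_right scaleC_scaleC mult.commute)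
      also have "\<dots> = (\<Sum>b<n. \<Sum>j<n. (t c b * q j k) *\<^sub>C u b j)"
        by (rule sum.swap)
      finally show ?thesis .
    qed
    have "\<alpha> (\<Sum>i<n. u i i) = (\<Sum>c<n. v c c)"
      unfolding v_def by (rule aut_sum[OF \<alpha>]) (simp add: u_A)
    also have "\<dots> = (\<Sum>c<n. \<Sum>b<n. \<Sum>j<n. (t c b * q j c) *\<^sub>C u b j)"
      by (simp add: eq)
    also have "\<dots> = (\<Sum>b<n. \<Sum>c<n. \<Sum>j<n. (t c b * q j c) *\<^sub>C u b j)"
      by (rule sum.swap)
    also have "\<dots> = (\<Sum>b<n. \<Sum>j<n. \<Sum>c<n. (t c b * q j c) *\<^sub>C u b j)"
      by (intro sum.cong refl sum.swap)
    also have "\<dots> = (\<Sum>b<n. \<Sum>j<n. (if j = b then 1 else 0) *\<^sub>C u b j)"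
      by (intro sum.cong refl)
        (simp add: qt[unfolded mult.commute[of "q _ _"]] flip: complex_vector.scale_sum_left)
    also have "\<dots> = (\<Sum>b<n. u b b)"
      by (simp add: if_distrib[of "\<lambda>c. c *\<^sub>C _"] scaleC_one cong: if_cong)
    finally have "\<alpha> (\<Sum>i<n. u i i) = (\<Sum>i<n. u i i)" .
    moreover have "\<exists>c. \<alpha> (u i j) = (\<Sum>k<n. \<Sum>l<n. c k l *\<^sub>C u k l)" if "i < n" "j < n" for i j
      using eq[OF that] unfolding v_def by (rule exI[of _ "\<lambda>k l. t i k * q l j"])
    ultimately show ?thesis
      by blast
  qed
  note main = this
  show ?thesis
    by (rule exI[of _ e], intro conjI[OF e] ballI impI, rule main) auto
qed

end

section \<open>Discreteness of the outer automorphism group\<close>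

text \<open>Functions p \<mapsto> \<Sum> f(p) b with finitely many coefficient functions
  \<open>f\<close> in \<open>R\<close> and fixed vectors \<open>b\<close>: the algebra-valued
  polynomial maps.\<close>

inductive combination :: "('p \<Rightarrow> complex) set \<Rightarrow> ('p \<Rightarrow> 'a :: cstar_algebra) \<Rightarrow> bool" for R where
  zero: "combination R (\<lambda>_. 0)"
| add: "f \<in> R \<Longrightarrow> combination R g \<Longrightarrow> combination R (\<lambda>p. f p *\<^sub>C b + g p)"

lemma combination_add:
  assumes "combination R g" "combination R h"
  shows "combination R (\<lambda>p. g p + h p)"
  using assms(1) by (induction rule: combination.induct)
    (auto simp: assms(2) add.assoc intro: combination.add)

lemma combination_single: "f \<in> R \<Longrightarrow> combination R (\<lambda>p. f p *\<^sub>C b)"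
  using combination.add[OF _ combination.zero] by fastforce

lemma combination_sum:
  "(\<And>i. i \<in> I \<Longrightarrow> combination R (g i)) \<Longrightarrow> combination R (\<lambda>p. \<Sum>i\<in>I. g i p)"
  by (induction I rule: infinite_finite_induct) (auto intro: combination.zero combination_add)

context
  fixes R :: "('p \<Rightarrow> complex) set"
  assumes R: "subring_set R"
begin

lemma combination_scale:
  assumes "combination R g" "f \<in> R"
  shows "combination R (\<lambda>p. f p *\<^sub>C g p)"
  using assms(1)
proof (induction rule: combination.induct)
  case (add f' g b)
  have "f * f' \<in> R"
    by (rule subring_set_mult[OF R assms(2) add(1)])
  from combination.add[OF this add(3), of b] show ?case
    by (simp add: scaleC_add_right scaleC_scaleC)
qed (simp add: combination.zero)

lemma combination_mult:
  assumes "combination R g" "combination R h"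
  shows "combination R (\<lambda>p. g p * h p)"
proof -
  have left: "combination R (\<lambda>p. b * h p)" for b
    using assms(2) by (induction rule: combination.induct)
      (auto simp: distrib_left mult_scaleC_right intro: combination.intros)
  show ?thesis
    using assms(1)
  proof (induction rule: combination.induct)
    case (add f g b)
    from combination_add[OF combination_scale[OF left add(1), of b] add(3)] show ?case
      by (simp add: distrib_right mult_scaleC_left)
  qed (simp add: combination.zero)
qed

text \<open>Each state turns an algebra-valued polynomial map into a scalar function in
  \<open>R\<close>, the form in which the noetherian property can be applied.\<close>

lemma state_combination:
  assumes \<psi>: "state \<psi>" and const: "\<And>c. (\<lambda>_. c) \<in> R" and g: "combination R g"
  shows "(\<lambda>p. \<psi> (g p)) \<in> R"
  using g
proof (induction rule: combination.induct)
  case zero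
  show ?case
    by (simp add: const)
next
  case (add f g b)
  have "f * (\<lambda>_. \<psi> b) + (\<lambda>p. \<psi> (g p)) \<in> R"
    by (intro subring_set_add[OF R] subring_set_mult[OF R] add const)
  then show ?case
    by (simp add: state_add[OF \<psi>] state_scaleC[OF \<psi>] plus_fun_def times_fun_def)
qed

end

context cqg_algebra
begin

text \<open>Automorphisms preserving the span of the entries of \<open>u\<close> act on \<open>A\<close> polynomially in their
  matrix on that span, so by the Hilbert basis theorem finitely many of the equations
  \<open>\<alpha> \<theta> = \<theta>\<close> imply all others.\<close>

lemma finitely_many_characters:
  assumes u: "unitary_rep T \<Delta> n u" and gen: "A \<subseteq> star_subalgebra hull {u i j | i j. i < n \<and> j < n}"
  obtains X where "finite X" "X \<subseteq> irreducible_characters T \<Delta>"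
    "\<And>\<alpha>. \<lbrakk>\<alpha> \<in> carrier G; \<And>i j. i < n \<Longrightarrow> j < n \<Longrightarrow> \<exists>c. \<alpha> (u i j) = (\<Sum>k<n. \<Sum>l<n. c k l *\<^sub>C u k l);
       \<And>\<theta>. \<theta> \<in> X \<Longrightarrow> \<alpha> \<theta> = \<theta>\<rbrakk> \<Longrightarrow> \<alpha> \<in> inner_aut T \<Delta> A"
proof -
  note u_A = unitary_rep_entries_in_A[OF u]
  define G0 where "G0 = {\<alpha> \<in> carrier G. \<forall>i<n. \<forall>j<n. \<exists>c. \<alpha> (u i j) = (\<Sum>k<n. \<Sum>l<n. c k l *\<^sub>C u k l)}"
  \<comment> \<open>The entries of \<open>u\<close> may be linearly dependent, so the coefficients
    are not determined; any choice will do. Off \<open>G0\<close> the values are arbitrary.\<close>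
  define m where "m \<alpha> i j = (SOME c. \<alpha> (u i j) = (\<Sum>k<n. \<Sum>l<n. c k l *\<^sub>C u k l))" for \<alpha> i j
  have m: "\<alpha> (u i j) = (\<Sum>k<n. \<Sum>l<n. m \<alpha> i j k l *\<^sub>C u k l)" if "\<alpha> \<in> G0" "i < n" "j < n" for \<alpha> i j
    unfolding m_def using that by (intro someI_ex[of "\<lambda>c. \<alpha> (u i j) = (\<Sum>k<n. \<Sum>l<n. c k l *\<^sub>C u k l)"]) (simp add: G0_def)
  define M where "M = (\<lambda>(i, j, k, l) \<alpha>. m \<alpha> i j k l) ` ({..<n} \<times> {..<n} \<times> {..<n} \<times> {..<n})"
  \<comment> \<open>Conjugate coefficients are adjoined as separate generators, because they occur
    in the images of the adjoint entries.\<close>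
  define M' where "M' = (\<lambda>(i, j, k, l) \<alpha>. cnj (m \<alpha> i j k l)) ` ({..<n} \<times> {..<n} \<times> {..<n} \<times> {..<n})"
  have "finite (M \<union> M')"
    by (simp add: M_def M'_def)
  then obtain R where R: "subring_set R" "noetherian_set R" "M \<union> M' \<subseteq> R" "\<And>c. (\<lambda>_. c) \<in> R"
    by (rule polynomial_functions_exist) blast
  have mR: "(\<lambda>\<alpha>. m \<alpha> i j k l) \<in> R" "(\<lambda>\<alpha>. cnj (m \<alpha> i j k l)) \<in> R"
    if "i < n" "j < n" "k < n" "l < n" for i j k l
  proof -
    have "(\<lambda>\<alpha>. m \<alpha> i j k l) \<in> M"
      unfolding M_def using that by (intro image_eqI[of _ _ "(i, j, k, l)"]) auto
    moreover have "(\<lambda>\<alpha>. cnj (m \<alpha> i j k l)) \<in> M'"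
      unfolding M'_def using that by (intro image_eqI[of _ _ "(i, j, k, l)"]) auto
    ultimately show "(\<lambda>\<alpha>. m \<alpha> i j k l) \<in> R" "(\<lambda>\<alpha>. cnj (m \<alpha> i j k l)) \<in> R"
      using R(3) by blast+
  qed
  have G0: "\<alpha> \<in> carrier G" if "\<alpha> \<in> G0" for \<alpha>
    using that by (simp add: G0_def)
  define E where "E a \<longleftrightarrow> (\<exists>g. combination R g \<and> (\<forall>\<alpha>\<in>G0. \<alpha> a = g \<alpha>))" for a
  have EI: "E a" if "combination R g" "\<And>\<alpha>. \<alpha> \<in> G0 \<Longrightarrow> \<alpha> a = g \<alpha>" for a g
    using that unfolding E_def by blast
  have E_const: "E a" if "\<And>\<alpha>. \<alpha> \<in> G0 \<Longrightarrow> \<alpha> a = a" for a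
    by (rule EI[OF combination_single[OF R(4)[of 1]]]) (simp add: that scaleC_one)
  have E0: "E 0" and E1: "E 1"
    using aut_zero aut_one G0 by (auto intro!: E_const)
  have E_add: "E (a + b)" if "E a" "E b" "a \<in> A" "b \<in> A" for a b
  proof -
    obtain g h where gh: "combination R g" "combination R h"
      and eq: "\<forall>\<alpha>\<in>G0. \<alpha> a = g \<alpha>" "\<forall>\<alpha>\<in>G0. \<alpha> b = h \<alpha>"
      using \<open>E a\<close> \<open>E b\<close> unfolding E_def by auto
    show ?thesis
      by (rule EI[OF combination_add[OF gh]]) (simp add: aut_add[OF G0] that eq)
  qed
  have E_mult: "E (a * b)" if "E a" "E b" "a \<in> A" "b \<in> A" for a b
  proof -
    obtain g h where gh: "combination R g" "combination R h"
      and eq: "\<forall>\<alpha>\<in>G0. \<alpha> a = g \<alpha>" "\<forall>\<alpha>\<in>G0. \<alpha> b = h \<alpha>"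
      using \<open>E a\<close> \<open>E b\<close> unfolding E_def by auto
    show ?thesis
      by (rule EI[OF combination_mult[OF R(1) gh]]) (simp add: aut_mult[OF G0] that eq)
  qed
  have E_scale: "E (c *\<^sub>C a)" if "E a" "a \<in> A" for c a
  proof -
    obtain g where g: "combination R g" and eq: "\<forall>\<alpha>\<in>G0. \<alpha> a = g \<alpha>"
      using \<open>E a\<close> unfolding E_def by auto
    show ?thesis
      by (rule EI[OF combination_scale[OF R(1) g R(4)[of c]]]) (simp add: aut_scaleC[OF G0] that eq)
  qed
  have E_u: "E (u i j)" "E (star (u i j))" if ij: "i < n" "j < n" for i j
  proof -
    show "E (u i j)"
    proof (rule EI)
      show "combination R (\<lambda>\<alpha>. \<Sum>k<n. \<Sum>l<n. m \<alpha> i j k l *\<^sub>C u k l)"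
        using ij by (intro combination_sum combination_single mR) auto
    qed (simp add: m ij)
    show "E (star (u i j))"
    proof (rule EI)
      show "combination R (\<lambda>\<alpha>. \<Sum>k<n. \<Sum>l<n. cnj (m \<alpha> i j k l) *\<^sub>C star (u k l))"
        using ij by (intro combination_sum combination_single mR) auto
    qed (simp add: aut_star[OF G0] u_A m ij star_sum star_scaleC)
  qed
  \<comment> \<open>\<open>R\<close> is not known to be closed under conjugation, so
    \<open>E\<close> is demanded of \<open>a\<close> and \<open>star a\<close> together; this makes
    the set star-closed.\<close>
  have "star_subalgebra {a \<in> A. E a \<and> E (star a)}"
    unfolding star_subalgebra_def complex_vector.subspace_def
    by (simp add: E0 E1 E_add E_mult E_scale zero_A one_A add_A mult_A scaleC_A star_A
        star_add star_mult star_scaleC star_star)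
  then have "star_subalgebra hull {u i j | i j. i < n \<and> j < n} \<subseteq> {a \<in> A. E a \<and> E (star a)}"
    using E_u u_A by (intro hull_minimal) auto
  then have E_A: "E a" if "a \<in> A" for a
    using gen that by blast
  \<comment> \<open>Members of \<open>R\<close> are functions of all maps, so they are tied to the
    scalar equations only on \<open>G0\<close>.\<close>
  define F where "F = {f \<in> R. \<exists>\<theta>\<in>irreducible_characters T \<Delta>. \<exists>\<psi>. state \<psi> \<and> (\<forall>\<alpha>\<in>G0. f \<alpha> = \<psi> (\<alpha> \<theta> - \<theta>))}"
  have "F \<subseteq> R"
    by (auto simp: F_def)
  from noetherian_common_zeros[OF R(1,2) this] obtain F' where F': "finite F'" "F' \<subseteq> F" "\<forall>\<alpha>. (\<forall>f\<in>F'. f \<alpha> = 0) \<longrightarrow> (\<forall>f\<in>F. f \<alpha> = 0)"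
    by (elim exE conjE)
  have "\<forall>f\<in>F'. \<exists>\<theta>. \<theta> \<in> irreducible_characters T \<Delta> \<and> (\<exists>\<psi>. state \<psi> \<and> (\<forall>\<alpha>\<in>G0. f \<alpha> = \<psi> (\<alpha> \<theta> - \<theta>)))"
    using F'(2) unfolding F_def by blast
  then obtain X where X: "\<And>f. f \<in> F' \<Longrightarrow> X f \<in> irreducible_characters T \<Delta>"
    "\<And>f. f \<in> F' \<Longrightarrow> \<exists>\<psi>. state \<psi> \<and> (\<forall>\<alpha>\<in>G0. f \<alpha> = \<psi> (\<alpha> (X f) - X f))"
    by metis
  show ?thesis
  proof (rule that[of "X ` F'"])
    show "finite (X ` F')" "X ` F' \<subseteq> irreducible_characters T \<Delta>"
      using F'(1) X(1) by auto
    fix \<alpha>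
    assume \<alpha>: "\<alpha> \<in> carrier G" "\<And>i j. i < n \<Longrightarrow> j < n \<Longrightarrow> \<exists>c. \<alpha> (u i j) = (\<Sum>k<n. \<Sum>l<n. c k l *\<^sub>C u k l)"
      and fix_X: "\<And>\<theta>. \<theta> \<in> X ` F' \<Longrightarrow> \<alpha> \<theta> = \<theta>"
    have \<alpha>0: "\<alpha> \<in> G0"
      using \<alpha> by (simp add: G0_def)
    have "f \<alpha> = 0" if f: "f \<in> F'" for f
    proof -
      obtain \<psi> where "state \<psi>" "f \<alpha> = \<psi> (\<alpha> (X f) - X f)"
        using X(2)[OF f] \<alpha>0 by blast
      then show ?thesis
        using fix_X[of "X f"] f by (simp add: state_zero)
    qed
    then have zero: "f \<alpha> = 0" if "f \<in> F" for f
      using F'(3) that by blast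
    have "\<alpha> \<theta> = \<theta>" if \<theta>: "\<theta> \<in> irreducible_characters T \<Delta>" for \<theta>
    proof (rule states_separate)
      fix \<psi> :: "'a \<Rightarrow> complex"
      assume \<psi>: "state \<psi>"
      obtain g where g: "combination R g" "\<forall>\<alpha>\<in>G0. \<alpha> \<theta> = g \<alpha>"
        using E_A[OF irreducible_character_in_A[OF \<theta>]] unfolding E_def by blast
      define f where "f = (\<lambda>\<alpha>. \<psi> (g \<alpha>)) - (\<lambda>_. \<psi> \<theta>)"
      have "f \<in> R"
        unfolding f_def by (intro subring_set_diff[OF R(1)] state_combination[OF R(1) \<psi>] R(4) g(1))
      moreover have "f \<alpha> = \<psi> (\<alpha> \<theta> - \<theta>)" if "\<alpha> \<in> G0" for \<alpha>
        using g(2) that by (simp add: f_def state_diff[OF \<psi>])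
      ultimately have "f \<in> F"
        unfolding F_def using \<theta> \<psi> by blast
      then have "f \<alpha> = 0"
        by (rule zero)
      then show "\<psi> (\<alpha> \<theta>) = \<psi> \<theta>"
        using g(2) \<alpha>0 by (simp add: f_def)
    qed
    then show "\<alpha> \<in> inner_aut T \<Delta> A"
      using \<alpha>(1) by (simp add: inner_aut_def)
  qed
qed

text \<open>The entries of \<open>u\<close> secure the invariant span, and the entries of one
  representation for each member of \<open>X\<close> secure the finitely many character
  equations.\<close>

lemma identity_neighbourhood_inner:
  assumes u: "unitary_rep T \<Delta> n u"
    and gen: "(\<lambda>S. star_subalgebra S \<and> closed S) hull {u i j | i j. i < n \<and> j < n} = UNIV"
  obtains S e where "finite S" "S \<subseteq> A" "e > 0" "identity_neighbourhood T \<Delta> A S e \<subseteq> inner_aut T \<Delta> A"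
proof -
  obtain X where X: "finite X" "X \<subseteq> irreducible_characters T \<Delta>"
    "\<And>\<alpha>. \<lbrakk>\<alpha> \<in> carrier G; \<And>i j. i < n \<Longrightarrow> j < n \<Longrightarrow> \<exists>c. \<alpha> (u i j) = (\<Sum>k<n. \<Sum>l<n. c k l *\<^sub>C u k l);
       \<And>\<theta>. \<theta> \<in> X \<Longrightarrow> \<alpha> \<theta> = \<theta>\<rbrakk> \<Longrightarrow> \<alpha> \<in> inner_aut T \<Delta> A"
    by (rule finitely_many_characters[OF u A_subset_generated[OF u gen]]) blast
  define near where "near S e \<alpha> \<longleftrightarrow> (\<forall>a\<in>S. norm (\<alpha> a - a) < e)" for S and e :: real and \<alpha> :: "'a \<Rightarrow> 'a"
  define entries where "entries k v = (\<lambda>(i, j). v i j) ` ({..<k} \<times> {..<k})" for k :: nat and v :: "nat \<Rightarrow> nat \<Rightarrow> 'a"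
  have near_entries: "near (entries k v) e \<alpha> \<longleftrightarrow> (\<forall>i<k. \<forall>j<k. norm (\<alpha> (v i j) - v i j) < e)" for k v e \<alpha>
    by (auto simp: near_def entries_def)
  have entries: "finite (entries k v)" "unitary_rep T \<Delta> k v \<Longrightarrow> entries k v \<subseteq> A" for k v
    using unitary_rep_entries_in_A by (auto simp: entries_def)
  have "\<exists>S e. finite S \<and> S \<subseteq> A \<and> e > 0 \<and> (\<forall>\<alpha>\<in>carrier G. near S e \<alpha> \<longrightarrow> (\<forall>\<theta>\<in>X. \<alpha> \<theta> = \<theta>))"
    using X(1,2)
  proof (induction X rule: finite_induct)
    case empty
    show ?case
      by (intro exI[of _ "{}"] exI[of _ 1]) simp
  next
    case (insert \<theta> X)
    then obtain S e where S: "finite S" "S \<subseteq> A" "e > 0"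
      "\<And>\<alpha>. \<alpha> \<in> carrier G \<Longrightarrow> near S e \<alpha> \<Longrightarrow> \<forall>\<theta>\<in>X. \<alpha> \<theta> = \<theta>"
      by auto
    obtain k v where v: "unitary_rep T \<Delta> k v" "\<theta> = (\<Sum>i<k. v i i)"
      using insert.prems by (auto simp: irreducible_characters_def irreducible_unitary_rep_def)
    obtain e' where e': "e' > 0" "\<And>\<alpha>. \<alpha> \<in> carrier G \<Longrightarrow> near (entries k v) e' \<alpha> \<Longrightarrow> \<alpha> \<theta> = \<theta>"
      using near_identity_aut[OF v(1)] unfolding near_entries v(2) by auto
    have "near S e \<alpha> \<and> near (entries k v) e' \<alpha>" if "near (S \<union> entries k v) (min e e') \<alpha>" for \<alpha>
      using that by (auto simp: near_def)
    then show ?case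
      using S e' entries v(1)
      by (intro exI[of _ "S \<union> entries k v"] exI[of _ "min e e'"]) auto
  qed
  then obtain S e where S: "finite S" "S \<subseteq> A" "e > 0"
    "\<And>\<alpha>. \<alpha> \<in> carrier G \<Longrightarrow> near S e \<alpha> \<Longrightarrow> \<forall>\<theta>\<in>X. \<alpha> \<theta> = \<theta>"
    by auto
  obtain e' where e': "e' > 0" "\<And>\<alpha> i j. \<alpha> \<in> carrier G \<Longrightarrow> near (entries n u) e' \<alpha> \<Longrightarrow> i < n \<Longrightarrow> j < n \<Longrightarrow>
      \<exists>c. \<alpha> (u i j) = (\<Sum>k<n. \<Sum>l<n. c k l *\<^sub>C u k l)"
    using near_identity_aut[OF u] unfolding near_entries by auto
  have "identity_neighbourhood T \<Delta> A (S \<union> entries n u) (min e e') \<subseteq> inner_aut T \<Delta> A"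
  proof
    fix \<alpha> assume "\<alpha> \<in> identity_neighbourhood T \<Delta> A (S \<union> entries n u) (min e e')"
    then have \<alpha>: "\<alpha> \<in> carrier G" and "\<forall>a\<in>S \<union> entries n u. universal_norm A (\<alpha> a - a) < ereal (min e e')"
      by (simp_all add: identity_neighbourhood_def)
    then have "norm (\<alpha> a - a) < min e e'" if "a \<in> S \<union> entries n u" for a
      using norm_le_universal_norm[of "\<alpha> a - a" A] that le_less_trans less_ereal.simps(1) by blast
    then have "near S e \<alpha>" "near (entries n u) e' \<alpha>"
      by (auto simp: near_def)
    then show "\<alpha> \<in> inner_aut T \<Delta> A"
      using S(4)[OF \<alpha>] e'(2)[OF \<alpha>] by (intro X(3)[OF \<alpha>]) auto
  qed
  then show ?thesis
    using S(1-3) e'(1) entries u by (intro that[of "S \<union> entries n u" "min e e'"]) auto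
qed

end

theorem theorem2p7:
  fixes T :: "'a :: cstar_algebra \<Rightarrow> 'a \<Rightarrow> 'b :: cstar_algebra"
    and L :: "'b \<Rightarrow> 'a \<Rightarrow> 'c :: cstar_algebra"
    and R :: "'a \<Rightarrow> 'b \<Rightarrow> 'c"
    and \<Delta> :: "'a \<Rightarrow> 'b"
    and A :: "'a set"
  assumes "compact_matrix_quantum_group T L R \<Delta>"
    and "is_cqg_algebra T \<Delta> A"
  shows "out_topology T \<Delta> A = discrete_topology (carrier (out_group T \<Delta> A))"
proof -
  have "minimal_tensor_product T" "star_hom \<Delta>"
    using assms(1) by (simp_all add: compact_matrix_quantum_group_def compact_quantum_group_def)
  then interpret cqg_algebra T \<Delta> A
    using assms(2) by unfold_locales
  obtain n u where u: "unitary_rep T \<Delta> n u"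
    "(\<lambda>S. star_subalgebra S \<and> closed S) hull {u i j | i j. i < n \<and> j < n} = UNIV"
    using assms(1) by (auto simp: compact_matrix_quantum_group_def)
  obtain S e where S: "finite S" "S \<subseteq> A" "e > 0" "identity_neighbourhood T \<Delta> A S e \<subseteq> inner_aut T \<Delta> A"
    by (rule identity_neighbourhood_inner[OF u])
  interpret G: group G
    by (rule group_aut)
  define f where "f \<alpha> = inner_aut T \<Delta> A #>\<^bsub>G\<^esub> \<alpha>" for \<alpha>
  \<comment> \<open>One pair \<open>S\<close>, \<open>e\<close> serves all points: right
    multiplication by an inner automorphism does not change the coset, so every preimage under
    \<open>f\<close> is open.\<close>
  have saturated: "openin (aut_topology T \<Delta> A) {\<alpha> \<in> carrier G. f \<alpha> \<in> U}" for U
    unfolding openin_aut_topology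
  proof (intro conjI ballI exI)
    fix \<alpha> assume \<alpha>: "\<alpha> \<in> {\<alpha> \<in> carrier G. f \<alpha> \<in> U}"
    show "\<alpha> <#\<^bsub>G\<^esub> identity_neighbourhood T \<Delta> A S e \<subseteq> {\<alpha> \<in> carrier G. f \<alpha> \<in> U}"
    proof
      fix \<gamma> assume "\<gamma> \<in> \<alpha> <#\<^bsub>G\<^esub> identity_neighbourhood T \<Delta> A S e"
      then obtain \<nu> where \<nu>: "\<nu> \<in> inner_aut T \<Delta> A" "\<gamma> = \<alpha> \<otimes>\<^bsub>G\<^esub> \<nu>"
        using S(4) by (auto simp: l_coset_def)
      then have "\<gamma> \<in> carrier G" "f \<gamma> = f \<alpha>"
        using \<alpha> inner_coset_eq[of \<alpha> \<nu>] by (auto simp: f_def inner_aut_def)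
      then show "\<gamma> \<in> {\<alpha> \<in> carrier G. f \<alpha> \<in> U}"
        using \<alpha> by simp
    qed
  qed (use S in auto)
  \<comment> \<open>The case U = UNIV shows that the whole group is open, which identifies the
    underlying space of the topology.\<close>
  have "{\<alpha> \<in> carrier G. f \<alpha> \<in> UNIV} \<subseteq> topspace (aut_topology T \<Delta> A)"
    using saturated openin_subset by blast
  moreover have "topspace (aut_topology T \<Delta> A) \<subseteq> carrier G"
    using openin_topspace[of "aut_topology T \<Delta> A", unfolded openin_aut_topology] by (rule conjunct1)
  ultimately have topspace: "topspace (aut_topology T \<Delta> A) = carrier G"
    by auto
  have "carrier (out_group T \<Delta> A) = f ` carrier G"
    by (auto simp: out_group_def FactGroup_def RCOSETS_def f_def)
  then show ?thesis
    unfolding topology_eq out_topology_def f_def[symmetric] openin_quotient_topology topspace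
      openin_discrete_topology using saturated by auto
qed

end
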